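(* Let $d \geq 1$ and $K \geq 1$ be integers, and let $(\lambda_n)_{n\geq 1}$ be a nondecreasing sequence of positive real numbers such that $\lambda_n \to \infty$ and $\lambda_n^d / n \to 0$ as $n \to \infty$. Then, for every distribution of $(X,Y)$ on $[0,1]^d \times \{0,1\}$, the online Mondrian Forest classifier $\widehat g_n^{(K)}$ with $K$ trees and lifetime sequence $(\lambda_n)_{n \geq 1}$ is consistent, that is, $L(\widehat g_n^{(K)}) \to L^*$ in probability as $n \to \infty$.
   Context: Mondrian process. For a box $C = \prod_{j=1}^d [a_j,b_j]$, write $|C| = \sum_{j=1}^d (b_j-a_j)$. For $\lambda > 0$, $\mathrm{MP}(\lambda, C)$ is the distribution of the random tree partition of $C$ produced by calling $\mathrm{SplitCell}(C,0,\lambda)$, where $\mathrm{SplitCell}(A,\tau,\lambda)$, for a cell $A$ with sides $[a_j,b_j]$, is defined recursively: draw an exponential variable $E_A$ with rate $|A|$ (independent of everything else). If $\tau + E_A \leq \lambda$, draw a split dimension $J \in \{1,\dots,d\}$ with $\mathbb P(J=j) = (b_j-a_j)/|A|$ and a threshold $\nu$ uniform on $[a_J,b_J]$, split $A$ into $\{x \in A : x_J \leq \nu\}$ and $\{x \in A : x_J > \nu\}$, and call $\mathrm{SplitCell}(\cdot, \tau + E_A, \lambda)$ on both children (with fresh independent randomness). Otherwise do nothing, so $A$ is a leaf cell. The leaf cells form the partition. As $\lambda$ increases the partitions can be realized on the same probability space so that $M_{\lambda'}$ refines $M_\lambda$ for $\lambda \le \lambda'$ (by continuing to split the leaves between times $\lambda$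 and $\lambda'$). Data. $(X_1,Y_1), (X_2,Y_2),\dots$ are i.i.d. copies of $(X,Y) \in [0,1]^d \times \{0,1\}$, and $\mathcal D_n = ((X_1,Y_1),\dots,(X_n,Y_n))$. Online Mondrian Forest classifier. $K$ i.i.d. trees are grown, independently of the data and of $(X,Y)$. At time $n$, the $k$-th tree is a partition $M^{(k)}_{\lambda_n} \sim \mathrm{MP}(\lambda_n,[0,1]^d)$, obtained from $M^{(k)}_{\lambda_{n-1}}$ by extending its lifetime from $\lambda_{n-1}$ to $\lambda_n$ (with $\lambda_0 = 0$). The $k$-th tree classifier predicts at $x$ the majority label among the $Y_i$, $1\le i \le n$, such that $X_i$ lies in the leaf cell of $M^{(k)}_{\lambda_n}$ containing $x$ (label $0$ if the cell is empty or in case of a tie). The forest classifier $\widehat g_n^{(K)}(x)$ is the majority vote of the $K$ tree predictions (ties giving $0$). Risk. For a randomized classifier $g_n$ depending on $\mathcal D_n$ and on randomness $Z$ independent of $(X,Y),\mathcal D_n$, $L(g_n) = \mathbb P(g_n(X,Z,\mathcal D_n) \neq Y \mid \mathcal D_n)$, where $(X,Y)$ is independent of $\mathcal D_n$. With $\eta(x) = \mathbb P(Y=1\mid X=x)$, the Bayes classifier is $g^*(x) = \mathbf 1_{\{\eta(x) > 1/2\}}$ and $L^* = \mathbb P(g^*(X) \neq Y)$. *)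

theory Defs
  imports "HOL-Probability.Probability" "HOL-Library.Sublist"
begin

text \<open>A box is given by its lower and upper corner. The dimension is \<open>CARD('d)\<close>.\<close>

type_synonym 'd box = "(real ^ 'd) \<times> (real ^ 'd)"

definition side :: "'d::finite box \<Rightarrow> 'd \<Rightarrow> real" where
  "side A j = snd A $ j - fst A $ j"

definition box_size :: "'d::finite box \<Rightarrow> real" where
  "box_size A = (\<Sum>j\<in>UNIV. side A j)"

text \<open>The draw made for one cell: waiting time, split dimension and threshold.\<close>

type_synonym 'd draw = "real \<times> 'd \<times> real"

abbreviation draw_space :: "'d::finite draw measure" where
  "draw_space \<equiv> borel \<Otimes>\<^sub>M (count_space UNIV \<Otimes>\<^sub>M borel)"

text \<open>
  This is the null measure if \<open>A\<close> has size 0; such a cell arises with probability 0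
  when starting from a box with nonempty interior.
\<close>

definition split_draw :: "'d::finite box \<Rightarrow> 'd draw measure" where
  "split_draw A = do {
     e \<leftarrow> density lborel (exponential_density (box_size A));
     j \<leftarrow> point_measure UNIV (\<lambda>j. ennreal (side A j / box_size A));
     \<nu> \<leftarrow> uniform_measure lborel {fst A $ j .. snd A $ j};
     return draw_space (e, j, \<nu>)
   }"

lemma box_size_pos:
  assumes "\<And>j. side A j > 0"
  shows "box_size (A::'d::finite box) > 0"
  unfolding box_size_def using assms by (intro sum_pos) auto

lemma split_draw_in_prob_algebra:
  fixes A :: "'d::finite box"
  assumes "\<And>j. side A j > 0"
  shows "split_draw A \<in> space (prob_algebra draw_space)"
proof -
  note pos = box_size_pos[OF assms]
  let ?E = "density lborel (exponential_density (box_size A))"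
  let ?J = "point_measure UNIV (\<lambda>j. ennreal (side A j / box_size A))"
  let ?N = "\<lambda>j. uniform_measure lborel {fst A $ j .. snd A $ j}"
  have E: "prob_space ?E" by (rule prob_space_exponential_density[OF pos])
  have J: "prob_space ?J"
  proof
    have "(\<Sum>j\<in>UNIV. side A j / box_size A) = 1"
      using pos by (simp add: box_size_def flip: sum_divide_distrib)
    moreover have "side A j / box_size A \<ge> 0" for j using assms[of j] pos by simp
    ultimately show "emeasure ?J (space ?J) = 1"
      by (simp add: emeasure_point_measure_finite space_point_measure)
  qed
  have N: "prob_space (?N j)" for j
    using assms[of j] by (intro prob_space_uniform_measure) (auto simp: side_def)
  have Jp: "?J \<in> space (prob_algebra (count_space UNIV))"
    by (simp add: space_prob_algebra J sets_point_measure)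
  have Ep: "?E \<in> space (prob_algebra borel)" by (simp add: space_prob_algebra E)
  have Nk': "?N \<in> count_space UNIV \<rightarrow>\<^sub>M prob_algebra borel"
    by (auto simp: space_prob_algebra N)
  show ?thesis
    unfolding split_draw_def
  proof (rule measurable_space[OF measurable_bind_prob_space2[where f="\<lambda>_. ?E" and M="count_space {()}" and N=borel, of _ draw_space], of _ "()"])
    show "(\<lambda>_. ?E) \<in> count_space {()} \<rightarrow>\<^sub>M prob_algebra borel" using Ep by simp
    have "(\<lambda>p::unit\<times>real. ?J \<bind> (\<lambda>j. ?N j \<bind> (\<lambda>\<nu>. return draw_space (snd p, j, \<nu>))))
       \<in> count_space {()} \<Otimes>\<^sub>M borel \<rightarrow>\<^sub>M prob_algebra draw_space"
    proof (rule measurable_bind_prob_space2[where N="count_space UNIV"])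
      show "(\<lambda>p. ?J) \<in> count_space {()} \<Otimes>\<^sub>M borel \<rightarrow>\<^sub>M prob_algebra (count_space UNIV)"
        using Jp by (rule measurable_const)
      have "(\<lambda>q::(unit\<times>real)\<times>'d. ?N (snd q) \<bind> (\<lambda>\<nu>. return draw_space (snd (fst q), snd q, \<nu>)))
        \<in> (count_space {()} \<Otimes>\<^sub>M borel) \<Otimes>\<^sub>M count_space UNIV \<rightarrow>\<^sub>M prob_algebra draw_space"
      proof (rule measurable_bind_prob_space2[where N=borel])
        show "(\<lambda>q::(unit\<times>real)\<times>'d. ?N (snd q)) \<in> (count_space {()} \<Otimes>\<^sub>M borel) \<Otimes>\<^sub>M count_space UNIV \<rightarrow>\<^sub>M prob_algebra borel"
          by (rule measurable_compose[OF measurable_snd Nk'])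
        show "(\<lambda>(x::(unit\<times>real)\<times>'d, y). return draw_space (snd (fst x), snd x, y))
           \<in> ((count_space {()} \<Otimes>\<^sub>M borel) \<Otimes>\<^sub>M count_space UNIV) \<Otimes>\<^sub>M borel \<rightarrow>\<^sub>M prob_algebra draw_space"
          unfolding split_beta
          by (rule measurable_compose[OF _ measurable_return_prob_space]) measurable
      qed
      then show "(\<lambda>(x::unit\<times>real, y). ?N y \<bind> (\<lambda>\<nu>. return draw_space (snd x, y, \<nu>)))
         \<in> (count_space {()} \<Otimes>\<^sub>M borel) \<Otimes>\<^sub>M count_space UNIV \<rightarrow>\<^sub>M prob_algebra draw_space"
        by (simp add: split_beta)
    qed
    then show "(\<lambda>(x::unit, y). ?J \<bind> (\<lambda>j. ?N j \<bind> (\<lambda>\<nu>. return draw_space (y, j, \<nu>))))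
         \<in> count_space {()} \<Otimes>\<^sub>M borel \<rightarrow>\<^sub>M prob_algebra draw_space"
      by (simp add: split_beta)
  qed simp
qed
text \<open>
  Nodes of the binary tree are addressed by the list of choices leading to them, the most
  recent choice first; \<open>False\<close> is the child with \<open>x\<^sub>J \<le> \<nu>\<close>, \<open>True\<close> the one with \<open>x\<^sub>J > \<nu>\<close>.
  So the descendants of \<open>v\<close> (including \<open>v\<close>) are the \<open>u\<close> with \<open>suffix v u\<close>.
  A draw tree assigns a draw to every node; the partition with lifetime \<open>\<lambda>\<close> only depends on
  the draws at the nodes for which a recursive call is made before \<open>\<lambda>\<close>, and using one draw
  tree for all lifetimes yields the nested family of partitions.
\<close>

type_synonym node = "bool list"
type_synonym 'd draw_tree = "node \<Rightarrow> 'd draw"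

abbreviation draw_tree_space :: "'d::finite draw_tree measure" where
  "draw_tree_space \<equiv> Pi\<^sub>M UNIV (\<lambda>_. draw_space)"

fun split_box :: "bool \<Rightarrow> 'd::finite draw \<Rightarrow> 'd box \<Rightarrow> 'd box" where
  "split_box c (e, j, \<nu>) (a, b) =
     (if c then (\<chi> i. if i = j then \<nu> else a $ i, b) else (a, \<chi> i. if i = j then \<nu> else b $ i))"

fun split_set :: "bool \<Rightarrow> 'd::finite draw \<Rightarrow> (real ^ 'd) set \<Rightarrow> (real ^ 'd) set" where
  "split_set c (e, j, \<nu>) S = (if c then {x \<in> S. x $ j > \<nu>} else {x \<in> S. x $ j \<le> \<nu>})"

fun node_box :: "'d::finite box \<Rightarrow> 'd draw_tree \<Rightarrow> node \<Rightarrow> 'd box" where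
  "node_box C T [] = C"
| "node_box C T (c # v) = split_box c (T v) (node_box C T v)"

text \<open>The cell itself, which differs from \<^term>\<open>node_box C T v\<close> only by missing some faces.\<close>

fun node_cell :: "'d::finite box \<Rightarrow> 'd draw_tree \<Rightarrow> node \<Rightarrow> (real ^ 'd) set" where
  "node_cell C T [] = cbox (fst C) (snd C)"
| "node_cell C T (c # v) = split_set c (T v) (node_cell C T v)"

fun node_time :: "'d::finite draw_tree \<Rightarrow> node \<Rightarrow> real" where
  "node_time T [] = 0"
| "node_time T (c # v) = node_time T v + fst (T v)"

text \<open>\<open>node_called lam T v\<close>: SplitCell with lifetime \<open>lam\<close> is called for the cell at \<open>v\<close>.\<close>

fun node_called :: "real \<Rightarrow> 'd::finite draw_tree \<Rightarrow> node \<Rightarrow> bool" where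
  "node_called lam T [] = True"
| "node_called lam T (c # v) \<longleftrightarrow> node_called lam T v \<and> node_time T v + fst (T v) \<le> lam"

definition is_leaf :: "real \<Rightarrow> 'd::finite draw_tree \<Rightarrow> node \<Rightarrow> bool" where
  "is_leaf lam T v \<longleftrightarrow> node_called lam T v \<and> \<not> node_time T v + fst (T v) \<le> lam"

definition mondrian_partition ::
    "'d::finite box \<Rightarrow> real \<Rightarrow> 'd draw_tree \<Rightarrow> (real ^ 'd) set set" where
  "mondrian_partition C lam T = {node_cell C T v | v. is_leaf lam T v}"

text \<open>
  Given the draws at all nodes other than \<open>v\<close> and its descendants (these determine the cell
  at \<open>v\<close>), the draw at \<open>v\<close> has the law prescribed by SplitCell. This determines the law of
  the draw tree, by conditioning on the levels of the tree one after the other.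
\<close>

definition mondrian_process ::
    "'w measure \<Rightarrow> 'd::finite box \<Rightarrow> ('w \<Rightarrow> 'd draw_tree) \<Rightarrow> bool" where
  "mondrian_process M C T \<longleftrightarrow>
     T \<in> M \<rightarrow>\<^sub>M draw_tree_space \<and>
     (\<forall>v. \<forall>B \<in> sets draw_space. AE \<omega> in M.
        real_cond_exp M
          (vimage_algebra (space M) (\<lambda>\<omega>. restrict (T \<omega>) {u. \<not> suffix v u})
             (Pi\<^sub>M {u. \<not> suffix v u} (\<lambda>_. draw_space)))
          (indicat_real {\<omega> \<in> space M. T \<omega> v \<in> B}) \<omega>
        = measure (split_draw (node_box C (T \<omega>) v)) B)"

text \<open>Label 1 is \<open>True\<close>, label 0 is \<open>False\<close>.\<close>

type_synonym 'd sample = "(real ^ 'd) \<times> bool"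

abbreviation sample_space :: "'d::finite sample measure" where
  "sample_space \<equiv> borel \<Otimes>\<^sub>M count_space UNIV"

definition majority :: "'i set \<Rightarrow> ('i \<Rightarrow> bool) \<Rightarrow> bool" where
  "majority I y \<longleftrightarrow> card {i \<in> I. y i} > card {i \<in> I. \<not> y i}"

text \<open>
  Leaf cells of one tree are disjoint, so the union has at most one member. It is empty if no
  leaf contains \<open>x\<close>, which for \<open>x\<close> in the root box requires a nonterminating recursion and
  hence has probability 0.
\<close>

definition leaf_cell :: "(real ^ 'd) set set \<Rightarrow> real ^ 'd \<Rightarrow> (real ^ 'd) set" where
  "leaf_cell P x = \<Union> {A \<in> P. x \<in> A}"

definition tree_classify ::
    "(real ^ 'd) set set \<Rightarrow> nat \<Rightarrow> (nat \<Rightarrow> 'd sample) \<Rightarrow> real ^ 'd \<Rightarrow> bool" where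
  "tree_classify P n D x \<longleftrightarrow>
     majority {i \<in> {1..n}. fst (D i) \<in> leaf_cell P x} (\<lambda>i. snd (D i))"

definition mondrian_forest ::
    "nat \<Rightarrow> real \<Rightarrow> (nat \<Rightarrow> 'd::finite draw_tree) \<Rightarrow> nat \<Rightarrow> (nat \<Rightarrow> 'd sample) \<Rightarrow> real ^ 'd \<Rightarrow> bool" where
  "mondrian_forest K lam T n D x \<longleftrightarrow>
     majority {1..K} (\<lambda>k. tree_classify (mondrian_partition (0, 1) lam (T k)) n D x)"

text \<open>\<open>\<eta>\<close> is a version of \<open>x \<mapsto> P(Y = 1 | X = x)\<close>.\<close>

definition regression_function ::
    "'w measure \<Rightarrow> ('w \<Rightarrow> real ^ 'd::finite) \<Rightarrow> ('w \<Rightarrow> bool) \<Rightarrow> (real ^ 'd \<Rightarrow> real) \<Rightarrow> bool" where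
  "regression_function M X Y \<eta> \<longleftrightarrow>
     \<eta> \<in> borel_measurable borel \<and>
     (AE \<omega> in M. real_cond_exp M (vimage_algebra (space M) X borel)
        (indicat_real {\<omega> \<in> space M. Y \<omega>}) \<omega> = \<eta> (X \<omega>))"

definition bayes_classifier :: "(real ^ 'd \<Rightarrow> real) \<Rightarrow> real ^ 'd \<Rightarrow> bool" where
  "bayes_classifier \<eta> x \<longleftrightarrow> \<eta> x > 1 / 2"

definition bayes_risk ::
    "'w measure \<Rightarrow> ('w \<Rightarrow> real ^ 'd) \<Rightarrow> ('w \<Rightarrow> bool) \<Rightarrow> (real ^ 'd \<Rightarrow> real) \<Rightarrow> real" where
  "bayes_risk M X Y \<eta> = measure M {\<omega> \<in> space M. bayes_classifier \<eta> (X \<omega>) \<noteq> Y \<omega>}"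

definition conditional_risk ::
    "'w measure \<Rightarrow> ('w \<Rightarrow> real ^ 'd::finite) \<Rightarrow> ('w \<Rightarrow> bool) \<Rightarrow> (nat \<Rightarrow> 'w \<Rightarrow> 'd sample) \<Rightarrow> nat
      \<Rightarrow> ('w \<Rightarrow> real ^ 'd \<Rightarrow> bool) \<Rightarrow> 'w \<Rightarrow> real" where
  "conditional_risk M X Y D n g =
     real_cond_exp M
       (vimage_algebra (space M) (\<lambda>\<omega>. \<lambda>i\<in>{1..n}. D i \<omega>) (Pi\<^sub>M {1..n} (\<lambda>_. sample_space)))
       (indicat_real {\<omega> \<in> space M. g \<omega> (X \<omega>) \<noteq> Y \<omega>})"

definition tendsto_in_prob :: "'w measure \<Rightarrow> (nat \<Rightarrow> 'w \<Rightarrow> real) \<Rightarrow> real \<Rightarrow> bool" where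
  "tendsto_in_prob M U c \<longleftrightarrow>
     (\<forall>\<epsilon>>0. (\<lambda>n. measure M {\<omega> \<in> space M. \<bar>U n \<omega> - c\<bar> > \<epsilon>}) \<longlonglongrightarrow> 0)"

abbreviation sigma_gen :: "'w measure \<Rightarrow> ('w \<Rightarrow> 'a) \<Rightarrow> 'a measure \<Rightarrow> 'w set set" where
  "sigma_gen M X N \<equiv> sets (vimage_algebra (space M) X N)"

end

theory Submission
  imports Defs
begin

text \<open>
  Write \<open>h = 2\<eta> - 1\<close>, so that the excess risk of a classifier \<open>\<gamma>\<close> is the integral of \<open>|h|\<close> over the set
  where \<open>\<gamma>\<close> differs from the Bayes classifier. The forest can only err where some tree errs, hence it
  suffices that the expected excess risk of a single tree tends to 0; convergence in probability of the
  conditional risk then follows from Markov's inequality, because the excess is nonnegative.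

  For a fixed partition, Chebyshev's inequality shows that the excess risk of a cell \<open>A\<close> is at most
  \<open>\<integral>\<^sub>A |h - c| + \<theta> \<mu>(A) + 1/(\<theta> n)\<close> for every constant \<open>c\<close> and every \<open>\<theta> > 0\<close>. Summing over the leaves and replacing
  \<open>h\<close> by a continuous function, two facts about the Mondrian partition remain: the expected number
  of leaves is at most \<open>(1 + \<lambda>)\<^sup>d\<close>, and the expected number of leaves whose box contains a given box \<open>B\<close> is at
  most \<open>exp (- \<lambda> |B|)\<close>, which bounds the diameter of the leaf of a point. Both are
  supermartingale arguments along the recursion of SplitCell, with the potentials
  \<open>\<Prod>\<^sub>j (1 + (\<lambda> - \<tau>) side\<^sub>j)\<close> and \<open>exp (- |B| (\<lambda> - \<tau>))\<close> on the cells still to be split.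
\<close>

section \<open>Cells of the partition\<close>

text \<open>The law of the draw tree is given only through conditional expectations, one node and
  one event at a time. The bridge to computation is \<open>nn_integral_draw\<close>: with the
  history of a node frozen, its draw is integrated against an explicit density. All probabilistic
  estimates on the partition rest on it. The recursion might not terminate, so potentials are
  compared generation by generation and the generation still alive is dropped, being nonnegative;
  that almost every point lies in a leaf needs its own argument. Both potentials are exact
  expectations and balance the recursion with equality: a box B inside a cell is missed by all cuts
  of the remaining lifetime with probability exp(-|B|(\<lambda> - \<tau>)), and the product is the
  mean number of leaves below a cell. The two assumptions on the lifetimes pull in opposite
  directions: \<lambda> tending to infinity makes the leaf of a point small, while \<lambda>^d / n
  tending to 0 makes the number of leaves divided by n vanish, which is the total price of the
  Chebyshev bounds.\<close>

lemma subalgebra_vimage_algebra: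
  assumes "f \<in> M \<rightarrow>\<^sub>M N"
  shows "subalgebra M (vimage_algebra (space M) f N)"
proof -
  have "f \<in> space M \<rightarrow> space N" by (rule funcsetI) (rule measurable_space[OF assms])
  then show ?thesis
    using measurable_sets[OF assms] by (auto simp: subalgebra_def sets_vimage_algebra2)
qed


lemma borel_measurable_vec_iff:
  fixes f :: "'a \<Rightarrow> real ^ 'd::finite"
  shows "f \<in> borel_measurable M \<longleftrightarrow> (\<forall>i. (\<lambda>x. f x $ i) \<in> borel_measurable M)"
  by (subst borel_measurable_euclidean_space)
     (auto simp: Basis_vec_def inner_axis)

lemma borel_measurable_vec_nth [measurable (raw)]:
  fixes f :: "'a \<Rightarrow> real ^ 'd::finite"
  assumes "f \<in> borel_measurable M"
  shows "(\<lambda>x. f x $ i) \<in> borel_measurable M"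
  using assms borel_measurable_vec_iff by blast

lemma borel_measurable_vec_upd [measurable (raw)]:
  fixes f :: "'a \<Rightarrow> real ^ 'd::finite"
  assumes [measurable]: "f \<in> borel_measurable M" "g \<in> borel_measurable M"
    "j \<in> M \<rightarrow>\<^sub>M count_space UNIV"
  shows "(\<lambda>x. \<chi> i. if i = j x then g x else f x $ i) \<in> borel_measurable M"
proof -
  have [measurable]: "Measurable.pred M (\<lambda>x. i = j x)" for i
    by measurable
  show ?thesis
    by (subst borel_measurable_vec_iff) (simp, measurable)
qed

section \<open>Measurability of boxes, times and cells in the draws\<close>

abbreviation box_space :: "'d::finite box measure" where
  "box_space \<equiv> borel \<Otimes>\<^sub>M borel"

lemma split_box_eq:
  "split_box c z A =
     (if c then (\<chi> i. if i = fst (snd z) then snd (snd z) else fst A $ i, snd A)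
      else (fst A, \<chi> i. if i = fst (snd z) then snd (snd z) else snd A $ i))"
proof -
  obtain e j \<nu> a b where "z = (e, j, \<nu>)" "A = (a, b)" by (metis surj_pair)
  then show ?thesis by (simp cong: if_cong)
qed

lemma split_set_eq:
  "split_set c z S = {x \<in> S. if c then x $ fst (snd z) > snd (snd z) else x $ fst (snd z) \<le> snd (snd z)}"
  by (cases z; cases "snd z") simp

lemma measurable_split_box [measurable (raw)]:
  fixes A :: "'a \<Rightarrow> 'd::finite box"
  assumes [measurable]: "f \<in> M \<rightarrow>\<^sub>M draw_space" "A \<in> M \<rightarrow>\<^sub>M box_space"
  shows "(\<lambda>x. split_box c (f x) (A x)) \<in> M \<rightarrow>\<^sub>M box_space"
  unfolding split_box_eq by (cases c) simp_all

lemma measurable_side [measurable (raw)]: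
  fixes A :: "'a \<Rightarrow> 'd::finite box"
  assumes [measurable]: "A \<in> M \<rightarrow>\<^sub>M box_space"
  shows "(\<lambda>x. side (A x) j) \<in> borel_measurable M"
  unfolding side_def by measurable

lemma measurable_box_size [measurable (raw)]:
  fixes A :: "'a \<Rightarrow> 'd::finite box"
  assumes [measurable]: "A \<in> M \<rightarrow>\<^sub>M box_space"
  shows "(\<lambda>x. box_size (A x)) \<in> borel_measurable M"
  unfolding box_size_def by measurable

text \<open>Only draws at proper ancestors of \<open>w\<close>, the \<open>u\<close> with
  \<open>w = v @ c # u\<close>, are assumed measurable. This form applies to the history of
  \<open>w\<close>, a sigma-algebra that does not see the draw at \<open>w\<close> itself.\<close>

lemma
  assumes "\<And>c u v. w = v @ c # u \<Longrightarrow> (\<lambda>x. T x u) \<in> M \<rightarrow>\<^sub>M draw_space"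
  shows measurable_node_box: "(\<lambda>x. node_box C (T x) w) \<in> M \<rightarrow>\<^sub>M box_space"
    and measurable_node_time: "(\<lambda>x. node_time (T x) w) \<in> borel_measurable M"
    and measurable_node_called: "Measurable.pred M (\<lambda>x. node_called lam (T x) w)"
proof -
  have "(\<lambda>x. node_box C (T x) w) \<in> M \<rightarrow>\<^sub>M box_space \<and> (\<lambda>x. node_time (T x) w) \<in> borel_measurable M
      \<and> Measurable.pred M (\<lambda>x. node_called lam (T x) w)"
    using assms
  proof (induction w)
    case (Cons a w)
    have [measurable]: "(\<lambda>x. T x w) \<in> M \<rightarrow>\<^sub>M draw_space"
      using Cons.prems[of "[]" a w] by simp
    have *[measurable]: "(\<lambda>x. node_box C (T x) w) \<in> M \<rightarrow>\<^sub>M box_space"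
       "(\<lambda>x. node_time (T x) w) \<in> borel_measurable M"
       "Measurable.pred M (\<lambda>x. node_called lam (T x) w)"
      using Cons.IH Cons.prems[of "a # _"] by auto
    show ?case by simp
  qed (simp add: space_pair_measure)
  then show "(\<lambda>x. node_box C (T x) w) \<in> M \<rightarrow>\<^sub>M box_space" "(\<lambda>x. node_time (T x) w) \<in> borel_measurable M"
     "Measurable.pred M (\<lambda>x. node_called lam (T x) w)"
    by auto
qed

lemma measurable_draw_tree_nth [measurable (raw)]:
  assumes "T \<in> M \<rightarrow>\<^sub>M draw_tree_space"
  shows "(\<lambda>x. T x v) \<in> M \<rightarrow>\<^sub>M draw_space"
  using measurable_compose[OF assms measurable_component_singleton[of v UNIV]] by simp

lemma
  assumes "T \<in> M \<rightarrow>\<^sub>M draw_tree_space"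
  shows measurable_node_box' [measurable (raw)]: "(\<lambda>x. node_box C (T x) w) \<in> M \<rightarrow>\<^sub>M box_space"
    and measurable_node_time' [measurable (raw)]: "(\<lambda>x. node_time (T x) w) \<in> borel_measurable M"
    and measurable_node_called' [measurable (raw)]: "Measurable.pred M (\<lambda>x. node_called lam (T x) w)"
  using measurable_draw_tree_nth[OF assms]
  by (auto intro!: measurable_node_box measurable_node_time measurable_node_called)

lemma measurable_is_leaf [measurable (raw)]:
  assumes [measurable]: "T \<in> M \<rightarrow>\<^sub>M draw_tree_space"
  shows "Measurable.pred M (\<lambda>x. is_leaf lam (T x) w)"
  unfolding is_leaf_def by measurable

lemma measurable_in_node_cell [measurable (raw)]:
  assumes [measurable]: "T \<in> M \<rightarrow>\<^sub>M draw_tree_space" "f \<in> borel_measurable M"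
  shows "Measurable.pred M (\<lambda>x. f x \<in> node_cell C (T x) w)"
proof (induction w)
  case Nil
  show ?case by (simp, measurable)
next
  case (Cons c w)
  note [measurable] = Cons
  have [measurable]: "(\<lambda>x. f x $ fst (snd (T x w))) \<in> borel_measurable M"
    by (rule measurable_compose_countable'[where I=UNIV and f="\<lambda>j x. f x $ j"]) measurable
  show ?case by (cases c) (simp_all add: split_set_eq)
qed

lemma node_cell_measurable [measurable]: "node_cell C t w \<in> sets borel"
proof (induction w)
  case (Cons c w)
  have "split_set c (t w) (node_cell C t w) =
    node_cell C t w \<inter> {x. if c then x $ fst (snd (t w)) > snd (snd (t w)) else x $ fst (snd (t w)) \<le> snd (snd (t w))}"
    by (auto simp: split_set_eq)
  also have "\<dots> \<in> sets borel"
    using Cons by (cases c) (intro sets.Int; simp)+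
  finally show ?case by simp
qed simp

section \<open>Nesting and disjointness of cells\<close>

lemma node_cell_subset_node_box:
  "node_cell C t w \<subseteq> cbox (fst (node_box C t w)) (snd (node_box C t w))"
proof (induction w)
  case (Cons c w)
  then show ?case
    by (force simp: split_set_eq split_box_eq subset_eq mem_box_cart)
qed simp

lemma node_cell_subset_root: "node_cell C t w \<subseteq> cbox (fst C) (snd C)"
  by (induction w) (auto simp: split_set_eq)

lemma node_cell_append: "node_cell C t (u @ v) \<subseteq> node_cell C t v"
  by (induction u) (auto simp: split_set_eq)

lemma node_called_append: "node_called lam t (u @ v) \<Longrightarrow> node_called lam t v"
  by (induction u) auto

text \<open>Every node strictly below a leaf passes through a child of it, and a child is called
  only if the split occurs by time \<open>lam\<close>.\<close>

lemma is_leaf_not_called_append: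
  assumes "is_leaf lam t v" "u \<noteq> []" shows "\<not> node_called lam t (u @ v)"
proof -
  obtain w c where "u = w @ [c]" using assms(2) by (metis rev_exhaust)
  then show ?thesis using assms(1) node_called_append[of lam t w "c # v"]
    by (auto simp: is_leaf_def)
qed

text \<open>Nodes put the latest choice first, so two unrelated nodes branch at their longest common suffix.\<close>

lemma node_cell_disjoint:
  assumes "\<not> suffix u v" "\<not> suffix v u"
  shows "node_cell C t u \<inter> node_cell C t v = {}"
proof -
  from assms have "\<not> prefix (rev u) (rev v)" "\<not> prefix (rev v) (rev u)"
    by (simp_all add: suffix_to_prefix)
  then have "rev u \<parallel> rev v" by auto
  from parallel_decomp[OF this] obtain as b bs c cs
    where *: "b \<noteq> c" "rev u = as @ b # bs" "rev v = as @ c # cs" by blast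
  have "u = rev (as @ b # bs)" "v = rev (as @ c # cs)"
    using *(2,3) by (metis rev_rev_ident)+
  then have u: "u = rev bs @ (b # rev as)" and v: "v = rev cs @ (c # rev as)" by simp_all
  have "node_cell C t (b # rev as) \<inter> node_cell C t (c # rev as) = {}"
    using * by (cases b; cases c) (auto simp: split_set_eq)
  then show ?thesis
    using node_cell_append[of C t "rev bs" "b # rev as"] node_cell_append[of C t "rev cs" "c # rev as"]
    unfolding u v by blast
qed

lemma leaf_cells_disjoint:
  assumes "is_leaf lam t u" "is_leaf lam t v" "u \<noteq> v"
  shows "node_cell C t u \<inter> node_cell C t v = {}"
proof (rule node_cell_disjoint)
  show "\<not> suffix u v"
    using assms is_leaf_not_called_append[OF assms(1)] by (auto simp: suffix_def is_leaf_def)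
  show "\<not> suffix v u"
    using assms is_leaf_not_called_append[OF assms(2)] by (auto simp: suffix_def is_leaf_def)
qed

lemma leaf_cell_mondrian_partition:
  assumes "is_leaf lam t v" "x \<in> node_cell C t v"
  shows "leaf_cell (mondrian_partition C lam t) x = node_cell C t v"
proof -
  have "{A \<in> mondrian_partition C lam t. x \<in> A} = {node_cell C t v}"
  proof (intro set_eqI iffI)
    fix A assume "A \<in> {A \<in> mondrian_partition C lam t. x \<in> A}"
    then obtain u where u: "A = node_cell C t u" "is_leaf lam t u" "x \<in> node_cell C t u"
      by (auto simp: mondrian_partition_def)
    then have "v = u" using leaf_cells_disjoint[OF assms(1) u(2)] assms(2) by blast
    then show "A \<in> {node_cell C t v}" using u by simp
  qed (use assms in \<open>auto simp: mondrian_partition_def\<close>)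
  then show ?thesis by (simp add: leaf_cell_def)
qed

text \<open>Descending always into the child that contains \<open>x\<close> can stop only at a leaf.
  A point in no leaf therefore witnesses a nonterminating recursion, with called nodes at every
  depth; \<open>AE_point_in_leaf\<close> shows that this has probability 0.\<close>

lemma exists_called_node_of_length:
  assumes "x \<in> cbox (fst C) (snd C)" "\<And>v. is_leaf lam t v \<Longrightarrow> x \<notin> node_cell C t v"
  shows "\<exists>v. length v = m \<and> node_called lam t v \<and> x \<in> node_cell C t v"
proof (induction m)
  case 0
  show ?case using assms(1) by (intro exI[of _ "[]"]) simp
next
  case (Suc m)
  then obtain v where v: "length v = m" "node_called lam t v" "x \<in> node_cell C t v" by blast
  with assms(2)[of v] have "node_time t v + fst (t v) \<le> lam" by (auto simp: is_leaf_def)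
  with v show ?case
    by (intro exI[of _ "(x $ fst (snd (t v)) > snd (snd (t v))) # v"]) (auto simp: split_set_eq)
qed

section \<open>The law of a draw given the other draws\<close>

text \<open>\<open>draw_space\<close> fixes only a sigma-algebra; this is the reference measure on
  it with respect to which the law of a draw gets a density.\<close>

abbreviation draw_base :: "'d::finite draw measure" where
  "draw_base \<equiv> lborel \<Otimes>\<^sub>M (count_space UNIV \<Otimes>\<^sub>M lborel)"

lemma sets_draw_base [measurable_cong]: "sets draw_base = sets draw_space"
  by (intro sets_pair_measure_cong) simp_all

lemma
  shows sigma_finite_draw_base: "sigma_finite_measure (draw_base :: 'd::finite draw measure)"
    and nn_integral_draw_base: "f \<in> borel_measurable draw_space \<Longrightarrow>
      (\<integral>\<^sup>+z. f z \<partial>(draw_base :: 'd::finite draw measure)) = (\<integral>\<^sup>+e. (\<Sum>j\<in>UNIV. \<integral>\<^sup>+\<nu>. f (e, j, \<nu>) \<partial>lborel) \<partial>lborel)"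
proof -
  interpret J: sigma_finite_measure "count_space (UNIV :: 'd set)"
    by (rule sigma_finite_measure_count_space_finite) simp
  interpret JN: pair_sigma_finite "count_space (UNIV :: 'd set)" "lborel :: real measure" ..
  have JN: "sigma_finite_measure (count_space (UNIV :: 'd set) \<Otimes>\<^sub>M (lborel :: real measure))" ..
  interpret B: pair_sigma_finite "lborel :: real measure" "count_space (UNIV :: 'd set) \<Otimes>\<^sub>M (lborel :: real measure)" ..
  show "sigma_finite_measure (draw_base :: 'd draw measure)" ..
  assume "f \<in> borel_measurable draw_space"
  then have [measurable]: "f \<in> borel_measurable draw_base"
    using measurable_cong_sets[OF sets_draw_base refl] by blast
  show "(\<integral>\<^sup>+z. f z \<partial>(draw_base :: 'd draw measure)) = (\<integral>\<^sup>+e. (\<Sum>j\<in>UNIV. \<integral>\<^sup>+\<nu>. f (e, j, \<nu>) \<partial>lborel) \<partial>lborel)"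
    by (subst sigma_finite_measure.nn_integral_fst[OF JN, symmetric], simp, intro nn_integral_cong,
        subst lborel.nn_integral_fst[symmetric], simp, simp add: nn_integral_count_space_finite)
qed

text \<open>The density of \<open>split_draw A\<close>: the normalisations |A| of the waiting time,
  side j / |A| of the dimension and 1 / side j of the threshold multiply to 1. What is left contains
  no division and is jointly measurable in the box and the draw.\<close>

definition draw_density :: "'d::finite box \<Rightarrow> 'd draw \<Rightarrow> ennreal" where
  "draw_density A z = indicator {0..} (fst z) * ennreal (exp (- box_size A * fst z)) *
     indicator {fst A $ fst (snd z) .. snd A $ fst (snd z)} (snd (snd z))"

lemma measurable_vec_nth_countable [measurable (raw)]:
  fixes f :: "'a \<Rightarrow> real ^ 'd::finite"
  assumes [measurable]: "f \<in> borel_measurable M" "j \<in> M \<rightarrow>\<^sub>M count_space UNIV"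
  shows "(\<lambda>x. f x $ j x) \<in> borel_measurable M"
  by (rule measurable_compose_countable'[where I=UNIV and f="\<lambda>j x. f x $ j"]) measurable

lemma measurable_draw_density [measurable (raw)]:
  assumes [measurable]: "A \<in> M \<rightarrow>\<^sub>M box_space" "f \<in> M \<rightarrow>\<^sub>M draw_space"
  shows "(\<lambda>x. draw_density (A x) (f x)) \<in> borel_measurable M"
  unfolding draw_density_def indicator_def atLeastAtMost_iff atLeast_iff by measurable

lemma measurable_draw_density_const: "draw_density A \<in> borel_measurable draw_space"
  by (intro measurable_draw_density[of "\<lambda>_. A" _ "\<lambda>z. z"]) (simp_all add: space_pair_measure)

text \<open>The three binds are resolved from the inside out, in fact \<open>3\<close> for the
  threshold, fact \<open>2\<close> for the dimension, and then the waiting time; \<open>k3\<close>,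
  \<open>k2'\<close> and \<open>k1\<close> provide the measurability of the kernels.\<close>

lemma emeasure_split_draw:
  fixes A :: "'d::finite box"
  assumes pos: "\<And>j. side A j > 0" and [measurable]: "B \<in> sets draw_space"
  shows "emeasure (split_draw A) B = (\<integral>\<^sup>+z. draw_density A z * indicator B z \<partial>draw_base)"
proof -
  note L = box_size_pos[OF pos]
  let ?E = "density lborel (exponential_density (box_size A))"
  let ?J = "point_measure UNIV (\<lambda>j. ennreal (side A j / box_size A))"
  let ?N = "\<lambda>j. uniform_measure lborel {fst A $ j .. snd A $ j}"
  have N: "prob_space (?N j)" for j
    using pos[of j] by (intro prob_space_uniform_measure) (auto simp: side_def)
  have J: "prob_space ?J"
  proof
    have "(\<Sum>j\<in>UNIV. side A j / box_size A) = 1"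
      using L by (simp add: box_size_def flip: sum_divide_distrib)
    moreover have "side A j / box_size A \<ge> 0" for j using pos[of j] L by simp
    ultimately show "emeasure ?J (space ?J) = 1"
      by (simp add: emeasure_point_measure_finite space_point_measure)
  qed
  have Jp: "?J \<in> space (prob_algebra (count_space UNIV))"
    by (simp add: space_prob_algebra J sets_point_measure)
  have Nk [measurable]: "?N \<in> count_space UNIV \<rightarrow>\<^sub>M prob_algebra borel"
    by (auto simp: space_prob_algebra N)
  have k3: "(\<lambda>\<nu>. return draw_space (e, j, \<nu>)) \<in> borel \<rightarrow>\<^sub>M prob_algebra draw_space"
    for e :: real and j :: 'd
    by (rule measurable_compose[OF _ measurable_return_prob_space]) measurable
  have k2: "(\<lambda>q. ?N (snd q) \<bind> (\<lambda>\<nu>. return draw_space (fst q, snd q, \<nu>)))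
      \<in> borel \<Otimes>\<^sub>M count_space UNIV \<rightarrow>\<^sub>M prob_algebra draw_space"
  proof (rule measurable_bind_prob_space2[where N=borel])
    show "(\<lambda>q. ?N (snd q)) \<in> borel \<Otimes>\<^sub>M count_space UNIV \<rightarrow>\<^sub>M prob_algebra borel"
      by (rule measurable_compose[OF measurable_snd Nk])
    show "(\<lambda>(q::real \<times> 'd, y). return draw_space (fst q, snd q, y))
        \<in> (borel \<Otimes>\<^sub>M count_space UNIV) \<Otimes>\<^sub>M borel \<rightarrow>\<^sub>M prob_algebra draw_space"
      unfolding split_beta
      by (rule measurable_compose[OF _ measurable_return_prob_space]) measurable
  qed
  have k2': "(\<lambda>j. ?N j \<bind> (\<lambda>\<nu>. return draw_space (e, j, \<nu>)))
      \<in> count_space UNIV \<rightarrow>\<^sub>M prob_algebra draw_space" for e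
    using measurable_compose[OF measurable_Pair1' k2, of e] by simp
  have k1: "(\<lambda>e. ?J \<bind> (\<lambda>j. ?N j \<bind> (\<lambda>\<nu>. return draw_space (e, j, \<nu>))))
      \<in> borel \<rightarrow>\<^sub>M prob_algebra draw_space"
  proof (rule measurable_bind_prob_space2[where N="count_space UNIV"])
    show "(\<lambda>p. ?J) \<in> borel \<rightarrow>\<^sub>M prob_algebra (count_space UNIV)"
      using Jp by (rule measurable_const)
    show "(\<lambda>(e::real, y). ?N y \<bind> (\<lambda>\<nu>. return draw_space (e, y, \<nu>)))
         \<in> borel \<Otimes>\<^sub>M count_space UNIV \<rightarrow>\<^sub>M prob_algebra draw_space"
      using k2 by (simp add: split_beta)
  qed
  have 3: "emeasure (?N j \<bind> (\<lambda>\<nu>. return draw_space (e, j, \<nu>))) B =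
      (\<integral>\<^sup>+\<nu>. indicator {fst A $ j .. snd A $ j} \<nu> * indicator B (e, j, \<nu>) \<partial>lborel) / ennreal (side A j)"
    for e j
  proof -
    have "emeasure (?N j \<bind> (\<lambda>\<nu>. return draw_space (e, j, \<nu>))) B
        = (\<integral>\<^sup>+\<nu>. emeasure (return draw_space (e, j, \<nu>)) B \<partial>?N j)"
      by (rule emeasure_bind[where N=draw_space])
        (use measurable_prob_algebraD[OF k3[of e j]] in \<open>simp_all cong: measurable_cong_sets\<close>)
    also have "\<dots> = (\<integral>\<^sup>+\<nu>. indicator B (e, j, \<nu>) \<partial>?N j)"
      by (simp add: emeasure_return)
    also have "\<dots> = (\<integral>\<^sup>+\<nu>. indicator B (e, j, \<nu>) * indicator {fst A $ j .. snd A $ j} \<nu> \<partial>lborel)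
          / emeasure lborel {fst A $ j .. snd A $ j}"
      by (rule nn_integral_uniform_measure) simp_all
    finally show ?thesis using pos[of j] by (simp add: side_def mult.commute)
  qed
  have 2: "emeasure (?J \<bind> (\<lambda>j. ?N j \<bind> (\<lambda>\<nu>. return draw_space (e, j, \<nu>)))) B =
      (\<Sum>j\<in>UNIV. (\<integral>\<^sup>+\<nu>. indicator {fst A $ j .. snd A $ j} \<nu> * indicator B (e, j, \<nu>) \<partial>lborel)) / ennreal (box_size A)"
    for e
  proof -
    have "emeasure (?J \<bind> (\<lambda>j. ?N j \<bind> (\<lambda>\<nu>. return draw_space (e, j, \<nu>)))) B
        = (\<integral>\<^sup>+j. emeasure (?N j \<bind> (\<lambda>\<nu>. return draw_space (e, j, \<nu>))) B \<partial>?J)"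
      by (rule emeasure_bind[where N=draw_space])
        (use measurable_prob_algebraD[OF k2'[of e]] in \<open>simp_all cong: measurable_cong_sets add: sets_point_measure space_point_measure\<close>)
    also have "\<dots> = (\<Sum>j\<in>UNIV. ennreal (side A j / box_size A) *
       ((\<integral>\<^sup>+\<nu>. indicator {fst A $ j .. snd A $ j} \<nu> * indicator B (e, j, \<nu>) \<partial>lborel) / ennreal (side A j)))"
      by (subst nn_integral_point_measure_finite) (simp_all add: 3 mult.commute)
    also have "\<dots> = (\<Sum>j\<in>UNIV. (\<integral>\<^sup>+\<nu>. indicator {fst A $ j .. snd A $ j} \<nu> * indicator B (e, j, \<nu>) \<partial>lborel)
         / ennreal (box_size A))"
    proof (rule sum.cong[OF refl])
      fix j
      let ?I = "\<integral>\<^sup>+\<nu>. indicator {fst A $ j .. snd A $ j} \<nu> * indicator B (e, j, \<nu>) \<partial>lborel"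
      have "ennreal (side A j / box_size A) * (?I / ennreal (side A j))
        = ?I * (ennreal (side A j / box_size A) * inverse (ennreal (side A j)))"
        by (simp add: divide_ennreal_def ac_simps)
      also have "ennreal (side A j / box_size A) * inverse (ennreal (side A j)) = inverse (ennreal (box_size A))"
        using pos[of j] L by (simp add: inverse_ennreal field_simps flip: ennreal_mult)
      finally show "ennreal (side A j / box_size A) * (?I / ennreal (side A j)) = ?I / ennreal (box_size A)"
        by (simp add: divide_ennreal_def)
    qed
    finally show ?thesis by (simp add: divide_ennreal_def sum_distrib_right)
  qed
  have "emeasure (split_draw A) B = (\<integral>\<^sup>+e. emeasure (?J \<bind> (\<lambda>j. ?N j \<bind> (\<lambda>\<nu>. return draw_space (e, j, \<nu>)))) B \<partial>?E)"
    unfolding split_draw_def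
    by (rule emeasure_bind[where N=draw_space])
        (use measurable_prob_algebraD[OF k1] in \<open>simp_all cong: measurable_cong_sets\<close>)
  also have "\<dots> = (\<integral>\<^sup>+e. ennreal (exponential_density (box_size A) e) *
       ((\<Sum>j\<in>UNIV. (\<integral>\<^sup>+\<nu>. indicator {fst A $ j .. snd A $ j} \<nu> * indicator B (e, j, \<nu>) \<partial>lborel)) / ennreal (box_size A)) \<partial>lborel)"
    unfolding 2 divide_ennreal_def by (subst nn_integral_density) measurable
  also have "\<dots> = (\<integral>\<^sup>+e. (indicator {0..} e * ennreal (exp (- box_size A * e))) *
       (\<Sum>j\<in>UNIV. (\<integral>\<^sup>+\<nu>. indicator {fst A $ j .. snd A $ j} \<nu> * indicator B (e, j, \<nu>) \<partial>lborel)) \<partial>lborel)"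
  proof (rule nn_integral_cong)
    fix e :: real
    let ?S = "\<Sum>j\<in>UNIV. (\<integral>\<^sup>+\<nu>. indicator {fst A $ j .. snd A $ j} \<nu> * indicator B (e, j, \<nu>) \<partial>lborel)"
    have "ennreal (exponential_density (box_size A) e) * (?S / ennreal (box_size A))
      = (ennreal (exponential_density (box_size A) e) * inverse (ennreal (box_size A))) * ?S"
      by (simp add: divide_ennreal_def ac_simps)
    also have "ennreal (exponential_density (box_size A) e) * inverse (ennreal (box_size A))
       = indicator {0..} e * ennreal (exp (- box_size A * e))"
      using L by (auto simp: exponential_density_def inverse_ennreal field_simps simp flip: ennreal_mult split: split_indicator)
    finally show "ennreal (exponential_density (box_size A) e) * (?S / ennreal (box_size A)) =
      (indicator {0..} e * ennreal (exp (- box_size A * e))) * ?S" .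
  qed
  also have "\<dots> = (\<integral>\<^sup>+z. draw_density A z * indicator B z \<partial>draw_base)"
    by (subst nn_integral_draw_base)
       (auto intro!: nn_integral_cong simp: space_pair_measure draw_density_def sum_distrib_left mult.assoc nn_integral_cmult[symmetric])
  finally show ?thesis .
qed

locale mondrian_tree = prob_space M for M :: "'w measure" +
  fixes C :: "'d::finite box" and T :: "'w \<Rightarrow> 'd draw_tree"
  assumes process: "mondrian_process M C T"
    and root_pos: "\<And>j. side C j > 0"
begin

lemma measurable_T [measurable]: "T \<in> M \<rightarrow>\<^sub>M draw_tree_space"
  using process by (simp add: mondrian_process_def)

text \<open>The sigma-algebra on which \<open>mondrian_process\<close> conditions the draw at
  \<open>v\<close>. It sees the draws at all proper ancestors, hence the box and time of
  \<open>v\<close> and whether \<open>v\<close> is called.\<close>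

definition hist :: "node \<Rightarrow> 'w measure" where
  "hist v = vimage_algebra (space M) (\<lambda>\<omega>. restrict (T \<omega>) {u. \<not> suffix v u})
             (Pi\<^sub>M {u. \<not> suffix v u} (\<lambda>_. draw_space))"

lemma space_hist [simp]: "space (hist v) = space M"
  by (simp add: hist_def)

lemma measurable_hist: "(\<lambda>x. x) \<in> M \<rightarrow>\<^sub>M hist v"
  unfolding hist_def by (intro measurable_vimage_algebra2) measurable

lemma subalgebra_hist: "subalgebra M (hist v)"
  unfolding hist_def by (intro subalgebra_vimage_algebra) measurable

lemma measurable_hist_draw:
  assumes "\<not> suffix v u"
  shows "(\<lambda>\<omega>. T \<omega> u) \<in> hist v \<rightarrow>\<^sub>M draw_space"
proof -
  have "(\<lambda>\<omega>. restrict (T \<omega>) {u. \<not> suffix v u}) \<in> hist v \<rightarrow>\<^sub>M Pi\<^sub>M {u. \<not> suffix v u} (\<lambda>_. draw_space)"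
    unfolding hist_def
    by (rule measurable_vimage_algebra1) (use measurable_space[OF measurable_T] in \<open>auto simp: space_PiM PiE_iff\<close>)
  from measurable_compose[OF this measurable_component_singleton[of u]] assms
  show ?thesis by simp
qed

lemma
  shows measurable_hist_box [measurable]: "(\<lambda>x. node_box C (T x) v) \<in> hist v \<rightarrow>\<^sub>M box_space"
    and measurable_hist_time [measurable]: "(\<lambda>x. node_time (T x) v) \<in> borel_measurable (hist v)"
    and measurable_hist_called [measurable]: "Measurable.pred (hist v) (\<lambda>x. node_called lam (T x) v)"
proof -
  have "(\<lambda>\<omega>. T \<omega> u) \<in> hist v \<rightarrow>\<^sub>M draw_space" if "v = w @ c # u" for c u w
    by (rule measurable_hist_draw) (use that in \<open>auto dest: suffix_length_le\<close>)
  then show "(\<lambda>x. node_box C (T x) v) \<in> hist v \<rightarrow>\<^sub>M box_space"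
    "(\<lambda>x. node_time (T x) v) \<in> borel_measurable (hist v)"
    "Measurable.pred (hist v) (\<lambda>x. node_called lam (T x) v)"
    by (auto intro!: measurable_node_box measurable_node_time measurable_node_called)
qed

text \<open>\<open>mondrian_process\<close> treats one event for the draw at a time, outside a null
  set that depends on the event. Uniqueness of measures on rectangles extends it to every jointly
  measurable function of the history and the draw.\<close>

lemma nn_integral_draw:
  assumes pos: "AE \<omega> in M. \<forall>j. side (node_box C (T \<omega>) v) j > 0"
    and [measurable]: "case_prod \<psi> \<in> borel_measurable (hist v \<Otimes>\<^sub>M draw_space)"
  shows "(\<integral>\<^sup>+\<omega>. \<psi> \<omega> (T \<omega> v) \<partial>M) =
    (\<integral>\<^sup>+\<omega>. \<integral>\<^sup>+z. draw_density (node_box C (T \<omega>) v) z * \<psi> \<omega> z \<partial>draw_base \<partial>M)"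
proof -
  let ?D = "draw_space :: 'd draw measure"
  let ?N = "hist v \<Otimes>\<^sub>M ?D"
  let ?b = "\<lambda>\<omega>. node_box C (T \<omega>) v"
  interpret sub: finite_measure_subalgebra M "hist v"
    by standard (rule subalgebra_hist)
  interpret B: sigma_finite_measure draw_base by (rule sigma_finite_draw_base)
  note [measurable] = measurable_hist
  \<comment> \<open>\<open>hist v\<close> is coarser than \<open>M\<close>, so the identity is
    measurable into the product with \<open>hist v\<close>. Both measures below live on that
    product.\<close>
  have id: "(\<lambda>x. x) \<in> M \<Otimes>\<^sub>M draw_base \<rightarrow>\<^sub>M ?N"
    by (rule measurable_pair) (simp_all add: comp_def measurable_compose[OF measurable_fst measurable_hist])
  have [measurable]: "(\<lambda>\<omega>. (\<omega>, T \<omega> v)) \<in> M \<rightarrow>\<^sub>M ?N" by measurable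
  \<comment> \<open>\<open>\<mu>1\<close> is the joint law of history and draw;
    \<open>\<mu>2\<close> is the law that the density predicts.\<close>
  define \<mu>1 where "\<mu>1 = distr M ?N (\<lambda>\<omega>. (\<omega>, T \<omega> v))"
  define \<mu>2 where "\<mu>2 = distr (density (M \<Otimes>\<^sub>M draw_base) (\<lambda>(\<omega>, z). draw_density (?b \<omega>) z)) ?N (\<lambda>x. x)"
  have int2: "(\<integral>\<^sup>+x. f x \<partial>\<mu>2) = (\<integral>\<^sup>+\<omega>. \<integral>\<^sup>+z. draw_density (?b \<omega>) z * f (\<omega>, z) \<partial>draw_base \<partial>M)"
    if f[measurable]: "f \<in> borel_measurable ?N" for f
  proof -
    have [measurable]: "f \<in> borel_measurable (M \<Otimes>\<^sub>M draw_base)"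
      using measurable_compose[OF id f] by simp
    have "(\<integral>\<^sup>+x. f x \<partial>\<mu>2) = (\<integral>\<^sup>+x. f x \<partial>density (M \<Otimes>\<^sub>M draw_base) (\<lambda>(\<omega>, z). draw_density (?b \<omega>) z))"
      unfolding \<mu>2_def by (rule nn_integral_distr) (use id in simp_all)
    also have "\<dots> = (\<integral>\<^sup>+x. (case x of (\<omega>, z) \<Rightarrow> draw_density (?b \<omega>) z) * f x \<partial>(M \<Otimes>\<^sub>M draw_base))"
      by (rule nn_integral_density) measurable
    finally show ?thesis
      by (simp add: B.nn_integral_fst[symmetric])
  qed
  have "\<mu>1 = \<mu>2"
  proof (rule measure_eqI_generator_eq[OF Int_stable_pair_measure_generator[of "hist v" ?D], where
        \<Omega>="space (hist v) \<times> space ?D" and A="\<lambda>_. space (hist v) \<times> space ?D"])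
    show "{a \<times> b |a b. a \<in> sets (hist v) \<and> b \<in> sets ?D} \<subseteq> Pow (space (hist v) \<times> space ?D)"
      by (rule pair_measure_closed)
    show "sets \<mu>1 = sigma_sets (space (hist v) \<times> space ?D) {a \<times> b |a b. a \<in> sets (hist v) \<and> b \<in> sets ?D}"
      "sets \<mu>2 = sigma_sets (space (hist v) \<times> space ?D) {a \<times> b |a b. a \<in> sets (hist v) \<and> b \<in> sets ?D}"
      by (simp_all add: \<mu>1_def \<mu>2_def sets_pair_measure)
    show "range (\<lambda>_. space (hist v) \<times> space ?D) \<subseteq> {a \<times> b |a b. a \<in> sets (hist v) \<and> b \<in> sets ?D}"
      using sets.top by blast
    show "(\<Union>i::nat. space (hist v) \<times> space ?D) = space (hist v) \<times> space ?D" by simp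
    show "emeasure \<mu>1 (space (hist v) \<times> space ?D) \<noteq> \<infinity>"
      unfolding \<mu>1_def infinity_ennreal_def by (intro finite_measure.emeasure_finite finite_measure_distr) simp
    fix S assume "S \<in> {a \<times> b |a b. a \<in> sets (hist v) \<and> b \<in> sets ?D}"
    then obtain a b where S: "S = a \<times> b" and [measurable]: "a \<in> sets (hist v)" "b \<in> sets ?D" by auto
    have [measurable]: "a \<in> sets M" using subalgebra_hist[of v] by (auto simp: subalgebra_def)
    let ?I = "indicat_real {\<omega> \<in> space M. T \<omega> v \<in> b}"
    have AE_ce: "AE \<omega> in M. real_cond_exp M (hist v) ?I \<omega> = measure (split_draw (?b \<omega>)) b"
      using process unfolding mondrian_process_def hist_def by auto
    have ce_pos: "AE \<omega> in M. real_cond_exp M (hist v) ?I \<omega> \<ge> 0"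
      by (rule sub.real_cond_exp_pos) auto
    have ce_int: "integrable M ?I" by (intro integrable_real_indicator) (auto simp: less_top[symmetric])
    have "emeasure \<mu>1 S = emeasure M {\<omega> \<in> space M. \<omega> \<in> a \<and> T \<omega> v \<in> b}"
      unfolding \<mu>1_def S by (subst emeasure_distr) (auto intro!: arg_cong[where f="emeasure M"])
    also have "\<dots> = ennreal (\<integral>\<omega>\<in>a. ?I \<omega> \<partial>M)"
    proof -
      have "(\<integral>\<omega>\<in>a. ?I \<omega> \<partial>M) = (\<integral>\<omega>. indicator {\<omega> \<in> space M. \<omega> \<in> a \<and> T \<omega> v \<in> b} \<omega> \<partial>M)"
        unfolding set_lebesgue_integral_def by (intro Bochner_Integration.integral_cong) (auto split: split_indicator)
      also have "\<dots> = measure M {\<omega> \<in> space M. \<omega> \<in> a \<and> T \<omega> v \<in> b}" by simp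
      finally show ?thesis by (simp add: emeasure_eq_measure)
    qed
    \<comment> \<open>As \<open>a\<close> is a history event, the indicator may be exchanged for its
      conditional expectation, which the process assumption identifies.\<close>
    also have "(\<integral>\<omega>\<in>a. ?I \<omega> \<partial>M) = (\<integral>\<omega>\<in>a. real_cond_exp M (hist v) ?I \<omega> \<partial>M)"
      by (rule sub.real_cond_exp_intA[OF ce_int]) simp
    also have "ennreal \<dots> = (\<integral>\<^sup>+\<omega>. ennreal (indicator a \<omega> * real_cond_exp M (hist v) ?I \<omega>) \<partial>M)"
      unfolding set_lebesgue_integral_def real_scaleR_def
      by (rule nn_integral_eq_integral[symmetric])
         (use ce_pos sub.real_cond_exp_int(1)[OF ce_int] in \<open>auto intro!: integrable_real_mult_indicator simp: mult.commute[of "indicator _ _"]\<close>)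
    \<comment> \<open>Positive sides enter here: they make \<open>split_draw\<close> a probability
      measure with density \<open>draw_density\<close>.\<close>
    also have "\<dots> = (\<integral>\<^sup>+\<omega>. \<integral>\<^sup>+z. draw_density (?b \<omega>) z * indicator S (\<omega>, z) \<partial>draw_base \<partial>M)"
    proof (rule nn_integral_cong_AE, use AE_ce pos in eventually_elim)
      case (elim \<omega>)
      have "ennreal (measure (split_draw (?b \<omega>)) b) = emeasure (split_draw (?b \<omega>)) b"
        using split_draw_in_prob_algebra[of "?b \<omega>"] elim
        by (intro finite_measure.emeasure_eq_measure[symmetric] prob_space.finite_measure)
           (auto simp: space_prob_algebra)
      then have "ennreal (indicator a \<omega> * real_cond_exp M (hist v) ?I \<omega>)
          = indicator a \<omega> * (\<integral>\<^sup>+z. draw_density (?b \<omega>) z * indicator b z \<partial>draw_base)"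
        using elim by (simp add: ennreal_mult emeasure_split_draw ennreal_indicator split: split_indicator)
      then show ?case
        by (simp add: S indicator_times split: split_indicator)
    qed
    also have "\<dots> = emeasure \<mu>2 S"
      by (subst nn_integral_indicator[symmetric]) (auto simp: int2 S \<mu>2_def[symmetric], simp add: \<mu>2_def)
    finally show "emeasure \<mu>1 S = emeasure \<mu>2 S" .
  qed
  then have "(\<integral>\<^sup>+x. case_prod \<psi> x \<partial>\<mu>1) = (\<integral>\<^sup>+x. case_prod \<psi> x \<partial>\<mu>2)" by simp
  then show ?thesis
    by (simp add: int2 \<mu>1_def nn_integral_distr)
qed

end

section \<open>Potentials of the recursion\<close>

lemma sum_nodes_Suc:
  "(\<Sum>v | length v = Suc m. f v) = (\<Sum>v | length v = m. f (False # v) + f (True # v))"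
  for f :: "node \<Rightarrow> 'a::comm_monoid_add"
proof -
  have eq: "{v :: node. length v = Suc m} = (#) False ` {v. length v = m} \<union> (#) True ` {v. length v = m}"
    by (auto simp: length_Suc_conv image_iff)
  have fin: "finite {v :: node. length v = m}"
    using finite_lists_length_eq[of "UNIV :: bool set" m] by simp
  show ?thesis
    unfolding eq by (subst sum.union_disjoint) (use fin in \<open>auto simp: sum.reindex sum.distrib\<close>)
qed

text \<open>Every generation is finite, so grading by depth gives a series of finite sums. It serves
  both to pass from bounds on generations to all nodes and to prove sums over nodes
  measurable.\<close>

lemma nn_integral_nodes:
  "(\<integral>\<^sup>+v. f v \<partial>count_space UNIV) = (\<Sum>m. \<Sum>v | length v = m. f v)" for f :: "node \<Rightarrow> ennreal"
proof -
  have fin: "finite {v :: node. length v = m}" for m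
    using finite_lists_length_eq[of "UNIV :: bool set" m] by simp
  have "f v = (\<Sum>m. f v * indicator {v. length v = m} v)" for v
    by (subst suminf_finite[of "{length v}"]) auto
  then have "(\<integral>\<^sup>+v. f v \<partial>count_space UNIV) = (\<integral>\<^sup>+v. (\<Sum>m. f v * indicator {v. length v = m} v) \<partial>count_space UNIV)"
    by simp
  also have "\<dots> = (\<Sum>m. \<integral>\<^sup>+v. f v * indicator {v. length v = m} v \<partial>count_space UNIV)"
    by (rule nn_integral_suminf) simp
  also have "\<dots> = (\<Sum>m. \<Sum>v | length v = m. f v)"
  proof (intro suminf_cong)
    fix m
    have "(\<integral>\<^sup>+v. f v * indicator {v. length v = m} v \<partial>count_space UNIV) = (\<integral>\<^sup>+v. f v \<partial>count_space {v. length v = m})"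
      by (subst nn_integral_restrict_space[symmetric]) (auto simp: restrict_count_space)
    then show "(\<integral>\<^sup>+v. f v * indicator {v. length v = m} v \<partial>count_space UNIV) = (\<Sum>v | length v = m. f v)"
      using fin by (simp add: nn_integral_count_space_finite)
  qed
  finally show ?thesis .
qed

text \<open>
  One generation of the recursion, applied to a function \<open>\<Psi>\<close> of the time and the box of a cell:
  the factor \<open>|A|\<close> of the exponential density cancels against the weights of the split dimension
  and threshold, so that cuts arrive at unit rate per unit of length.
\<close>

definition step_op :: "real \<Rightarrow> (real \<Rightarrow> 'd::finite box \<Rightarrow> ennreal) \<Rightarrow> real \<Rightarrow> 'd box \<Rightarrow> ennreal" where
  "step_op lam \<Psi> \<tau> A = (\<integral>\<^sup>+e. indicator {0..lam - \<tau>} e * ennreal (exp (- box_size A * e)) *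
     (\<Sum>j\<in>UNIV. \<integral>\<^sup>+\<nu>. indicator {fst A $ j .. snd A $ j} \<nu> *
        (\<Psi> (\<tau> + e) (split_box False (e, j, \<nu>) A) + \<Psi> (\<tau> + e) (split_box True (e, j, \<nu>) A)) \<partial>lborel) \<partial>lborel)"

text \<open>The almost sure invariant of the recursion. Strictness of
  \<open>fst A $ j < snd A $ j\<close> keeps away from degenerate boxes, where
  \<open>split_draw\<close> need not be a probability measure.\<close>

definition good_cell :: "'d::finite box \<Rightarrow> real \<Rightarrow> 'd box \<Rightarrow> bool" where
  "good_cell C \<tau> A \<longleftrightarrow> 0 \<le> \<tau> \<and>
     (\<forall>j. fst A $ j < snd A $ j \<and> fst C $ j \<le> fst A $ j \<and> snd A $ j \<le> snd C $ j)"

context mondrian_tree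
begin

text \<open>Induction along the path to the node: the invariant at \<open>v\<close> gives the
  positive sides that \<open>nn_integral_draw\<close> demands, and integrating the failure indicator
  \<open>\<psi>\<close> of the child then gives 0.\<close>

lemma AE_good_cell: "AE \<omega> in M. good_cell C (node_time (T \<omega>) v) (node_box C (T \<omega>) v)"
proof (induction v)
  case Nil
  show ?case using root_pos by (simp add: good_cell_def side_def)
next
  case (Cons c v)
  let ?b = "\<lambda>\<omega>. node_box C (T \<omega>) v" and ?t = "\<lambda>\<omega>. node_time (T \<omega>) v"
  define \<psi> :: "'w \<Rightarrow> 'd draw \<Rightarrow> ennreal" where
    "\<psi> \<omega> z = (if good_cell C (?t \<omega> + fst z) (split_box c z (?b \<omega>)) then 0 else 1)" for \<omega> z
  have m\<psi> [measurable]: "case_prod \<psi> \<in> borel_measurable (hist v \<Otimes>\<^sub>M draw_space)"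
    unfolding \<psi>_def good_cell_def by measurable
  have pos: "AE \<omega> in M. \<forall>j. side (?b \<omega>) j > 0"
    using Cons by eventually_elim (auto simp: good_cell_def side_def)
  have [measurable]: "(\<lambda>\<omega>. \<psi> \<omega> (T \<omega> v)) \<in> borel_measurable M"
    unfolding \<psi>_def good_cell_def by measurable
  have "(\<integral>\<^sup>+\<omega>. \<psi> \<omega> (T \<omega> v) \<partial>M) = (\<integral>\<^sup>+\<omega>. \<integral>\<^sup>+z. draw_density (?b \<omega>) z * \<psi> \<omega> z \<partial>draw_base \<partial>M)"
    by (rule nn_integral_draw[OF pos]) measurable
  also have "\<dots> = (\<integral>\<^sup>+\<omega>. 0 \<partial>M)"
  proof (rule nn_integral_cong_AE, use Cons AE_space in \<open>eventually_elim\<close>)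
    case (elim \<omega>)
    have [measurable]: "\<psi> \<omega> \<in> borel_measurable draw_space"
      using measurable_Pair2[OF m\<psi>, of \<omega>] elim by simp
    have "(\<integral>\<^sup>+\<nu>. draw_density (?b \<omega>) (e, j, \<nu>) * \<psi> \<omega> (e, j, \<nu>) \<partial>lborel) = (\<integral>\<^sup>+\<nu>. 0 \<partial>(lborel :: real measure))" for e j
    proof (rule nn_integral_cong_AE)
      \<comment> \<open>A cut exactly at an endpoint would produce a child with an empty side; each
        endpoint is a Lebesgue null set.\<close>
      have ne: "AE \<nu> in lborel. \<nu> \<noteq> (x::real)" for x
        by (rule AE_lborel_singleton)
      show "AE \<nu> in lborel. draw_density (?b \<omega>) (e, j, \<nu>) * \<psi> \<omega> (e, j, \<nu>) = 0"
        using ne[of "fst (?b \<omega>) $ j"] ne[of "snd (?b \<omega>) $ j"]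
      proof eventually_elim
        case (elim \<nu>)
        have "good_cell C (?t \<omega> + e) (split_box c (e, j, \<nu>) (?b \<omega>))"
          if "0 \<le> e" "fst (?b \<omega>) $ j < \<nu>" "\<nu> < snd (?b \<omega>) $ j"
        proof -
          have b: "fst C $ i \<le> fst (?b \<omega>) $ i" "snd (?b \<omega>) $ i \<le> snd C $ i" "fst (?b \<omega>) $ i < snd (?b \<omega>) $ i" for i
            using \<open>good_cell C (?t \<omega>) (?b \<omega>)\<close> by (auto simp: good_cell_def)
          have "fst C $ j \<le> \<nu>" "\<nu> \<le> snd C $ j"
            using b[of j] that by linarith+
          with b that \<open>good_cell C (?t \<omega>) (?b \<omega>)\<close>
          show ?thesis by (auto simp: good_cell_def split_box_eq)
        qed
        with elim show ?case
          by (auto simp: \<psi>_def draw_density_def split: split_indicator)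
      qed
    qed
    moreover have "(\<lambda>z. draw_density (?b \<omega>) z * \<psi> \<omega> z) \<in> borel_measurable draw_space"
      by (intro borel_measurable_times_ennreal measurable_draw_density_const) simp
    ultimately show ?case
      by (subst nn_integral_draw_base) simp_all
  qed
  finally have "AE \<omega> in M. \<psi> \<omega> (T \<omega> v) = 0"
    by (simp add: nn_integral_0_iff_AE)
  then show ?case
    by eventually_elim (auto simp: \<psi>_def split: if_splits)
qed

lemma AE_side_pos: "AE \<omega> in M. \<forall>j. side (node_box C (T \<omega>) v) j > 0"
  using AE_good_cell[of v] by eventually_elim (auto simp: good_cell_def side_def)

text \<open>In the language of branching processes, the integral of \<Psi> against the intensity
  measure of the m-th generation of called cells.\<close>

definition level :: "real \<Rightarrow> nat \<Rightarrow> (real \<Rightarrow> 'd box \<Rightarrow> ennreal) \<Rightarrow> ennreal" where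
  "level lam m \<Psi> = (\<Sum>v | length v = m. \<integral>\<^sup>+\<omega>. indicator {\<omega>. node_called lam (T \<omega>) v} \<omega> *
      \<Psi> (node_time (T \<omega>) v) (node_box C (T \<omega>) v) \<partial>M)"

lemma measurable_step_op:
  assumes [measurable]: "case_prod \<Psi> \<in> borel_measurable (borel \<Otimes>\<^sub>M box_space)"
  shows "case_prod (step_op lam \<Psi>) \<in> borel_measurable (borel \<Otimes>\<^sub>M box_space)"
  unfolding step_op_def indicator_def atLeastAtMost_iff by measurable

lemma level_0: "0 \<le> lam \<Longrightarrow> level lam 0 \<Psi> = \<Psi> 0 C"
  by (simp add: level_def emeasure_space_1)

text \<open>Given the history of \<open>v\<close>, the joint contribution of its two children is a
  function of the draw at \<open>v\<close>; integrating that draw out yields \<open>step_op\<close>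
  at the time and box of \<open>v\<close>.\<close>

lemma level_Suc:
  assumes [measurable]: "case_prod \<Psi> \<in> borel_measurable (borel \<Otimes>\<^sub>M box_space)"
  shows "level lam (Suc m) \<Psi> = level lam m (step_op lam \<Psi>)"
  unfolding level_def sum_nodes_Suc
proof (rule sum.cong[OF refl])
  fix v
  let ?b = "\<lambda>\<omega>. node_box C (T \<omega>) v" and ?t = "\<lambda>\<omega>. node_time (T \<omega>) v"
  let ?call = "\<lambda>\<omega>. node_called lam (T \<omega>) v"
  let ?f = "\<lambda>w. \<integral>\<^sup>+\<omega>. indicator {\<omega>. node_called lam (T \<omega>) w} \<omega> * \<Psi> (node_time (T \<omega>) w) (node_box C (T \<omega>) w) \<partial>M"
  define \<psi> :: "'w \<Rightarrow> 'd draw \<Rightarrow> ennreal" where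
    "\<psi> \<omega> z = (if ?call \<omega> \<and> ?t \<omega> + fst z \<le> lam then
       \<Psi> (?t \<omega> + fst z) (split_box False z (?b \<omega>)) + \<Psi> (?t \<omega> + fst z) (split_box True z (?b \<omega>)) else 0)" for \<omega> z
  have m\<psi> [measurable]: "case_prod \<psi> \<in> borel_measurable (hist v \<Otimes>\<^sub>M draw_space)"
    unfolding \<psi>_def by measurable
  have "?f (False # v) + ?f (True # v) = (\<integral>\<^sup>+\<omega>. \<psi> \<omega> (T \<omega> v) \<partial>M)"
    unfolding indicator_def mem_Collect_eq
    by (subst nn_integral_add[symmetric]) (auto intro!: nn_integral_cong simp: \<psi>_def)
  also have "\<dots> = (\<integral>\<^sup>+\<omega>. \<integral>\<^sup>+z. draw_density (?b \<omega>) z * \<psi> \<omega> z \<partial>draw_base \<partial>M)"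
    by (rule nn_integral_draw[OF AE_side_pos]) measurable
  also have "\<dots> = (\<integral>\<^sup>+\<omega>. indicator {\<omega>. ?call \<omega>} \<omega> * step_op lam \<Psi> (?t \<omega>) (?b \<omega>) \<partial>M)"
  proof (rule nn_integral_cong)
    fix \<omega> assume "\<omega> \<in> space M"
    then have [measurable]: "\<psi> \<omega> \<in> borel_measurable draw_space"
      using measurable_Pair2[OF m\<psi>, of \<omega>] by simp
    have [measurable]: "(\<lambda>z. draw_density (?b \<omega>) z * \<psi> \<omega> z) \<in> borel_measurable draw_space"
      by (intro borel_measurable_times_ennreal measurable_draw_density_const) simp
    have "(\<integral>\<^sup>+z. draw_density (?b \<omega>) z * \<psi> \<omega> z \<partial>draw_base) =
      (\<integral>\<^sup>+e. (\<Sum>j\<in>UNIV. \<integral>\<^sup>+\<nu>. draw_density (?b \<omega>) (e, j, \<nu>) * \<psi> \<omega> (e, j, \<nu>) \<partial>lborel) \<partial>lborel)"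
      by (subst nn_integral_draw_base) simp_all
    also have "\<dots> = indicator {\<omega>. ?call \<omega>} \<omega> * step_op lam \<Psi> (?t \<omega>) (?b \<omega>)"
    proof (cases "?call \<omega>")
      case True
      have [measurable]: "(\<lambda>\<nu>. split_box c (e, j, \<nu>) (?b \<omega>)) \<in> borel \<rightarrow>\<^sub>M box_space" for c e j
        by (rule measurable_split_box) (simp_all add: space_pair_measure)
      from True show ?thesis
        unfolding step_op_def
        by (auto intro!: nn_integral_cong sum.cong simp: \<psi>_def draw_density_def sum_distrib_left
              nn_integral_cmult[symmetric] mult.assoc split: split_indicator)
    qed (simp add: \<psi>_def)
    finally show "(\<integral>\<^sup>+z. draw_density (?b \<omega>) z * \<psi> \<omega> z \<partial>draw_base) = indicator {\<omega>. ?call \<omega>} \<omega> * step_op lam \<Psi> (?t \<omega>) (?b \<omega>)" .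
  qed
  finally show "?f (False # v) + ?f (True # v) = (\<integral>\<^sup>+\<omega>. indicator {\<omega>. ?call \<omega>} \<omega> * step_op lam \<Psi> (?t \<omega>) (?b \<omega>) \<partial>M)" .
qed

text \<open>Called nodes have time at most \<open>lam\<close>, and almost surely all cells are good,
  so the pointwise comparison is required only there.\<close>

lemma level_mono:
  assumes "\<And>\<tau> A. good_cell C \<tau> A \<Longrightarrow> \<tau> \<le> lam \<Longrightarrow> F \<tau> A \<le> G \<tau> A" "0 \<le> lam"
  shows "level lam m F \<le> level lam m G"
  unfolding level_def
proof (rule sum_mono, rule nn_integral_mono_AE)
  fix v
  have called: "node_time t v \<le> lam" if "node_called lam t v" for t :: "'d draw_tree"
    using that assms(2) by (cases v) auto
  show "AE \<omega> in M. indicator {\<omega>. node_called lam (T \<omega>) v} \<omega> * F (node_time (T \<omega>) v) (node_box C (T \<omega>) v)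
    \<le> indicator {\<omega>. node_called lam (T \<omega>) v} \<omega> * G (node_time (T \<omega>) v) (node_box C (T \<omega>) v)"
    using AE_good_cell[of v]
    by eventually_elim (auto intro!: assms(1) called split: split_indicator)
qed

text \<open>Given its history, a called cell A with time \<tau> stays unsplit up to
  \<open>lam\<close> with probability exp(-|A|(lam - \<tau>)), the tail of the exponential waiting
  time.\<close>

lemma leaf_integral:
  assumes [measurable]: "\<rho> \<in> borel_measurable box_space" and "0 \<le> lam"
  shows "(\<integral>\<^sup>+\<omega>. indicator {\<omega>. is_leaf lam (T \<omega>) v} \<omega> * \<rho> (node_box C (T \<omega>) v) \<partial>M)
    = (\<integral>\<^sup>+\<omega>. indicator {\<omega>. node_called lam (T \<omega>) v} \<omega> *
        (ennreal (exp (- box_size (node_box C (T \<omega>) v) * (lam - node_time (T \<omega>) v))) * \<rho> (node_box C (T \<omega>) v)) \<partial>M)"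
proof -
  let ?b = "\<lambda>\<omega>. node_box C (T \<omega>) v" and ?t = "\<lambda>\<omega>. node_time (T \<omega>) v"
  let ?call = "\<lambda>\<omega>. node_called lam (T \<omega>) v"
  define \<psi> :: "'w \<Rightarrow> 'd draw \<Rightarrow> ennreal" where
    "\<psi> \<omega> z = (if ?call \<omega> \<and> \<not> ?t \<omega> + fst z \<le> lam then \<rho> (?b \<omega>) else 0)" for \<omega> z
  have m\<psi> [measurable]: "case_prod \<psi> \<in> borel_measurable (hist v \<Otimes>\<^sub>M draw_space)"
    unfolding \<psi>_def by measurable
  have "(\<integral>\<^sup>+\<omega>. indicator {\<omega>. is_leaf lam (T \<omega>) v} \<omega> * \<rho> (node_box C (T \<omega>) v) \<partial>M) = (\<integral>\<^sup>+\<omega>. \<psi> \<omega> (T \<omega> v) \<partial>M)"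
    by (auto intro!: nn_integral_cong simp: \<psi>_def is_leaf_def)
  also have "\<dots> = (\<integral>\<^sup>+\<omega>. \<integral>\<^sup>+z. draw_density (?b \<omega>) z * \<psi> \<omega> z \<partial>draw_base \<partial>M)"
    by (rule nn_integral_draw[OF AE_side_pos]) measurable
  also have "\<dots> = (\<integral>\<^sup>+\<omega>. indicator {\<omega>. ?call \<omega>} \<omega> * (ennreal (exp (- box_size (?b \<omega>) * (lam - ?t \<omega>))) * \<rho> (?b \<omega>)) \<partial>M)"
  proof (rule nn_integral_cong_AE, use AE_good_cell[of v] AE_space in eventually_elim)
    case (elim \<omega>)
    have [measurable]: "\<psi> \<omega> \<in> borel_measurable draw_space"
      using measurable_Pair2[OF m\<psi>, of \<omega>] elim by simp
    have mdens: "(\<lambda>z. draw_density (?b \<omega>) z * \<psi> \<omega> z) \<in> borel_measurable draw_space"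
      by (intro borel_measurable_times_ennreal measurable_draw_density_const) simp
    show ?case
    proof (cases "?call \<omega>")
      case True
      let ?L = "box_size (?b \<omega>)"
      define s where "s = lam - ?t \<omega>"
      have s: "s \<ge> 0" using True \<open>0 \<le> lam\<close> by (cases v) (auto simp: s_def)
      have sides: "side (?b \<omega>) j > 0" for j using elim by (auto simp: good_cell_def side_def)
      have L: "?L > 0" by (rule box_size_pos) (rule sides)
      have I: "(\<integral>\<^sup>+\<nu>. draw_density (?b \<omega>) (e, j, \<nu>) * \<psi> \<omega> (e, j, \<nu>) \<partial>lborel)
          = ennreal (side (?b \<omega>) j) * (indicator {s<..} e * ennreal (exp (- ?L * e)) * \<rho> (?b \<omega>))" for e j
      proof -
        \<comment> \<open>Since \<open>s\<close> is nonnegative, the condition e > s absorbs the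
          restriction of the density to nonnegative times.\<close>
        have "draw_density (?b \<omega>) (e, j, \<nu>) * \<psi> \<omega> (e, j, \<nu>) =
          (indicator {s<..} e * ennreal (exp (- ?L * e)) * \<rho> (?b \<omega>)) * indicator {fst (?b \<omega>) $ j..snd (?b \<omega>) $ j} \<nu>" for \<nu>
          using s True by (auto simp: draw_density_def \<psi>_def s_def split: split_indicator)
        then have "(\<integral>\<^sup>+\<nu>. draw_density (?b \<omega>) (e, j, \<nu>) * \<psi> \<omega> (e, j, \<nu>) \<partial>lborel) =
          (indicator {s<..} e * ennreal (exp (- ?L * e)) * \<rho> (?b \<omega>)) * emeasure lborel {fst (?b \<omega>) $ j..snd (?b \<omega>) $ j}"
          by (simp only: nn_integral_cmult_indicator sets_lborel atLeastAtMost_borel)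
        then show ?thesis
          using sides[of j] by (simp add: side_def mult.commute)
      qed
      have [measurable]: "(\<lambda>z. draw_density (?b \<omega>) z * \<psi> \<omega> z) \<in> borel_measurable draw_space"
      by (intro borel_measurable_times_ennreal measurable_draw_density_const) simp
    have "(\<integral>\<^sup>+z. draw_density (?b \<omega>) z * \<psi> \<omega> z \<partial>draw_base) =
        (\<integral>\<^sup>+e. (\<Sum>j\<in>UNIV. ennreal (side (?b \<omega>) j)) * (indicator {s<..} e * ennreal (exp (- ?L * e)) * \<rho> (?b \<omega>)) \<partial>lborel)"
        using mdens by (subst nn_integral_draw_base) (simp_all add: I sum_distrib_right)
      also have "(\<Sum>j\<in>UNIV. ennreal (side (?b \<omega>) j)) = ennreal ?L"
        unfolding box_size_def by (rule sum_ennreal) (use sides in \<open>auto intro: less_imp_le\<close>)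
      also have "(\<integral>\<^sup>+e. ennreal ?L * (indicator {s<..} e * ennreal (exp (- ?L * e)) * \<rho> (?b \<omega>)) \<partial>lborel)
         = (\<integral>\<^sup>+e. ennreal (?L * exp (- ?L * e)) * indicator {s<..} e * \<rho> (?b \<omega>) \<partial>lborel)"
        using L by (simp add: ennreal_mult ac_simps)
      also have "\<dots> = (\<integral>\<^sup>+e. ennreal (?L * exp (- ?L * e)) * indicator {s<..} e \<partial>lborel) * \<rho> (?b \<omega>)"
        by (rule nn_integral_multc) simp
      \<comment> \<open>Closing the half-line at \<open>s\<close> changes a null set and gives the
        form required by the fundamental theorem of calculus.\<close>
      also have "(\<integral>\<^sup>+e. ennreal (?L * exp (- ?L * e)) * indicator {s<..} e \<partial>lborel)
          = (\<integral>\<^sup>+e. ennreal (?L * exp (- ?L * e)) * indicator {s..} e \<partial>lborel)"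
        by (rule nn_integral_cong_AE, use AE_lborel_singleton[of s] in eventually_elim) (auto split: split_indicator)
      also have "\<dots> = ennreal (0 - (- exp (- ?L * s)))"
      proof (rule nn_integral_FTC_atLeast)
        show "((\<lambda>e. - exp (- ?L * e)) \<longlongrightarrow> 0) at_top"
        proof -
          have "LIM e at_top. (- ?L) * e :> at_bot"
            using L by (intro filterlim_tendsto_neg_mult_at_bot[OF tendsto_const] filterlim_ident) auto
          from tendsto_minus[OF filterlim_compose[OF exp_at_bot this]] show ?thesis by simp
        qed
      qed (use L in \<open>auto intro!: derivative_eq_intros\<close>)
      finally show ?thesis
        using True by (simp add: s_def)
    qed (simp add: \<psi>_def)
  qed
  finally show ?thesis .
qed

text \<open>The supermartingale argument: the potential of a cell pays for its chance of being a
  leaf, weighted by \<rho>, and for the potentials of its children. So the leaves of the first m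
  generations together with the potential of generation m never exceed the initial value.\<close>

lemma potential_bound:
  assumes m\<Psi> [measurable]: "case_prod \<Psi> \<in> borel_measurable (borel \<Otimes>\<^sub>M box_space)"
    and m\<rho> [measurable]: "\<rho> \<in> borel_measurable box_space" and lam: "0 \<le> lam"
    and step: "\<And>\<tau> A. good_cell C \<tau> A \<Longrightarrow> \<tau> \<le> lam \<Longrightarrow>
      ennreal (exp (- box_size A * (lam - \<tau>))) * \<rho> A + step_op lam \<Psi> \<tau> A \<le> \<Psi> \<tau> A"
  shows "(\<integral>\<^sup>+v. \<integral>\<^sup>+\<omega>. indicator {\<omega>. is_leaf lam (T \<omega>) v} \<omega> * \<rho> (node_box C (T \<omega>) v) \<partial>M \<partial>count_space UNIV) \<le> \<Psi> 0 C"
proof -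
  let ?f = "\<lambda>v. \<integral>\<^sup>+\<omega>. indicator {\<omega>. is_leaf lam (T \<omega>) v} \<omega> * \<rho> (node_box C (T \<omega>) v) \<partial>M"
  have lev: "(\<Sum>v | length v = m. ?f v) = level lam m (\<lambda>\<tau> A. ennreal (exp (- box_size A * (lam - \<tau>))) * \<rho> A)" for m
    unfolding level_def by (rule sum.cong[OF refl], rule leaf_integral[OF m\<rho> lam])
  have add: "level lam m F + level lam m G = level lam m (\<lambda>\<tau> A. F \<tau> A + G \<tau> A)"
    if [measurable]: "case_prod F \<in> borel_measurable (borel \<Otimes>\<^sub>M box_space)" "case_prod G \<in> borel_measurable (borel \<Otimes>\<^sub>M box_space)" for m F G
    unfolding level_def indicator_def mem_Collect_eq
    by (subst sum.distrib[symmetric], rule sum.cong[OF refl], subst nn_integral_add[symmetric]) (auto simp: distrib_left)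
  have "(\<Sum>i<m. \<Sum>v | length v = i. ?f v) + level lam m \<Psi> \<le> \<Psi> 0 C" for m
  proof (induction m)
    case 0
    show ?case using level_0[OF lam, of \<Psi>] by simp
  next
    case (Suc m)
    note [measurable] = measurable_step_op[OF m\<Psi>, of lam]
    have "(\<Sum>v | length v = m. ?f v) + level lam (Suc m) \<Psi>
      = level lam m (\<lambda>\<tau> A. ennreal (exp (- box_size A * (lam - \<tau>))) * \<rho> A + step_op lam \<Psi> \<tau> A)"
      unfolding lev level_Suc[OF m\<Psi>] by (rule add) measurable
    also have "\<dots> \<le> level lam m \<Psi>"
      by (intro level_mono step lam)
    finally have "(\<Sum>i<m. \<Sum>v | length v = i. ?f v) + ((\<Sum>v | length v = m. ?f v) + level lam (Suc m) \<Psi>)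
       \<le> (\<Sum>i<m. \<Sum>v | length v = i. ?f v) + level lam m \<Psi>"
      by (rule add_left_mono)
    from order_trans[OF this Suc] show ?case by (simp add: add.assoc)
  qed
  \<comment> \<open>The potential still carried by generation m is discarded here, so termination of
    the recursion is not presupposed.\<close>
  then have "(\<Sum>i<m. \<Sum>v | length v = i. ?f v) \<le> \<Psi> 0 C" for m
    by (rule order_trans[OF add_increasing2[OF zero_le order_refl]])
  then show ?thesis
    unfolding nn_integral_nodes by (intro suminf_le_const) auto
qed

end

section \<open>Leaves containing a given box\<close>

lemma side_split_box:
  "side (split_box c (e, j, \<nu>) A) i =
     (if i = j then (if c then snd A $ j - \<nu> else \<nu> - fst A $ j) else side A i)"
  by (auto simp: side_def split_box_eq)

text \<open>Stated for closed boxes instead of cells, whose missing faces would disturb the symmetry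
  of the two children. The inner box may be degenerate: points and segments are used below.\<close>

definition contains_box :: "'d::finite box \<Rightarrow> 'd box \<Rightarrow> bool" where
  "contains_box B A \<longleftrightarrow> (\<forall>i. fst A $ i \<le> fst B $ i \<and> snd B $ i \<le> snd A $ i)"

lemma measurable_contains_box [measurable (raw)]:
  assumes [measurable]: "f \<in> M \<rightarrow>\<^sub>M box_space" "g \<in> M \<rightarrow>\<^sub>M box_space"
  shows "Measurable.pred M (\<lambda>x. contains_box (f x) (g x))"
  unfolding contains_box_def by measurable

lemma box_size_mono:
  assumes "contains_box B A" shows "box_size B \<le> box_size A"
  unfolding box_size_def side_def
  using assms by (intro sum_mono diff_mono) (auto simp: contains_box_def)

text \<open>A uniform cut of \<open>A\<close> at unit rate per unit of length misses the box \<open>B\<close> at rate \<open>|A| - |B|\<close>.\<close>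

lemma cuts_missing_box:
  assumes B: "\<And>j. side B j \<ge> 0" and A: "\<And>j. side A j \<ge> 0"
  shows "(\<Sum>j\<in>UNIV. \<integral>\<^sup>+\<nu>. indicator {fst A $ j .. snd A $ j} \<nu> *
        ((if contains_box B (split_box False (e, j, \<nu>) A) then 1 else 0) +
         (if contains_box B (split_box True (e, j, \<nu>) A) then 1 else 0)) \<partial>lborel) =
     (if contains_box B A then ennreal (box_size A - box_size B) else 0)"
proof -
  let ?J = "\<lambda>j. \<integral>\<^sup>+\<nu>. indicator {fst A $ j .. snd A $ j} \<nu> *
        ((if contains_box B (split_box False (e, j, \<nu>) A) then 1 else (0::ennreal)) +
         (if contains_box B (split_box True (e, j, \<nu>) A) then 1 else 0)) \<partial>lborel"
  show ?thesis
  proof (cases "contains_box B A")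
    case True
    have "?J j =
        ennreal (side A j - side B j)" for j
    proof -
      have *: "fst A $ j \<le> fst B $ j" "snd B $ j \<le> snd A $ j" "fst B $ j \<le> snd B $ j" for j
        using True B[of j] by (auto simp: contains_box_def side_def)
      \<comment> \<open>The left child keeps B iff the cut is above B, the right child iff it is
        below; the admissible thresholds form two intervals of total length side A - side B.\<close>
      have "contains_box B (split_box False (e, j, \<nu>) A) \<longleftrightarrow> snd B $ j \<le> \<nu>"
        "contains_box B (split_box True (e, j, \<nu>) A) \<longleftrightarrow> \<nu> \<le> fst B $ j" for \<nu>
        using True by (auto simp: contains_box_def split_box_eq)
      then have "?J j
         = (\<integral>\<^sup>+\<nu>. indicator {snd B $ j .. snd A $ j} \<nu> + indicator {fst A $ j .. fst B $ j} \<nu> \<partial>lborel)"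
        using *[of j] by (intro nn_integral_cong) (auto split: split_indicator)
      also have "\<dots> = ennreal (snd A $ j - snd B $ j) + ennreal (fst B $ j - fst A $ j)"
        using *[of j] by (subst nn_integral_add) simp_all
      finally show ?thesis using *[of j] by (simp add: side_def flip: ennreal_plus)
    qed
    moreover have "side A j - side B j \<ge> 0" for j
      using True by (auto simp: contains_box_def side_def intro: diff_mono)
    ultimately show ?thesis
      using True by (simp add: sum_ennreal sum_subtractf box_size_def)
  next
    case False
    \<comment> \<open>A cut inside A only shrinks boxes, so a box not contained in A is contained in
      neither child.\<close>
    have "\<not> contains_box B (split_box c (e, j, \<nu>) A)" if "\<nu> \<in> {fst A $ j .. snd A $ j}" for c j \<nu>
    proof
      assume H: "contains_box B (split_box c (e, j, \<nu>) A)"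
      have "fst A $ i \<le> fst B $ i \<and> snd B $ i \<le> snd A $ i" for i
        using that spec[OF H[unfolded contains_box_def split_box_eq], of i] by (cases c; cases "i = j") auto
      then have "contains_box B A" by (simp add: contains_box_def)
      with False show False by simp
    qed
    then have "?J j =
        (\<integral>\<^sup>+\<nu>. 0 \<partial>(lborel :: real measure))" for j
      by (intro nn_integral_cong) (auto split: split_indicator)
    then show ?thesis using False by simp
  qed
qed

text \<open>The potential depends on the child only through containment of B, so the sum over cuts
  contributes the factor |A| - |B|. In both applications the rate \<open>c\<close> has the value
  |B|, in the second one written as 0.\<close>

lemma step_op_contains_box:
  assumes B: "\<And>j. side B j \<ge> 0" and A: "\<And>j. side A j \<ge> 0"
  shows "step_op lam (\<lambda>\<tau> A. if contains_box B A then ennreal (exp (- c * (lam - \<tau>))) else 0) \<tau> A =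
    (if contains_box B A then (\<integral>\<^sup>+e. ennreal ((box_size A - box_size B) * exp (- box_size A * e - c * (lam - \<tau> - e))) * indicator {0..lam - \<tau>} e \<partial>lborel) else 0)"
proof -
  have *: "(\<Sum>j\<in>UNIV. \<integral>\<^sup>+\<nu>. indicator {fst A $ j .. snd A $ j} \<nu> *
        ((if contains_box B (split_box False (e, j, \<nu>) A) then g else 0) +
         (if contains_box B (split_box True (e, j, \<nu>) A) then g else 0)) \<partial>lborel) =
     (if contains_box B A then g * ennreal (box_size A - box_size B) else 0)" for g :: ennreal and e
  proof -
    have [measurable]: "(\<lambda>\<nu>. split_box c (e, j, \<nu>) A) \<in> borel \<rightarrow>\<^sub>M box_space" for c j
      by (rule measurable_split_box) (simp_all add: space_pair_measure)
    have [measurable]: "Measurable.pred borel (\<lambda>\<nu>. contains_box B (split_box c (e, j, \<nu>) A))" for c j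
      by (rule measurable_contains_box) (simp_all add: space_pair_measure)
    have "(\<Sum>j\<in>UNIV. \<integral>\<^sup>+\<nu>. indicator {fst A $ j .. snd A $ j} \<nu> *
        ((if contains_box B (split_box False (e, j, \<nu>) A) then g else 0) +
         (if contains_box B (split_box True (e, j, \<nu>) A) then g else 0)) \<partial>lborel)
       = (\<Sum>j\<in>UNIV. \<integral>\<^sup>+\<nu>. g * (indicator {fst A $ j .. snd A $ j} \<nu> *
        ((if contains_box B (split_box False (e, j, \<nu>) A) then 1 else 0) +
         (if contains_box B (split_box True (e, j, \<nu>) A) then 1 else 0))) \<partial>lborel)"
      by (intro sum.cong nn_integral_cong) (auto simp: distrib_left mult_2_right split: split_indicator)
    also have "\<dots> = (\<Sum>j\<in>UNIV. g * (\<integral>\<^sup>+\<nu>. indicator {fst A $ j .. snd A $ j} \<nu> *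
        ((if contains_box B (split_box False (e, j, \<nu>) A) then 1 else 0) +
         (if contains_box B (split_box True (e, j, \<nu>) A) then 1 else 0)) \<partial>lborel))"
      by (intro sum.cong refl nn_integral_cmult) measurable
    also have "\<dots> = g * (if contains_box B A then ennreal (box_size A - box_size B) else 0)"
      by (subst sum_distrib_left[symmetric], subst cuts_missing_box[OF B A]) simp
    finally show ?thesis by simp
  qed
  show ?thesis
    unfolding step_op_def * using box_size_mono[of B A]
    by (auto intro!: nn_integral_cong simp: ennreal_mult[symmetric] exp_add[symmetric] algebra_simps
        simp flip: ennreal_mult split: split_indicator)
qed

text \<open>The primitive is -exp(-L e - c (s - e)), whose derivative carries the factor L - c; this
  is the source of the assumption \<open>b = c\<close>.\<close>

lemma nn_integral_exp_FTC:
  fixes L b c s :: real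
  assumes "b \<le> L" "0 \<le> s" "b = c"
  shows "(\<integral>\<^sup>+e. ennreal ((L - b) * exp (- L * e - c * (s - e))) * indicator {0..s} e \<partial>lborel)
     = ennreal (exp (- c * s) - exp (- L * s))"
proof -
  have "(\<integral>\<^sup>+e. ennreal ((L - b) * exp (- L * e - c * (s - e))) * indicator {0..s} e \<partial>lborel)
     = ennreal (- exp (- L * s - c * (s - s)) - (- exp (- L * 0 - c * (s - 0))))"
    using assms
    by (intro nn_integral_FTC_Icc)
       (auto intro!: derivative_eq_intros simp: algebra_simps)
  then show ?thesis by simp
qed

context mondrian_tree
begin

text \<open>The potential balances exactly on boxes containing B: with remaining time s, the leaf
  term exp(-|A|s) and the step term exp(-|B|s) - exp(-|A|s) add up to exp(-|B|s).\<close>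

lemma expected_leaves_containing_box:
  assumes B: "\<And>j. side B j \<ge> 0" and lam: "0 \<le> lam"
  shows "(\<integral>\<^sup>+v. \<integral>\<^sup>+\<omega>. indicator {\<omega>. is_leaf lam (T \<omega>) v} \<omega> *
      (if contains_box B (node_box C (T \<omega>) v) then 1 else 0) \<partial>M \<partial>count_space UNIV)
    \<le> ennreal (exp (- box_size B * lam))"
proof -
  let ?\<Psi> = "\<lambda>\<tau> A. if contains_box B A then ennreal (exp (- box_size B * (lam - \<tau>))) else 0"
  have "(\<integral>\<^sup>+v. \<integral>\<^sup>+\<omega>. indicator {\<omega>. is_leaf lam (T \<omega>) v} \<omega> *
      (if contains_box B (node_box C (T \<omega>) v) then 1 else 0) \<partial>M \<partial>count_space UNIV) \<le> ?\<Psi> 0 C"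
  proof (rule potential_bound[OF _ _ lam])
    show "case_prod ?\<Psi> \<in> borel_measurable (borel \<Otimes>\<^sub>M box_space)"
      unfolding contains_box_def by measurable
    show "(\<lambda>A. if contains_box B A then 1 else 0) \<in> borel_measurable box_space"
      unfolding contains_box_def by measurable
    fix \<tau> :: real and A :: "'d box" assume good: "good_cell C \<tau> A" and \<tau>: "\<tau> \<le> lam"
    have A: "side A j \<ge> 0" for j using good by (auto simp: good_cell_def side_def less_imp_le)
    show "ennreal (exp (- box_size A * (lam - \<tau>))) * (if contains_box B A then 1 else 0) + step_op lam ?\<Psi> \<tau> A \<le> ?\<Psi> \<tau> A"
    proof (cases "contains_box B A")
      case True
      have "exp (- box_size A * (lam - \<tau>)) \<le> exp (- box_size B * (lam - \<tau>))"
        using box_size_mono[OF True] \<tau> by (simp add: mult_right_mono)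
      then show ?thesis
        using True \<tau> box_size_mono[OF True]
        by (simp add: step_op_contains_box[OF B A] nn_integral_exp_FTC[where s="lam - \<tau>", simplified] flip: ennreal_plus)
    qed (simp add: step_op_contains_box[OF B A])
  qed
  also have "\<dots> \<le> ennreal (exp (- box_size B * lam))" by simp
  finally show ?thesis .
qed

text \<open>The mean number of called cells of depth m whose box contains \<open>x\<close> decays
  like q^m, since in each generation such a cell must split before \<open>lam\<close>. A point
  outside all leaves would need a called cell at every depth.\<close>

lemma AE_point_in_leaf:
  assumes x: "x \<in> cbox (fst C) (snd C)" and lam: "0 \<le> lam"
  shows "AE \<omega> in M. \<exists>v. is_leaf lam (T \<omega>) v \<and> x \<in> node_cell C (T \<omega>) v"
proof -
  let ?\<Psi> = "\<lambda>(\<tau>::real) A. if contains_box (x, x) A then ennreal (exp (- 0 * (lam - \<tau>))) else 0"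
  \<comment> \<open>The probability that the root splits before \<open>lam\<close>. It dominates the
    splitting probability of every later cell, which has smaller size and less time left.\<close>
  define q where "q = 1 - exp (- box_size C * lam)"
  have C0: "0 \<le> box_size C" by (intro less_imp_le box_size_pos root_pos)
  have q: "0 \<le> q" "q < 1" using C0 lam by (simp_all add: q_def)
  have m\<Psi>[measurable]: "case_prod ?\<Psi> \<in> borel_measurable (borel \<Otimes>\<^sub>M box_space)"
    unfolding contains_box_def by measurable
  have step: "step_op lam ?\<Psi> \<tau> A \<le> ennreal q * ?\<Psi> \<tau> A" if good: "good_cell C \<tau> A" and \<tau>: "\<tau> \<le> lam" for \<tau> A
  proof -
    have x0: "side (x, x) j \<ge> 0" "box_size (x, x) = 0" for j by (simp_all add: side_def box_size_def)
    have A: "side A j \<ge> 0" for j using good by (auto simp: good_cell_def side_def less_imp_le)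
    have L: "0 \<le> box_size A" using A by (auto simp: box_size_def intro: sum_nonneg)
    have "box_size A \<le> box_size C"
      using good by (intro box_size_mono) (auto simp: contains_box_def good_cell_def)
    then have "box_size A * (lam - \<tau>) \<le> box_size C * lam"
      using L \<tau> good by (intro mult_mono) (auto simp: good_cell_def)
    then have "1 - exp (- box_size A * (lam - \<tau>)) \<le> q" by (simp add: q_def)
    then show ?thesis
      using nn_integral_exp_FTC[of 0 "box_size A" "lam - \<tau>" 0] L \<tau>
      by (subst step_op_contains_box[OF x0(1) A]) (auto simp: x0 intro: ennreal_leI)
  qed
  have level: "level lam m ?\<Psi> \<le> ennreal (q ^ m)" for m
  proof (induction m)
    case 0
    show ?case using level_0[OF lam, of ?\<Psi>] by simp
  next
    case (Suc m)
    have "level lam (Suc m) ?\<Psi> = level lam m (step_op lam ?\<Psi>)"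
      by (rule level_Suc) measurable
    also have "\<dots> \<le> level lam m (\<lambda>\<tau> A. ennreal q * ?\<Psi> \<tau> A)"
      by (rule level_mono[OF step lam])
    also have "\<dots> = ennreal q * level lam m ?\<Psi>"
      unfolding level_def sum_distrib_left indicator_def mem_Collect_eq
      by (intro sum.cong refl, subst nn_integral_cmult[symmetric]) (auto intro!: nn_integral_cong)
    also have "\<dots> \<le> ennreal q * ennreal (q ^ m)" by (rule mult_left_mono[OF Suc]) simp
    finally show ?case using q by (simp add: ennreal_mult)
  qed
  let ?U = "{\<omega> \<in> space M. \<not> (\<exists>v. is_leaf lam (T \<omega>) v \<and> x \<in> node_cell C (T \<omega>) v)}"
  have U[measurable]: "?U \<in> sets M" by measurable
  have "emeasure M ?U \<le> ennreal (q ^ m)" for m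
  proof -
    have fin: "finite {v :: node. length v = m}"
      using finite_lists_length_eq[of "UNIV :: bool set" m] by simp
    have "emeasure M ?U = (\<integral>\<^sup>+\<omega>. indicator ?U \<omega> \<partial>M)" by simp
    also have "\<dots> \<le> (\<integral>\<^sup>+\<omega>. (\<Sum>v | length v = m. indicator {\<omega>. node_called lam (T \<omega>) v} \<omega> *
         ?\<Psi> (node_time (T \<omega>) v) (node_box C (T \<omega>) v)) \<partial>M)"
    proof (rule nn_integral_mono)
      fix \<omega>
      show "indicator ?U \<omega> \<le> (\<Sum>v | length v = m. indicator {\<omega>. node_called lam (T \<omega>) v} \<omega> *
         ?\<Psi> (node_time (T \<omega>) v) (node_box C (T \<omega>) v))"
      proof (cases "\<omega> \<in> ?U")
        case True
        then obtain v where v: "length v = m" "node_called lam (T \<omega>) v" "x \<in> node_cell C (T \<omega>) v"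
          using exists_called_node_of_length[OF x, of lam "T \<omega>" m] by blast
        then have "contains_box (x, x) (node_box C (T \<omega>) v)"
          using node_cell_subset_node_box[of C "T \<omega>" v] by (auto simp: contains_box_def mem_box_cart)
        then have "1 \<le> (\<Sum>v \<in> {v}. indicator {\<omega>. node_called lam (T \<omega>) v} \<omega> *
           ?\<Psi> (node_time (T \<omega>) v) (node_box C (T \<omega>) v))" using v by simp
        also have "\<dots> \<le> (\<Sum>v | length v = m. indicator {\<omega>. node_called lam (T \<omega>) v} \<omega> *
           ?\<Psi> (node_time (T \<omega>) v) (node_box C (T \<omega>) v))"
          by (rule sum_mono2) (use v fin in auto)
        finally show ?thesis using True by simp
      qed simp
    qed
    also have "\<dots> = level lam m ?\<Psi>"
      unfolding level_def indicator_def mem_Collect_eq by (rule nn_integral_sum) simp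
    finally show ?thesis using level[of m] by (rule order_trans)
  qed
  moreover have "(\<lambda>m. ennreal (q ^ m)) \<longlonglongrightarrow> ennreal 0"
    using q by (intro tendsto_ennrealI LIMSEQ_realpow_zero) auto
  ultimately have "emeasure M ?U \<le> 0"
    using LIMSEQ_le_const[of "\<lambda>m. ennreal (q ^ m)" 0 "emeasure M ?U"] by simp
  then show ?thesis
    using AE_iff_measurable[OF U, of "\<lambda>\<omega>. \<exists>v. is_leaf lam (T \<omega>) v \<and> x \<in> node_cell C (T \<omega>) v"] by simp
qed

end

section \<open>The number of leaves\<close>

lemma prod_side_split_box:
  "(\<Prod>i\<in>UNIV. 1 + u * side (split_box c (e, j, \<nu>) A) i) =
     (1 + u * (if c then snd A $ j - \<nu> else \<nu> - fst A $ j)) * (\<Prod>i\<in>UNIV - {j}. 1 + u * side A i)"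
  by (subst prod.remove[of UNIV j]) (auto intro!: prod.cong simp: side_split_box)

text \<open>The expected number of leaves descending from \<open>A\<close> if its lifetime is still \<open>lam - \<tau>\<close>.\<close>

definition leaf_potential :: "real \<Rightarrow> real \<Rightarrow> 'd::finite box \<Rightarrow> real" where
  "leaf_potential lam \<tau> A = (\<Prod>j\<in>UNIV. 1 + (lam - \<tau>) * side A j)"

text \<open>For remaining time u after the split, let F(u) be the potential of A as a polynomial in
  u. The cuts contribute F'(u) + |A| F(u), and exp(-|A|e) (F'(s - e) + |A| F(s - e)) is the
  derivative in e of -exp(-|A|e) F(s - e). With F(0) = 1 this gives the closed form.\<close>

lemma step_op_leaf_potential:
  fixes A :: "'d::finite box"
  assumes A: "\<And>j. side A j \<ge> 0" and \<tau>: "\<tau> \<le> lam"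
  shows "step_op lam (\<lambda>\<tau> A. ennreal (leaf_potential lam \<tau> A)) \<tau> A =
    ennreal (leaf_potential lam \<tau> A - exp (- box_size A * (lam - \<tau>)))"
proof -
  define s where "s = lam - \<tau>"
  define L where "L = box_size A"
  let ?V = "\<lambda>e j \<nu>. ennreal (leaf_potential lam (\<tau> + e) (split_box False (e, j, \<nu>) A)) +
         ennreal (leaf_potential lam (\<tau> + e) (split_box True (e, j, \<nu>) A))"
  define F where "F u = (\<Prod>i\<in>UNIV. 1 + u * side A i)" for u
  define F' where "F' u = (\<Sum>j\<in>UNIV. side A j * (\<Prod>i\<in>UNIV - {j}. 1 + u * side A i))" for u
  have F_deriv: "(F has_field_derivative F' u) (at u)" for u
    unfolding F_def F'_def by (rule has_field_derivative_prod) (auto intro!: derivative_eq_intros)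
  have nonneg: "0 \<le> F u" "0 \<le> F' u" if "0 \<le> u" for u
    unfolding F_def F'_def using A that by (auto intro!: prod_nonneg sum_nonneg add_nonneg_nonneg mult_nonneg_nonneg)
  have L: "0 \<le> L" unfolding L_def box_size_def using A by (simp add: sum_nonneg)
  have inner: "(\<Sum>j\<in>UNIV. \<integral>\<^sup>+\<nu>. indicator {fst A $ j .. snd A $ j} \<nu> *
        ?V e j \<nu> \<partial>lborel)
       = ennreal (F' (s - e) + L * F (s - e))" if e: "e \<in> {0..s}" for e
  proof -
    define u where "u = s - e"
    have u: "0 \<le> u" "lam - (\<tau> + e) = u" using e by (auto simp: u_def s_def)
    define Q where "Q j = (\<Prod>i\<in>UNIV - {j}. 1 + u * side A i)" for j
    have Q: "0 \<le> Q j" for j unfolding Q_def using A u by (auto intro!: prod_nonneg add_nonneg_nonneg)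
    have "(\<integral>\<^sup>+\<nu>. indicator {fst A $ j .. snd A $ j} \<nu> *
        ?V e j \<nu> \<partial>lborel)
       = ennreal (side A j * Q j + side A j * F u)" for j
    proof -
      have "(\<integral>\<^sup>+\<nu>. indicator {fst A $ j .. snd A $ j} \<nu> *
        ?V e j \<nu> \<partial>lborel)
        = (\<integral>\<^sup>+\<nu>. ennreal ((2 + u * side A j) * Q j) * indicator {fst A $ j .. snd A $ j} \<nu> \<partial>lborel)"
      proof (rule nn_integral_cong)
        fix \<nu> :: real
        show "indicator {fst A $ j .. snd A $ j} \<nu> *
          ?V e j \<nu> =
          ennreal ((2 + u * side A j) * Q j) * indicator {fst A $ j .. snd A $ j} \<nu>"
        proof (cases "\<nu> \<in> {fst A $ j .. snd A $ j}")
          case True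
          then have "ennreal ((1 + u * (\<nu> - fst A $ j)) * Q j) + ennreal ((1 + u * (snd A $ j - \<nu>)) * Q j)
            = ennreal ((1 + u * (\<nu> - fst A $ j)) * Q j + (1 + u * (snd A $ j - \<nu>)) * Q j)"
            using u Q by (subst ennreal_plus) (auto intro!: mult_nonneg_nonneg add_nonneg_nonneg)
          \<comment> \<open>The two children together have the side they were cut from, so the sum
            does not depend on the threshold.\<close>
          also have "(1 + u * (\<nu> - fst A $ j)) * Q j + (1 + u * (snd A $ j - \<nu>)) * Q j = (2 + u * side A j) * Q j"
            by (simp add: side_def algebra_simps)
          finally show ?thesis
            using True unfolding leaf_potential_def u(2) prod_side_split_box Q_def[symmetric] by simp
        qed simp
      qed
      also have "\<dots> = ennreal ((2 + u * side A j) * Q j) * ennreal (side A j)"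
        using A[of j] by (subst nn_integral_cmult_indicator) (auto simp: side_def)
      also have "\<dots> = ennreal (side A j * ((2 + u * side A j) * Q j))"
        using A[of j] Q[of j] u by (subst ennreal_mult[symmetric]) (auto simp: mult.commute)
      \<comment> \<open>One of the two copies of \<open>Q j\<close>, taken with the term
        \<open>u * side A j\<close>, restores the missing factor and becomes \<open>F u\<close>; the
        other belongs to the product rule for \<open>F'\<close>.\<close>
      also have "side A j * ((2 + u * side A j) * Q j) = side A j * Q j + side A j * F u"
        unfolding F_def Q_def by (subst prod.remove[of UNIV j]) (auto simp: algebra_simps)
      finally show ?thesis .
    qed
    note eq = this
    have "(\<Sum>j\<in>UNIV. ennreal (side A j * Q j + side A j * F u)) = ennreal (\<Sum>j\<in>UNIV. side A j * Q j + side A j * F u)"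
      using A Q nonneg(1)[OF u(1)] by (intro sum_ennreal) simp
    also have "(\<Sum>j\<in>UNIV. side A j * Q j + side A j * F u) = F' u + L * F u"
      by (simp add: sum.distrib F'_def Q_def L_def box_size_def sum_distrib_right)
    finally show ?thesis unfolding eq u_def .
  qed
  have "step_op lam (\<lambda>\<tau> A. ennreal (leaf_potential lam \<tau> A)) \<tau> A =
    (\<integral>\<^sup>+e. ennreal (exp (- L * e) * (F' (s - e) + L * F (s - e))) * indicator {0..s} e \<partial>lborel)"
    unfolding step_op_def s_def[symmetric] L_def[symmetric]
    using inner by (intro nn_integral_cong) (auto simp: ennreal_mult' split: split_indicator)
  also have "\<dots> = ennreal (- exp (- L * s) * F (s - s) - (- exp (- L * 0) * F (s - 0)))"
  proof (rule nn_integral_FTC_Icc)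
    show "(\<lambda>e. exp (- L * e) * (F' (s - e) + L * F (s - e))) \<in> borel_measurable borel"
      unfolding F_def F'_def by measurable
    show "((\<lambda>e. - exp (- L * e) * F (s - e)) has_real_derivative exp (- L * e) * (F' (s - e) + L * F (s - e))) (at e)" for e
      by (auto intro!: derivative_eq_intros DERIV_chain2[OF F_deriv] simp: algebra_simps)
  qed (use nonneg L \<tau> in \<open>auto simp: s_def\<close>)
  also have "- exp (- L * s) * F (s - s) - (- exp (- L * 0) * F (s - 0)) = F s - exp (- L * s)"
    by (simp add: F_def)
  finally show ?thesis by (simp add: F_def leaf_potential_def s_def L_def)
qed

text \<open>The case of unit weight in \<open>potential_bound\<close>; by
  \<open>step_op_leaf_potential\<close> its hypothesis holds with equality. On the unit cube the
  bound is (1 + lam)^d.\<close>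

lemma (in mondrian_tree) expected_leaf_count:
  assumes lam: "0 \<le> lam"
  shows "(\<integral>\<^sup>+v. emeasure M {\<omega> \<in> space M. is_leaf lam (T \<omega>) v} \<partial>count_space UNIV)
    \<le> ennreal (\<Prod>j\<in>UNIV. 1 + lam * side C j)"
proof -
  have "(\<integral>\<^sup>+v. \<integral>\<^sup>+\<omega>. indicator {\<omega>. is_leaf lam (T \<omega>) v} \<omega> * 1 \<partial>M \<partial>count_space UNIV) \<le> ennreal (leaf_potential lam 0 C)"
  proof (rule potential_bound[OF _ _ lam])
    show "(\<lambda>(\<tau>, A). ennreal (leaf_potential lam \<tau> A)) \<in> borel_measurable (borel \<Otimes>\<^sub>M box_space)"
      unfolding leaf_potential_def by measurable
    fix \<tau> :: real and A :: "'d box" assume good: "good_cell C \<tau> A" and \<tau>: "\<tau> \<le> lam"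
    have A: "side A j \<ge> 0" for j using good by (auto simp: good_cell_def side_def less_imp_le)
    have L: "0 \<le> box_size A" unfolding box_size_def using A by (simp add: sum_nonneg)
    have "1 \<le> leaf_potential lam \<tau> A"
      unfolding leaf_potential_def using A \<tau> by (intro prod_ge_1) auto
    moreover have "exp (- box_size A * (lam - \<tau>)) \<le> 1" using L \<tau> by simp
    ultimately have "exp (- box_size A * (lam - \<tau>)) \<le> leaf_potential lam \<tau> A" by linarith
    then show "ennreal (exp (- box_size A * (lam - \<tau>))) * 1 + step_op lam (\<lambda>\<tau> A. ennreal (leaf_potential lam \<tau> A)) \<tau> A
        \<le> ennreal (leaf_potential lam \<tau> A)"
      unfolding step_op_leaf_potential[OF A \<tau>] by (subst mult_1_right, subst ennreal_plus[symmetric]) auto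
  qed simp
  also have "(\<integral>\<^sup>+v. \<integral>\<^sup>+\<omega>. indicator {\<omega>. is_leaf lam (T \<omega>) v} \<omega> * 1 \<partial>M \<partial>count_space UNIV)
    = (\<integral>\<^sup>+v. emeasure M {\<omega> \<in> space M. is_leaf lam (T \<omega>) v} \<partial>count_space UNIV)"
  proof (rule nn_integral_cong)
    fix v
    have "(\<integral>\<^sup>+\<omega>. indicator {\<omega>. is_leaf lam (T \<omega>) v} \<omega> * 1 \<partial>M) = (\<integral>\<^sup>+\<omega>. indicator {\<omega> \<in> space M. is_leaf lam (T \<omega>) v} \<omega> \<partial>M)"
      by (rule nn_integral_cong) (auto split: split_indicator)
    also have "\<dots> = emeasure M {\<omega> \<in> space M. is_leaf lam (T \<omega>) v}"
      by (rule nn_integral_indicator) measurable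
    finally show "(\<integral>\<^sup>+\<omega>. indicator {\<omega>. is_leaf lam (T \<omega>) v} \<omega> * 1 \<partial>M) = emeasure M {\<omega> \<in> space M. is_leaf lam (T \<omega>) v}" .
  qed
  finally show ?thesis by (simp add: leaf_potential_def)
qed

section \<open>Approximation and deviation bounds\<close>

text \<open>Indicators are approximated by regularity of finite Borel measures and Urysohn
  functions; sums and dominated limits then reach all integrable functions.\<close>

lemma integrable_L1_approx_continuous:
  fixes h :: "'a::euclidean_space \<Rightarrow> real"
  assumes "finite_measure \<mu>" and sets [measurable_cong]: "sets \<mu> = sets borel"
    and "integrable \<mu> h" and "\<epsilon> > 0"
  shows "\<exists>g. continuous_on UNIV g \<and> (\<integral>\<^sup>+x. ennreal \<bar>h x - g x\<bar> \<partial>\<mu>) \<le> ennreal \<epsilon>"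
proof -
  interpret finite_measure \<mu> by fact
  have meas: "g \<in> borel_measurable \<mu>" if "continuous_on UNIV g" for g :: "'a \<Rightarrow> real"
    using borel_measurable_continuous_onI[OF that] sets by (simp cong: measurable_cong_sets)
  have "\<forall>\<epsilon>>0. \<exists>g. continuous_on UNIV g \<and> (\<integral>\<^sup>+x. ennreal \<bar>h x - g x\<bar> \<partial>\<mu>) \<le> ennreal \<epsilon>"
    using \<open>integrable \<mu> h\<close>
  proof (induction h rule: integrable_induct)
    case (base A c)
    show ?case
    proof (intro allI impI)
      fix \<epsilon> :: real assume "\<epsilon> > 0"
      \<comment> \<open>The error will be at most |c| times 2\<delta>; the summand 1 avoids a
        division by zero when c = 0.\<close>
      define \<delta> where "\<delta> = \<epsilon> / (2 * (\<bar>c\<bar> + 1))"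
      have \<delta>: "\<delta> > 0" using \<open>\<epsilon> > 0\<close> by (simp add: \<delta>_def)
      have A: "A \<in> sets borel" using base sets by simp
      have fin: "emeasure \<mu> (space \<mu>) \<noteq> \<infinity>" by simp
      have "emeasure \<mu> A < emeasure \<mu> A + ennreal \<delta>"
        using \<delta> by (simp add: emeasure_eq_measure ennreal_less_iff flip: ennreal_plus)
      then obtain U where U: "A \<subseteq> U" "open U" "emeasure \<mu> U < emeasure \<mu> A + ennreal \<delta>"
        using outer_regular[OF sets fin A] by (auto simp: INF_less_iff)
      \<comment> \<open>The supremum of inner regularity needs a strictly smaller value to be
        exceeded. If A has measure at most \<delta>, the empty set already serves.\<close>
      have "\<exists>K. K \<subseteq> A \<and> compact K \<and> emeasure \<mu> A \<le> emeasure \<mu> K + ennreal \<delta>"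
      proof (cases "emeasure \<mu> A \<le> ennreal \<delta>")
        case True
        then show ?thesis by (intro exI[of _ "{}"]) auto
      next
        case False
        then have "emeasure \<mu> A - ennreal \<delta> < emeasure \<mu> A"
          using \<delta> by (simp add: emeasure_eq_measure ennreal_minus ennreal_less_iff not_le)
        then obtain K where K: "K \<subseteq> A" "compact K" "emeasure \<mu> A - ennreal \<delta> < emeasure \<mu> K"
          using inner_regular[OF sets fin A] by (auto simp: less_SUP_iff)
        have "emeasure \<mu> A \<le> emeasure \<mu> K + ennreal \<delta>"
          using less_imp_le[OF K(3)] by (simp add: ennreal_minus_le_iff add.commute)
        with K show ?thesis by blast
      qed
      then obtain K where K: "K \<subseteq> A" "compact K" "emeasure \<mu> A \<le> emeasure \<mu> K + ennreal \<delta>" by blast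
      have [measurable]: "K \<in> sets \<mu>" "U \<in> sets \<mu>" "A \<in> sets \<mu>"
        using K(2) U(2) base(1) sets by (auto simp: borel_compact)
      have "K \<inter> - U = {}" using K U by auto
      then obtain f :: "'a \<Rightarrow> real" where f: "continuous_on UNIV f" "\<And>x. f x \<in> closed_segment 1 0"
        "\<And>x. x \<in> K \<Longrightarrow> f x = 1" "\<And>x. x \<in> - U \<Longrightarrow> f x = 0"
        using Urysohn[of K "- U" "1::real" 0] compact_imp_closed[OF K(2)] closed_Compl[OF U(2)] by metis
      have f01: "0 \<le> f x" "f x \<le> 1" for x
        using f(2)[of x] by (auto simp: closed_segment_eq_real_ivl)
      have "(\<integral>\<^sup>+x. ennreal \<bar>indicator A x *\<^sub>R c - c * f x\<bar> \<partial>\<mu>) \<le> (\<integral>\<^sup>+x. ennreal \<bar>c\<bar> * indicator (U - K) x \<partial>\<mu>)"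
      proof (rule nn_integral_mono)
        fix x
        \<comment> \<open>The Urysohn function is 1 on K and 0 off U, so it can differ from the
          indicator of A only on U - K.\<close>
        have "\<bar>indicator A x - f x\<bar> \<le> indicator (U - K) x"
          using f(3,4)[of x] f01[of x] K(1) U(1) by (auto split: split_indicator)
        then have "\<bar>c\<bar> * \<bar>indicator A x - f x\<bar> \<le> \<bar>c\<bar> * indicator (U - K) x"
          by (rule mult_left_mono) simp
        moreover have "\<bar>indicator A x *\<^sub>R c - c * f x\<bar> = \<bar>c\<bar> * \<bar>indicator A x - f x\<bar>"
          by (simp add: abs_mult[symmetric] algebra_simps)
        ultimately have "ennreal \<bar>indicator A x *\<^sub>R c - c * f x\<bar> \<le> ennreal (\<bar>c\<bar> * indicator (U - K) x)"
          by (intro ennreal_leI) simp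
        also have "\<dots> = ennreal \<bar>c\<bar> * indicator (U - K) x"
          by (simp split: split_indicator)
        finally show "ennreal \<bar>indicator A x *\<^sub>R c - c * f x\<bar> \<le> ennreal \<bar>c\<bar> * indicator (U - K) x" .
      qed
      also have "\<dots> = ennreal \<bar>c\<bar> * emeasure \<mu> (U - K)"
        by (rule nn_integral_cmult_indicator) measurable
      also have "emeasure \<mu> (U - K) = ennreal (measure \<mu> U - measure \<mu> K)"
        using K(1) U(1) by (simp add: emeasure_eq_measure finite_measure_Diff subset_trans)
      also have "measure \<mu> U - measure \<mu> K \<le> 2 * \<delta>"
      proof -
        have "measure \<mu> U < measure \<mu> A + \<delta>" "measure \<mu> A \<le> measure \<mu> K + \<delta>"
          using U(3) K(3) \<delta> by (simp_all add: emeasure_eq_measure ennreal_less_iff flip: ennreal_plus)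
        then show ?thesis by simp
      qed
      then have "ennreal \<bar>c\<bar> * ennreal (measure \<mu> U - measure \<mu> K) \<le> ennreal \<bar>c\<bar> * ennreal (2 * \<delta>)"
        by (intro mult_left_mono ennreal_leI) auto
      also have "\<dots> = ennreal (\<bar>c\<bar> * (2 * \<delta>))" using \<delta> by (simp add: ennreal_mult)
      also have "\<bar>c\<bar> * (2 * \<delta>) \<le> \<epsilon>"
        using \<open>\<epsilon> > 0\<close> by (simp add: \<delta>_def field_simps)
      then have "ennreal (\<bar>c\<bar> * (2 * \<delta>)) \<le> ennreal \<epsilon>" by (rule ennreal_leI)
      finally show "\<exists>g. continuous_on UNIV g \<and> (\<integral>\<^sup>+x. ennreal \<bar>indicator A x *\<^sub>R c - g x\<bar> \<partial>\<mu>) \<le> ennreal \<epsilon>"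
        by (intro exI[of _ "\<lambda>x. c * f x"]) (auto intro!: continuous_intros f(1))
    qed
  next
    case (add f g)
    show ?case
    proof (intro allI impI)
      fix \<epsilon> :: real assume "\<epsilon> > 0"
      then have "\<epsilon> / 2 > 0" by simp
      with add.IH obtain f' g' where f': "continuous_on UNIV f'" "(\<integral>\<^sup>+x. ennreal \<bar>f x - f' x\<bar> \<partial>\<mu>) \<le> ennreal (\<epsilon> / 2)"
        and g': "continuous_on UNIV g'" "(\<integral>\<^sup>+x. ennreal \<bar>g x - g' x\<bar> \<partial>\<mu>) \<le> ennreal (\<epsilon> / 2)" by blast
      note [measurable] = meas[OF f'(1)] meas[OF g'(1)] borel_measurable_integrable[OF add.hyps(1)] borel_measurable_integrable[OF add.hyps(2)]
      have "(\<integral>\<^sup>+x. ennreal \<bar>f x + g x - (f' x + g' x)\<bar> \<partial>\<mu>) \<le> (\<integral>\<^sup>+x. ennreal \<bar>f x - f' x\<bar> + ennreal \<bar>g x - g' x\<bar> \<partial>\<mu>)"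
        by (intro nn_integral_mono) (auto simp flip: ennreal_plus intro!: ennreal_leI)
      also have "\<dots> = (\<integral>\<^sup>+x. ennreal \<bar>f x - f' x\<bar> \<partial>\<mu>) + (\<integral>\<^sup>+x. ennreal \<bar>g x - g' x\<bar> \<partial>\<mu>)"
        by (rule nn_integral_add) measurable
      also have "\<dots> \<le> ennreal (\<epsilon> / 2) + ennreal (\<epsilon> / 2)" by (rule add_mono[OF f'(2) g'(2)])
      also have "\<dots> = ennreal \<epsilon>" using \<open>\<epsilon> > 0\<close> by (simp flip: ennreal_plus)
      finally show "\<exists>k. continuous_on UNIV k \<and> (\<integral>\<^sup>+x. ennreal \<bar>f x + g x - k x\<bar> \<partial>\<mu>) \<le> ennreal \<epsilon>"
        by (intro exI[of _ "\<lambda>x. f' x + g' x"]) (auto intro!: continuous_intros f' g')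
    qed
  next
    case (lim f s)
    show ?case
    proof (intro allI impI)
      fix \<epsilon> :: real assume "\<epsilon> > 0"
      note [measurable] = borel_measurable_integrable[OF lim.hyps(1)] borel_measurable_integrable[OF lim.hyps(4)]
      have "(\<lambda>i. \<integral>\<^sup>+x. norm (f x - s i x) \<partial>\<mu>) \<longlonglongrightarrow> 0"
      proof (rule nn_integral_dominated_convergence_norm[where w="\<lambda>x. 2 * norm (f x)"])
        show "AE x in \<mu>. norm (s j x) \<le> 2 * norm (f x)" for j
          using lim.hyps(3) by (intro AE_I2)
        have "integrable \<mu> (\<lambda>x. 2 * f x)" using lim.hyps(4) by simp
        then have "(\<integral>\<^sup>+x. ennreal (norm (2 * f x)) \<partial>\<mu>) < \<infinity>"
          unfolding integrable_iff_bounded by blast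
        then show "(\<integral>\<^sup>+x. ennreal (2 * norm (f x)) \<partial>\<mu>) < \<infinity>"
          by (simp add: abs_mult)
        show "AE x in \<mu>. (\<lambda>i. s i x) \<longlonglongrightarrow> f x"
          using lim.hyps(2) by (intro AE_I2)
      qed simp_all
      then have "eventually (\<lambda>i. (\<integral>\<^sup>+x. norm (f x - s i x) \<partial>\<mu>) < ennreal (\<epsilon> / 2)) sequentially"
        using \<open>\<epsilon> > 0\<close> by (intro order_tendstoD) auto
      then obtain i where i: "(\<integral>\<^sup>+x. norm (f x - s i x) \<partial>\<mu>) < ennreal (\<epsilon> / 2)"
        using eventually_happens'[OF sequentially_bot] by blast
      from \<open>\<epsilon> > 0\<close> have "\<epsilon> / 2 > 0" by simp
      with lim.IH[of i] obtain g where g: "continuous_on UNIV g" "(\<integral>\<^sup>+x. ennreal \<bar>s i x - g x\<bar> \<partial>\<mu>) \<le> ennreal (\<epsilon> / 2)" by blast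
      note [measurable] = meas[OF g(1)]
      have "(\<integral>\<^sup>+x. ennreal \<bar>f x - g x\<bar> \<partial>\<mu>) \<le> (\<integral>\<^sup>+x. norm (f x - s i x) + ennreal \<bar>s i x - g x\<bar> \<partial>\<mu>)"
        by (intro nn_integral_mono) (auto simp flip: ennreal_plus intro!: ennreal_leI)
      also have "\<dots> = (\<integral>\<^sup>+x. norm (f x - s i x) \<partial>\<mu>) + (\<integral>\<^sup>+x. ennreal \<bar>s i x - g x\<bar> \<partial>\<mu>)"
        by (rule nn_integral_add) measurable
      also have "\<dots> \<le> ennreal (\<epsilon> / 2) + ennreal (\<epsilon> / 2)" by (rule add_mono[OF less_imp_le[OF i] g(2)])
      also have "\<dots> = ennreal \<epsilon>" using \<open>\<epsilon> > 0\<close> by (simp flip: ennreal_plus)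
      finally show "\<exists>g. continuous_on UNIV g \<and> (\<integral>\<^sup>+x. ennreal \<bar>f x - g x\<bar> \<partial>\<mu>) \<le> ennreal \<epsilon>"
        using g(1) by blast
    qed
  qed
  with \<open>\<epsilon> > 0\<close> show ?thesis by blast
qed

text \<open>Chebyshev with the variance bounded by the second moment \<open>p\<close>. For votes in
  a cell the second moment is the mass of the cell, so light cells have small fluctuations; the
  uniform bound \<open>B\<close> supplies integrability.\<close>

lemma (in prob_space) prob_sum_deviation_le:
  fixes b :: "nat \<Rightarrow> 'a \<Rightarrow> real" and p q B a :: real
  assumes indep: "indep_vars (\<lambda>_. borel) b I" and fin: "finite I" "I \<noteq> {}"
    and bd: "\<And>i \<omega>. i \<in> I \<Longrightarrow> \<bar>b i \<omega>\<bar> \<le> B"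
    and q: "\<And>i. i \<in> I \<Longrightarrow> expectation (b i) = q"
    and p: "\<And>i. i \<in> I \<Longrightarrow> expectation (\<lambda>\<omega>. (b i \<omega>)\<^sup>2) \<le> p"
    and a: "a > 0"
  shows "prob {\<omega> \<in> space M. \<bar>(\<Sum>i\<in>I. b i \<omega>) - card I * q\<bar> \<ge> a} \<le> card I * p / a\<^sup>2"
proof -
  have m[measurable]: "b i \<in> borel_measurable M" if "i \<in> I" for i
    using indep that by (auto simp: indep_vars_def)
  define c where "c i \<omega> = b i \<omega> - q" for i \<omega>
  have mc[measurable]: "c i \<in> borel_measurable M" if "i \<in> I" for i
    unfolding c_def using that by simp
  have int_b: "integrable M (b i)" if "i \<in> I" for i
    using bd[OF that] that by (intro integrable_const_bound[where B=B]) auto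
  have B: "0 \<le> B" using bd fin by (meson abs_ge_zero ex_in_conv order_trans)
  have c_bd: "\<bar>c i \<omega>\<bar> \<le> B + \<bar>q\<bar>" if "i \<in> I" for i \<omega>
    using bd[OF that, of \<omega>] by (simp add: c_def)
  have int_c: "integrable M (c i)" if "i \<in> I" for i
    using int_b[OF that] unfolding c_def by simp
  have int_cc: "integrable M (\<lambda>\<omega>. c i \<omega> * c j \<omega>)" if "i \<in> I" "j \<in> I" for i j
  proof (rule integrable_const_bound[where B="(B + \<bar>q\<bar>) * (B + \<bar>q\<bar>)"])
    show "AE \<omega> in M. norm (c i \<omega> * c j \<omega>) \<le> (B + \<bar>q\<bar>) * (B + \<bar>q\<bar>)"
      using c_bd that B by (intro AE_I2) (auto simp: abs_mult intro!: mult_mono)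
  qed (use that in simp)
  have int_b2: "integrable M (\<lambda>\<omega>. (b i \<omega>)\<^sup>2)" if "i \<in> I" for i
  proof (rule integrable_const_bound[where B="B\<^sup>2"])
    show "AE \<omega> in M. norm ((b i \<omega>)\<^sup>2) \<le> B\<^sup>2"
      using bd[OF that] B by (intro AE_I2) (auto simp: abs_le_square_iff[symmetric])
  qed (use that in simp)
  have diag: "expectation (\<lambda>\<omega>. c i \<omega> * c i \<omega>) \<le> p" if "i \<in> I" for i
  proof -
    have "expectation (\<lambda>\<omega>. c i \<omega> * c i \<omega>) = expectation (\<lambda>\<omega>. (b i \<omega>)\<^sup>2 - 2 * q * b i \<omega> + q\<^sup>2)"
      by (rule Bochner_Integration.integral_cong) (simp_all add: c_def power2_eq_square algebra_simps)
    also have "\<dots> = expectation (\<lambda>\<omega>. (b i \<omega>)\<^sup>2) - q\<^sup>2"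
      using int_b[OF that] int_b2[OF that] q[OF that] by (simp add: prob_space power2_eq_square)
    also have "\<dots> \<le> p" using p[OF that] zero_le_power2[of q] by linarith
    finally show ?thesis .
  qed
  have indep_c: "indep_vars (\<lambda>_. borel) c I"
    unfolding c_def by (rule indep_vars_compose2[OF indep]) simp
  have off: "expectation (\<lambda>\<omega>. c i \<omega> * c j \<omega>) = 0" if "i \<in> I" "j \<in> I" "i \<noteq> j" for i j
  proof -
    have "expectation (\<lambda>\<omega>. \<Prod>k\<in>{i, j}. c k \<omega>) = (\<Prod>k\<in>{i, j}. expectation (c k))"
      by (rule indep_vars_lebesgue_integral) (use that in \<open>auto intro: int_c indep_vars_subset[OF indep_c]\<close>)
    then have "expectation (\<lambda>\<omega>. c i \<omega> * c j \<omega>) = expectation (c i) * expectation (c j)"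
      using that by simp
    also have "expectation (c i) = 0"
      using int_b[OF that(1)] q[OF that(1)] unfolding c_def by (simp add: prob_space)
    finally show ?thesis by simp
  qed
  define S where "S \<omega> = (\<Sum>i\<in>I. c i \<omega>)" for \<omega>
  have S_eq: "S \<omega> = (\<Sum>i\<in>I. b i \<omega>) - card I * q" for \<omega>
    by (simp add: S_def c_def sum_subtractf)
  have S2: "(S \<omega>)\<^sup>2 = (\<Sum>i\<in>I. \<Sum>j\<in>I. c i \<omega> * c j \<omega>)" for \<omega>
    by (simp add: S_def power2_eq_square sum_product)
  have mS[measurable]: "S \<in> borel_measurable M" unfolding S_def by measurable
  have "expectation (\<lambda>\<omega>. (S \<omega>)\<^sup>2) = (\<Sum>i\<in>I. \<Sum>j\<in>I. expectation (\<lambda>\<omega>. c i \<omega> * c j \<omega>))"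
    unfolding S2 by (simp add: int_cc)
  \<comment> \<open>Centred independent variables are uncorrelated, so only the diagonal terms
    survive.\<close>
  also have "\<dots> = (\<Sum>i\<in>I. expectation (\<lambda>\<omega>. c i \<omega> * c i \<omega>))"
    by (intro sum.cong refl, subst sum.remove[OF fin(1)], assumption) (auto intro!: sum.neutral off)
  also have "\<dots> \<le> (\<Sum>i\<in>I. p)" by (intro sum_mono diag)
  finally have ES: "expectation (\<lambda>\<omega>. (S \<omega>)\<^sup>2) \<le> card I * p" by simp
  have "prob {\<omega> \<in> space M. \<bar>S \<omega>\<bar> \<ge> a} \<le> expectation (\<lambda>\<omega>. (S \<omega>)\<^sup>2) / a\<^sup>2"
    by (rule second_moment_method) (use a in \<open>auto simp: S2 int_cc\<close>)
  also have "\<dots> \<le> card I * p / a\<^sup>2"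
    using ES a by (intro divide_right_mono) auto
  finally show ?thesis by (simp add: S_eq)
qed

section \<open>Excess risk of one cell\<close>

text \<open>Signing the label turns a majority into the sign of a sum, and the mean vote into the
  integral of 2\<eta> - 1 over A.\<close>

definition vote :: "(real ^ 'd) set \<Rightarrow> 'd sample \<Rightarrow> real" where
  "vote A z = (if snd z then 1 else - 1) * indicator A (fst z)"

lemma measurable_vote [measurable]:
  assumes [measurable]: "A \<in> sets borel"
  shows "vote A \<in> borel_measurable sample_space"
  unfolding vote_def by measurable

text \<open>Ties and empty cells give label 0, which corresponds to strict positivity of the
  sum.\<close>

lemma majority_iff_sum_votes:
  fixes n :: nat
  shows "majority {i \<in> {1..n}. fst (D i) \<in> A} (\<lambda>i. snd (D i)) \<longleftrightarrow> (\<Sum>i=1..n. vote A (D i)) > 0"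
proof -
  let ?I = "{i \<in> {1..n}. fst (D i) \<in> A}"
  have count: "real (card {i \<in> ?I. Q i}) = (\<Sum>i=1..n. if fst (D i) \<in> A \<and> Q i then 1 else 0)" for Q
  proof -
    have "(\<Sum>i=1..n. if fst (D i) \<in> A \<and> Q i then 1 else 0) = (\<Sum>i\<in>{i \<in> {1..n}. fst (D i) \<in> A \<and> Q i}. (1::real))"
      by (rule sum.inter_filter[symmetric]) simp
    also have "{i \<in> {1..n}. fst (D i) \<in> A \<and> Q i} = {i \<in> ?I. Q i}" by blast
    finally show ?thesis by simp
  qed
  have "vote A z = (if fst z \<in> A \<and> snd z then 1 else 0) - (if fst z \<in> A \<and> \<not> snd z then 1 else 0)" for z
    by (simp add: vote_def)
  then have "(\<Sum>i=1..n. vote A (D i)) = real (card {i \<in> ?I. snd (D i)}) - real (card {i \<in> ?I. \<not> snd (D i)})"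
    unfolding count by (simp only: sum_subtractf)
  then show ?thesis by (simp add: majority_def)
qed

text \<open>
  If the sign of the sum of the votes in \<open>A\<close> agrees with the sign of \<open>\<integral>h\<close> over \<open>A\<close>, the excess risk is
  at most the \<open>L1\<close> distance of \<open>h\<close> from any constant; otherwise it grows by \<open>|\<integral>h|\<close>, and
  the probability of this is controlled by Chebyshev's inequality.
\<close>

lemma (in prob_space) cell_excess_risk:
  fixes D :: "nat \<Rightarrow> 'a \<Rightarrow> 'd::finite sample" and h :: "real ^ 'd \<Rightarrow> real"
  assumes indep: "indep_vars (\<lambda>_. sample_space) D {1..}"
    and distr_D: "\<And>i. i \<ge> 1 \<Longrightarrow> distr M sample_space (D i) = P"
    and A [measurable]: "A \<in> sets borel"
    and h: "integrable (distr P borel fst) h"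
    and hP: "(\<integral>z. vote A z \<partial>P) = (\<integral>x. indicator A x * h x \<partial>distr P borel fst)"
    and n: "n \<ge> 1" and \<theta>: "\<theta> > 0"
  shows "(\<integral>\<^sup>+\<omega>. \<integral>\<^sup>+x. indicator A x * ennreal \<bar>h x\<bar> *
        (if majority {i \<in> {1..n}. fst (D i \<omega>) \<in> A} (\<lambda>i. snd (D i \<omega>)) \<noteq> (h x > 0) then 1 else 0) \<partial>distr P borel fst \<partial>M)
    \<le> (\<integral>\<^sup>+x. indicator A x * ennreal \<bar>h x - c\<bar> \<partial>distr P borel fst)
        + (ennreal \<theta> * emeasure (distr P borel fst) A + ennreal (1 / (\<theta> * n)))"
proof -
  let ?\<mu> = "distr P borel fst"
  have mD[measurable]: "D i \<in> M \<rightarrow>\<^sub>M sample_space" if "i \<ge> 1" for i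
    using indep that by (auto simp: indep_vars_def)
  have P: "prob_space P" using prob_space_distr[OF mD[of 1]] distr_D[of 1] by simp
  have sP[measurable_cong]: "sets P = sets sample_space" using distr_D[of 1] by auto
  interpret P: prob_space P by fact
  interpret \<mu>: prob_space ?\<mu> by (rule P.prob_space_distr) simp
  have [measurable]: "h \<in> borel_measurable borel" using h by auto
  define p where "p = measure ?\<mu> A"
  define q where "q = (\<integral>x. indicator A x * h x \<partial>?\<mu>)"
  \<comment> \<open>Positive and negative part of \<open>h\<close> on A: their integrals
    \<open>a\<close> and \<open>b\<close> are the excess risks of predicting 0 and 1 on the whole
    cell.\<close>
  define ha where "ha x = indicator A x * max 0 (h x)" for x
  define hb where "hb x = indicator A x * max 0 (- h x)" for x
  have ha[measurable]: "integrable ?\<mu> ha" and hb[measurable]: "integrable ?\<mu> hb"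
    unfolding ha_def hb_def
    by (auto intro!: Bochner_Integration.integrable_bound[OF h] AE_I2 split: split_indicator)
  define a where "a = (\<integral>x. ha x \<partial>?\<mu>)"
  define b where "b = (\<integral>x. hb x \<partial>?\<mu>)"
  have ha0: "0 \<le> ha x" and hb0: "0 \<le> hb x" for x by (simp_all add: ha_def hb_def)
  have ia: "(\<integral>\<^sup>+x. ennreal (ha x) \<partial>?\<mu>) = ennreal a"
    unfolding a_def using ha ha0 by (intro nn_integral_eq_integral AE_I2)
  have ib: "(\<integral>\<^sup>+x. ennreal (hb x) \<partial>?\<mu>) = ennreal b"
    unfolding b_def using hb hb0 by (intro nn_integral_eq_integral AE_I2)
  have ab0: "0 \<le> a" "0 \<le> b"
    unfolding a_def b_def by (auto intro!: Bochner_Integration.integral_nonneg simp: ha_def hb_def)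
  have q_ab: "q = a - b"
    unfolding q_def a_def b_def
    by (subst Bochner_Integration.integral_diff[symmetric, OF ha hb])
       (auto intro!: Bochner_Integration.integral_cong simp: ha_def hb_def split: split_indicator)
  define S where "S \<omega> = (\<Sum>i=1..n. vote A (D i \<omega>))" for \<omega>
  have mS[measurable]: "S \<in> borel_measurable M"
    unfolding S_def by measurable
  \<comment> \<open>The sum has mean n q. A sign that disagrees with q forces a deviation of at
    least n |q|.\<close>
  let ?W = "{\<omega> \<in> space M. \<bar>S \<omega> - n * q\<bar> \<ge> n * \<bar>q\<bar>}"
  have W[measurable]: "?W \<in> sets M" by measurable
  let ?mis = "\<lambda>\<omega> x. if majority {i \<in> {1..n}. fst (D i \<omega>) \<in> A} (\<lambda>i. snd (D i \<omega>)) \<noteq> (h x > 0) then 1 else (0::ennreal)"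
  have inner: "(\<integral>\<^sup>+x. indicator A x * ennreal \<bar>h x\<bar> * ?mis \<omega> x \<partial>?\<mu>) = (if S \<omega> > 0 then ennreal b else ennreal a)" for \<omega>
  proof -
    have "indicator A x * ennreal \<bar>h x\<bar> * ?mis \<omega> x = (if S \<omega> > 0 then ennreal (hb x) else ennreal (ha x))" for x
      unfolding majority_iff_sum_votes S_def[symmetric]
      by (auto simp: ha_def hb_def max_def split: split_indicator)
    then show ?thesis by (simp add: ia ib)
  qed
  have "(\<integral>\<^sup>+\<omega>. \<integral>\<^sup>+x. indicator A x * ennreal \<bar>h x\<bar> * ?mis \<omega> x \<partial>?\<mu> \<partial>M)
      \<le> (\<integral>\<^sup>+\<omega>. ennreal (min a b) + ennreal \<bar>q\<bar> * indicator ?W \<omega> \<partial>M)"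
    unfolding inner
  proof (rule nn_integral_mono)
    fix \<omega> assume \<omega>: "\<omega> \<in> space M"
    \<comment> \<open>The better label costs min a b, the worse one |a - b| = |q| more, and the
      worse one is chosen only on \<open>?W\<close>.\<close>
    have "(if S \<omega> > 0 then b else a) \<le> min a b + \<bar>q\<bar> * indicator ?W \<omega>"
    proof (cases "(S \<omega> > 0) = (a > b)")
      case False
      then have "\<bar>S \<omega> - n * q\<bar> \<ge> n * \<bar>q\<bar>"
      proof (cases "a > b")
        case True
        then have "n * q \<ge> 0" "n * \<bar>q\<bar> = n * q" "S \<omega> \<le> 0" using q_ab False by auto
        then show ?thesis by linarith
      next
        case ab: False
        then have "n * q \<le> 0" "n * \<bar>q\<bar> = - (n * q)" "S \<omega> > 0"
          using q_ab False ab by (auto simp: right_diff_distrib intro!: mult_left_mono)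
        then show ?thesis by linarith
      qed
      then show ?thesis using \<omega> False q_ab by (auto simp: min_def)
    qed (auto simp: min_def add_increasing2)
    then have "ennreal (if S \<omega> > 0 then b else a) \<le> ennreal (min a b + \<bar>q\<bar> * indicator ?W \<omega>)"
      by (rule ennreal_leI)
    also have "\<dots> = ennreal (min a b) + ennreal \<bar>q\<bar> * indicator ?W \<omega>"
      using ab0 by (simp split: split_indicator)
    finally show "(if S \<omega> > 0 then ennreal b else ennreal a) \<le> ennreal (min a b) + ennreal \<bar>q\<bar> * indicator ?W \<omega>"
      by (simp split: if_splits)
  qed
  also have "\<dots> = ennreal (min a b) + ennreal \<bar>q\<bar> * emeasure M ?W"
    by (subst nn_integral_add) (simp_all add: nn_integral_cmult_indicator emeasure_space_1)
  also have "\<dots> = ennreal (min a b) + ennreal (\<bar>q\<bar> * prob ?W)"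
    by (simp add: emeasure_eq_measure ennreal_mult)
  \<comment> \<open>The sign of \<open>c\<close> selects the part of \<open>h\<close> to use: for c
    nonnegative the negative part of \<open>h\<close> is at most |h - c|, for c negative the
    positive part is.\<close>
  also have "ennreal (min a b) \<le> (\<integral>\<^sup>+x. indicator A x * ennreal \<bar>h x - c\<bar> \<partial>?\<mu>)"
  proof (cases "c \<ge> 0")
    case True
    have "ennreal (min a b) \<le> (\<integral>\<^sup>+x. ennreal (hb x) \<partial>?\<mu>)" unfolding ib by (rule ennreal_leI) simp
    also have "\<dots> \<le> (\<integral>\<^sup>+x. indicator A x * ennreal \<bar>h x - c\<bar> \<partial>?\<mu>)"
      using True by (intro nn_integral_mono) (auto simp: hb_def intro!: ennreal_leI split: split_indicator)
    finally show ?thesis .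
  next
    case False
    have "ennreal (min a b) \<le> (\<integral>\<^sup>+x. ennreal (ha x) \<partial>?\<mu>)" unfolding ia by (rule ennreal_leI) simp
    also have "\<dots> \<le> (\<integral>\<^sup>+x. indicator A x * ennreal \<bar>h x - c\<bar> \<partial>?\<mu>)"
      using False by (intro nn_integral_mono) (auto simp: ha_def intro!: ennreal_leI split: split_indicator)
    finally show ?thesis .
  qed
  also have "\<bar>q\<bar> * prob ?W \<le> \<theta> * p + 1 / (\<theta> * n)"
  \<comment> \<open>A small mean is paid for by \<theta> p outright. Otherwise Chebyshev leaves |q|
    n p / (n |q|)^2 = p / (n |q|), which is below 1 / (\<theta> n).\<close>
  proof (cases "\<bar>q\<bar> \<le> \<theta> * p")
    case True
    have "\<bar>q\<bar> * prob ?W \<le> \<bar>q\<bar> * 1" by (rule mult_left_mono) simp_all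
    also have "\<dots> \<le> \<theta> * p + 1 / (\<theta> * n)" using True \<theta> by (simp add: add_increasing2)
    finally show ?thesis .
  next
    case False
    have p0: "0 \<le> p" by (simp add: p_def)
    then have q0: "\<bar>q\<bar> > 0" using False \<theta> by (smt (verit) mult_nonneg_nonneg)
    have E1: "expectation (\<lambda>\<omega>. vote A (D i \<omega>)) = q" if "i \<in> {1..n}" for i
    proof -
      have "expectation (\<lambda>\<omega>. vote A (D i \<omega>)) = (\<integral>z. vote A z \<partial>distr M sample_space (D i))"
        using that by (subst integral_distr) auto
      then show ?thesis using that by (simp add: distr_D hP q_def)
    qed
    have E2: "expectation (\<lambda>\<omega>. (vote A (D i \<omega>))\<^sup>2) \<le> p" if "i \<in> {1..n}" for i
    proof -
      have "expectation (\<lambda>\<omega>. (vote A (D i \<omega>))\<^sup>2) = (\<integral>z. (vote A z)\<^sup>2 \<partial>distr M sample_space (D i))"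
        using that by (subst integral_distr) auto
      also have "\<dots> = (\<integral>z. indicator A (fst z) \<partial>P)"
        using that by (simp add: distr_D) (intro Bochner_Integration.integral_cong, auto simp: vote_def power2_eq_square split: split_indicator)
      also have "\<dots> = (\<integral>x. indicator A x \<partial>?\<mu>)"
        by (subst integral_distr) simp_all
      also have "\<dots> = p" by (simp add: p_def)
      finally show ?thesis by simp
    qed
    have ind: "indep_vars (\<lambda>_. borel) (\<lambda>i \<omega>. vote A (D i \<omega>)) {1..n}"
      by (rule indep_vars_compose2[OF indep_vars_subset[OF indep]]) auto
    have "prob {\<omega> \<in> space M. \<bar>(\<Sum>i=1..n. vote A (D i \<omega>)) - card {1..n} * q\<bar> \<ge> n * \<bar>q\<bar>} \<le> card {1..n} * p / (n * \<bar>q\<bar>)\<^sup>2"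
      by (rule prob_sum_deviation_le[OF ind, where B=1])
         (use n q0 E1 E2 in \<open>auto simp: vote_def split: split_indicator\<close>)
    then have "\<bar>q\<bar> * prob ?W \<le> \<bar>q\<bar> * (n * p / (n * \<bar>q\<bar>)\<^sup>2)"
      by (intro mult_left_mono) (auto simp: S_def)
    also have "\<dots> = p / (n * \<bar>q\<bar>)"
      using q0 n by (simp add: power2_eq_square field_simps)
    also have "\<dots> \<le> 1 / (\<theta> * n)"
      using False q0 n \<theta> by (simp add: field_simps)
    also have "\<dots> \<le> \<theta> * p + 1 / (\<theta> * n)" using p0 \<theta> by simp
    finally show ?thesis .
  qed
  also have "ennreal (\<theta> * p + 1 / (\<theta> * n)) = ennreal \<theta> * emeasure ?\<mu> A + ennreal (1 / (\<theta> * n))"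
    using \<theta> n by (simp add: p_def \<mu>.emeasure_eq_measure ennreal_mult)
  finally show ?thesis by (simp add: add_left_mono add_right_mono ennreal_leI)
qed

section \<open>Excess risk of one tree\<close>

text \<open>The regression function enters only through \<open>mean_vote\<close>, which says that
  \<open>h\<close> is 2\<eta> - 1 in integrated form; conditional expectations are thereby kept out
  of the risk estimates.\<close>

locale iid_sample = prob_space M for M :: "'w measure" +
  fixes D :: "nat \<Rightarrow> 'w \<Rightarrow> 'd::finite sample" and P :: "'d sample measure" and h :: "real ^ 'd \<Rightarrow> real"
  assumes indep_D: "indep_vars (\<lambda>_. sample_space) D {1..}"
    and distr_D: "\<And>i. i \<ge> 1 \<Longrightarrow> distr M sample_space (D i) = P"
    and integrable_h: "integrable (distr P borel fst) h"
    and mean_vote: "\<And>A. A \<in> sets borel \<Longrightarrow> (\<integral>z. vote A z \<partial>P) = (\<integral>x. indicator A x * h x \<partial>distr P borel fst)"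
begin

abbreviation "\<mu> \<equiv> distr P borel fst"

lemma measurable_D: "i \<ge> 1 \<Longrightarrow> D i \<in> M \<rightarrow>\<^sub>M sample_space"
  using indep_D by (auto simp: indep_vars_def)

lemma sets_P [measurable_cong]: "sets P = sets sample_space"
  using distr_D[of 1] by auto

lemma prob_space_P: "prob_space P"
  using prob_space_distr[OF measurable_D[of 1]] distr_D[of 1] by simp

lemma prob_space_mu: "prob_space \<mu>"
  by (rule prob_space.prob_space_distr[OF prob_space_P]) simp

lemma measurable_h [measurable]: "h \<in> borel_measurable borel"
  using integrable_h by auto

abbreviation mismatch :: "(real ^ 'd) set \<Rightarrow> nat \<Rightarrow> 'w \<Rightarrow> real ^ 'd \<Rightarrow> ennreal" where
  "mismatch A n \<omega> x \<equiv>
     (if majority {i \<in> {1..n}. fst (D i \<omega>) \<in> A} (\<lambda>i. snd (D i \<omega>)) \<noteq> (h x > 0) then 1 else 0)"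

text \<open>Leaf cells are disjoint, so the sum over nodes has at most one nonzero term.\<close>

lemma nn_integral_leaf_indicator_le:
  assumes "\<And>v. is_leaf lam t v \<Longrightarrow> x \<in> node_cell C t v \<Longrightarrow> f v \<le> c"
  shows "(\<integral>\<^sup>+v. (if is_leaf lam t v \<and> x \<in> node_cell C t v then f v else 0) \<partial>count_space UNIV) \<le> c"
proof (cases "\<exists>v. is_leaf lam t v \<and> x \<in> node_cell C t v")
  case True
  then obtain w where w: "is_leaf lam t w" "x \<in> node_cell C t w" by blast
  have eq: "is_leaf lam t v \<and> x \<in> node_cell C t v \<longleftrightarrow> v = w" for v
    using w leaf_cells_disjoint[OF w(1), of v C] by blast
  have "(\<integral>\<^sup>+v. (if is_leaf lam t v \<and> x \<in> node_cell C t v then f v else 0) \<partial>count_space UNIV)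
      = (\<integral>\<^sup>+v. f w * indicator {w} v \<partial>count_space UNIV)"
    unfolding eq by (intro nn_integral_cong) (auto split: split_indicator)
  also have "\<dots> = f w" by (subst nn_integral_cmult_indicator) auto
  finally show ?thesis using assms[OF w] by simp
next
  case False
  then have "(if is_leaf lam t v \<and> x \<in> node_cell C t v then f v else 0) = 0" for v by auto
  then show ?thesis by simp
qed

text \<open>The partition is deterministic here and only the data are random.
  \<open>cell_excess_risk\<close> is summed over the leaves with the constant f(y) for some y in the
  cell. Leaves with all sides at most \<open>r\<close> use the uniform continuity of
  \<open>f\<close>, the others the crude bound 2B. Infinitely many leaves make the last term
  infinite, and the bound trivial.\<close>

lemma fixed_tree_excess_risk:
  fixes t :: "'d draw_tree" and lam r :: real
  defines "leaves \<equiv> {v. is_leaf lam t v}"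
  assumes covered: "AE x in \<mu>. \<exists>v. is_leaf lam t v \<and> x \<in> node_cell C t v"
    and n: "n \<ge> 1" and \<theta>: "\<theta> > 0" and \<epsilon>: "\<epsilon> \<ge> 0" and B: "B \<ge> 0"
    and f [measurable]: "f \<in> borel_measurable borel"
    and f_unif: "\<And>x y. x \<in> cbox (fst C) (snd C) \<Longrightarrow> y \<in> cbox (fst C) (snd C) \<Longrightarrow>
        (\<And>j. \<bar>x $ j - y $ j\<bar> \<le> r) \<Longrightarrow> \<bar>f x - f y\<bar> \<le> \<epsilon>"
    and f_bdd: "\<And>x. x \<in> cbox (fst C) (snd C) \<Longrightarrow> \<bar>f x\<bar> \<le> B"
  shows "(\<integral>\<^sup>+\<omega>. \<integral>\<^sup>+x. ennreal \<bar>h x\<bar> *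
        (if tree_classify (mondrian_partition C lam t) n (\<lambda>i. D i \<omega>) x \<noteq> (h x > 0) then 1 else 0) \<partial>\<mu> \<partial>M)
    \<le> (\<integral>\<^sup>+x. ennreal \<bar>h x - f x\<bar> \<partial>\<mu>) + ennreal (\<epsilon> + \<theta>)
      + ennreal (2 * B) * (\<integral>\<^sup>+x. \<integral>\<^sup>+v. (if is_leaf lam t v \<and> x \<in> node_cell C t v \<and>
            (\<exists>j. side (node_box C t v) j > r) then 1 else 0) \<partial>count_space UNIV \<partial>\<mu>)
      + ennreal (1 / (\<theta> * n)) * (\<integral>\<^sup>+v. indicator leaves v \<partial>count_space UNIV)"
proof -
  let ?A = "node_cell C t"
  let ?I = "\<lambda>v \<omega>. \<integral>\<^sup>+x. indicator (?A v) x * ennreal \<bar>h x\<bar> * mismatch (?A v) n \<omega> x \<partial>\<mu>"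
  interpret \<mu>: prob_space \<mu> by (rule prob_space_mu)
  define bad where "bad v \<longleftrightarrow> (\<exists>j. side (node_box C t v) j > r)" for v
  have [measurable]: "?A v \<in> sets borel" for v by (rule node_cell_measurable)
  have mm[measurable]: "(\<lambda>x. mismatch (?A v) n \<omega> x) \<in> borel_measurable borel" for v \<omega>
    unfolding majority_iff_sum_votes by measurable
  have mI[measurable]: "?I v \<in> borel_measurable M" for v
  proof -
    have [measurable]: "D i \<in> M \<rightarrow>\<^sub>M sample_space" if "i \<in> {1..n}" for i
      using measurable_D that by auto
    show ?thesis unfolding majority_iff_sum_votes by measurable
  qed
  have "(\<integral>\<^sup>+\<omega>. \<integral>\<^sup>+x. ennreal \<bar>h x\<bar> *
        (if tree_classify (mondrian_partition C lam t) n (\<lambda>i. D i \<omega>) x \<noteq> (h x > 0) then 1 else 0) \<partial>\<mu> \<partial>M)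
     \<le> (\<integral>\<^sup>+\<omega>. \<integral>\<^sup>+x. \<integral>\<^sup>+v. indicator leaves v * (indicator (?A v) x * ennreal \<bar>h x\<bar> * mismatch (?A v) n \<omega> x) \<partial>count_space UNIV \<partial>\<mu> \<partial>M)"
  proof (rule nn_integral_mono, rule nn_integral_mono_AE, use covered in eventually_elim)
    case (elim \<omega> x)
    then obtain v where v: "is_leaf lam t v" "x \<in> ?A v" by blast
    have "ennreal \<bar>h x\<bar> * (if tree_classify (mondrian_partition C lam t) n (\<lambda>i. D i \<omega>) x \<noteq> (h x > 0) then 1 else 0)
       = ennreal \<bar>h x\<bar> * mismatch (?A v) n \<omega> x"
      by (simp add: tree_classify_def leaf_cell_mondrian_partition[OF v])
    also have "\<dots> = (\<integral>\<^sup>+w. (ennreal \<bar>h x\<bar> * mismatch (?A v) n \<omega> x) * indicator {v} w \<partial>count_space UNIV)"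
      by (subst nn_integral_cmult_indicator) auto
    also have "\<dots> \<le> (\<integral>\<^sup>+v. indicator leaves v * (indicator (?A v) x * ennreal \<bar>h x\<bar> * mismatch (?A v) n \<omega> x) \<partial>count_space UNIV)"
      using v by (intro nn_integral_mono) (auto simp: leaves_def split: split_indicator)
    finally show ?case .
  qed
  \<comment> \<open>Tonelli moves the sum over nodes outside, so that each cell can be treated
    separately.\<close>
  also have "\<dots> = (\<integral>\<^sup>+v. indicator leaves v * (\<integral>\<^sup>+\<omega>. ?I v \<omega> \<partial>M) \<partial>count_space UNIV)"
  proof -
    have "(\<integral>\<^sup>+\<omega>. \<integral>\<^sup>+x. \<integral>\<^sup>+v. indicator leaves v * (indicator (?A v) x * ennreal \<bar>h x\<bar> * mismatch (?A v) n \<omega> x) \<partial>count_space UNIV \<partial>\<mu> \<partial>M)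
      = (\<integral>\<^sup>+\<omega>. \<integral>\<^sup>+v. \<integral>\<^sup>+x. indicator leaves v * (indicator (?A v) x * ennreal \<bar>h x\<bar> * mismatch (?A v) n \<omega> x) \<partial>\<mu> \<partial>count_space UNIV \<partial>M)"
      by (intro nn_integral_cong nn_integral_count_space_nn_integral) auto
    also have "\<dots> = (\<integral>\<^sup>+\<omega>. \<integral>\<^sup>+v. indicator leaves v * ?I v \<omega> \<partial>count_space UNIV \<partial>M)"
      by (intro nn_integral_cong nn_integral_cmult) measurable
    also have "\<dots> = (\<integral>\<^sup>+v. \<integral>\<^sup>+\<omega>. indicator leaves v * ?I v \<omega> \<partial>M \<partial>count_space UNIV)"
      by (intro nn_integral_count_space_nn_integral countableI_type borel_measurable_times_ennreal mI borel_measurable_const)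
    also have "\<dots> = (\<integral>\<^sup>+v. indicator leaves v * (\<integral>\<^sup>+\<omega>. ?I v \<omega> \<partial>M) \<partial>count_space UNIV)"
      by (intro nn_integral_cong nn_integral_cmult mI)
    finally show ?thesis .
  qed
  also have "\<dots> \<le> (\<integral>\<^sup>+v. (\<integral>\<^sup>+x. (if is_leaf lam t v \<and> x \<in> ?A v then ennreal \<bar>h x - f x\<bar> else 0) \<partial>\<mu>)
      + (\<integral>\<^sup>+x. (if is_leaf lam t v \<and> x \<in> ?A v then ennreal (\<epsilon> + \<theta>) else 0) \<partial>\<mu>)
      + ennreal (2 * B) * (\<integral>\<^sup>+x. (if is_leaf lam t v \<and> x \<in> ?A v \<and> bad v then 1 else 0) \<partial>\<mu>)
      + ennreal (1 / (\<theta> * n)) * indicator leaves v \<partial>count_space UNIV)"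
  proof (rule nn_integral_mono)
    fix v
    \<comment> \<open>For an empty cell the choice is arbitrary, and all integrals over the cell
      vanish.\<close>
    define c where "c = f (SOME y. y \<in> ?A v)"
    show "indicator leaves v * (\<integral>\<^sup>+\<omega>. ?I v \<omega> \<partial>M)
      \<le> (\<integral>\<^sup>+x. (if is_leaf lam t v \<and> x \<in> ?A v then ennreal \<bar>h x - f x\<bar> else 0) \<partial>\<mu>)
      + (\<integral>\<^sup>+x. (if is_leaf lam t v \<and> x \<in> ?A v then ennreal (\<epsilon> + \<theta>) else 0) \<partial>\<mu>)
      + ennreal (2 * B) * (\<integral>\<^sup>+x. (if is_leaf lam t v \<and> x \<in> ?A v \<and> bad v then 1 else 0) \<partial>\<mu>)
      + ennreal (1 / (\<theta> * n)) * indicator leaves v"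
    proof (cases "is_leaf lam t v")
      case leaf: True
      have "indicator (?A v) x * ennreal \<bar>h x - c\<bar> \<le>
          (if x \<in> ?A v then ennreal \<bar>h x - f x\<bar> else 0) + indicator (?A v) x * ennreal \<epsilon> + ennreal (2 * B) * (if x \<in> ?A v \<and> bad v then 1 else 0)" for x
      proof (cases "x \<in> ?A v")
        case True
        define y where "y = (SOME y. y \<in> ?A v)"
        have y: "y \<in> ?A v" unfolding y_def using True by (rule someI)
        have xy: "x \<in> cbox (fst C) (snd C)" "y \<in> cbox (fst C) (snd C)"
          using node_cell_subset_root[of C t v] True y by auto
        have "\<bar>f x - f y\<bar> \<le> \<epsilon> + 2 * B * (if bad v then 1 else 0)"
        proof (cases "bad v")
          case True
          then show ?thesis using f_bdd[OF xy(1)] f_bdd[OF xy(2)] \<epsilon> by simp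
        next
          case False
          have "\<bar>x $ j - y $ j\<bar> \<le> r" for j
          proof -
            have "x \<in> cbox (fst (node_box C t v)) (snd (node_box C t v))" "y \<in> cbox (fst (node_box C t v)) (snd (node_box C t v))"
              using node_cell_subset_node_box[of C t v] True y by auto
            then have "fst (node_box C t v) $ j \<le> x $ j" "x $ j \<le> snd (node_box C t v) $ j"
                "fst (node_box C t v) $ j \<le> y $ j" "y $ j \<le> snd (node_box C t v) $ j"
              by (auto simp: mem_box_cart)
            moreover have "side (node_box C t v) j \<le> r" using False by (auto simp: bad_def not_less)
            ultimately show ?thesis by (auto simp: side_def)
          qed
          then show ?thesis using f_unif[OF xy] False by simp
        qed
        then have "\<bar>h x - f y\<bar> \<le> \<bar>h x - f x\<bar> + \<epsilon> + 2 * B * (if bad v then 1 else 0)" by linarith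
        then have "ennreal \<bar>h x - c\<bar> \<le> ennreal (\<bar>h x - f x\<bar> + \<epsilon> + 2 * B * (if bad v then 1 else 0))"
          unfolding c_def y_def by (rule ennreal_leI)
        also have "\<dots> = ennreal \<bar>h x - f x\<bar> + ennreal \<epsilon> + ennreal (2 * B) * (if bad v then 1 else 0)"
          using \<epsilon> B by simp
        finally show ?thesis using True by simp
      qed simp
      then have "(\<integral>\<^sup>+x. indicator (?A v) x * ennreal \<bar>h x - c\<bar> \<partial>\<mu>) \<le>
         (\<integral>\<^sup>+x. (if x \<in> ?A v then ennreal \<bar>h x - f x\<bar> else 0) + indicator (?A v) x * ennreal \<epsilon> + ennreal (2 * B) * (if x \<in> ?A v \<and> bad v then 1 else 0) \<partial>\<mu>)"
        by (intro nn_integral_mono)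
      also have "\<dots> = (\<integral>\<^sup>+x. (if x \<in> ?A v then ennreal \<bar>h x - f x\<bar> else 0) \<partial>\<mu>) + emeasure \<mu> (?A v) * ennreal \<epsilon>
         + ennreal (2 * B) * (\<integral>\<^sup>+x. (if x \<in> ?A v \<and> bad v then 1 else 0) \<partial>\<mu>)"
        by (simp add: nn_integral_add nn_integral_cmult nn_integral_multc)
      finally have *: "(\<integral>\<^sup>+x. indicator (?A v) x * ennreal \<bar>h x - c\<bar> \<partial>\<mu>) \<le> \<dots>" .
      have "(\<integral>\<^sup>+x. (if x \<in> ?A v then ennreal (\<epsilon> + \<theta>) else 0) \<partial>\<mu>) = (\<integral>\<^sup>+x. ennreal (\<epsilon> + \<theta>) * indicator (?A v) x \<partial>\<mu>)"
        by (intro nn_integral_cong) auto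
      also have "\<dots> = ennreal (\<epsilon> + \<theta>) * emeasure \<mu> (?A v)"
        by (rule nn_integral_cmult_indicator) simp
      also have "\<dots> = emeasure \<mu> (?A v) * ennreal \<epsilon> + ennreal \<theta> * emeasure \<mu> (?A v)"
        using \<epsilon> \<theta> by (simp add: distrib_right mult.commute)
      finally have **: "(\<integral>\<^sup>+x. (if x \<in> ?A v then ennreal (\<epsilon> + \<theta>) else 0) \<partial>\<mu>) = \<dots>" .
      have "(\<integral>\<^sup>+\<omega>. ?I v \<omega> \<partial>M)
        \<le> (\<integral>\<^sup>+x. indicator (?A v) x * ennreal \<bar>h x - c\<bar> \<partial>\<mu>) + (ennreal \<theta> * emeasure \<mu> (?A v) + ennreal (1 / (\<theta> * n)))"
        by (rule cell_excess_risk[OF indep_D distr_D _ integrable_h mean_vote n \<theta>]) simp_all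
      also have "\<dots> \<le> ((\<integral>\<^sup>+x. (if x \<in> ?A v then ennreal \<bar>h x - f x\<bar> else 0) \<partial>\<mu>) + emeasure \<mu> (?A v) * ennreal \<epsilon>
         + ennreal (2 * B) * (\<integral>\<^sup>+x. (if x \<in> ?A v \<and> bad v then 1 else 0) \<partial>\<mu>)) + (ennreal \<theta> * emeasure \<mu> (?A v) + ennreal (1 / (\<theta> * n)))"
        by (rule add_right_mono[OF *])
      finally show ?thesis
        using leaf ** by (simp add: leaves_def ac_simps)
    qed (simp add: leaves_def)
  qed
  \<comment> \<open>After summation each of the first two terms is pulled back inside the integral
    over x, where disjointness of the leaves removes the sum.\<close>
  also have "\<dots> = (\<integral>\<^sup>+v. (\<integral>\<^sup>+x. (if is_leaf lam t v \<and> x \<in> ?A v then ennreal \<bar>h x - f x\<bar> else 0) \<partial>\<mu>) \<partial>count_space UNIV)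
      + (\<integral>\<^sup>+v. (\<integral>\<^sup>+x. (if is_leaf lam t v \<and> x \<in> ?A v then ennreal (\<epsilon> + \<theta>) else 0) \<partial>\<mu>) \<partial>count_space UNIV)
      + ennreal (2 * B) * (\<integral>\<^sup>+v. (\<integral>\<^sup>+x. (if is_leaf lam t v \<and> x \<in> ?A v \<and> bad v then 1 else 0) \<partial>\<mu>) \<partial>count_space UNIV)
      + ennreal (1 / (\<theta> * n)) * (\<integral>\<^sup>+v. indicator leaves v \<partial>count_space UNIV)"
    by (simp add: nn_integral_add nn_integral_cmult)
  also have "(\<integral>\<^sup>+v. (\<integral>\<^sup>+x. (if is_leaf lam t v \<and> x \<in> ?A v then ennreal \<bar>h x - f x\<bar> else 0) \<partial>\<mu>) \<partial>count_space UNIV)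
      = (\<integral>\<^sup>+x. (\<integral>\<^sup>+v. (if is_leaf lam t v \<and> x \<in> ?A v then ennreal \<bar>h x - f x\<bar> else 0) \<partial>count_space UNIV) \<partial>\<mu>)"
    by (rule nn_integral_count_space_nn_integral[symmetric]) auto
  also have "\<dots> \<le> (\<integral>\<^sup>+x. ennreal \<bar>h x - f x\<bar> \<partial>\<mu>)"
    by (intro nn_integral_mono nn_integral_leaf_indicator_le) simp
  also have "(\<integral>\<^sup>+v. (\<integral>\<^sup>+x. (if is_leaf lam t v \<and> x \<in> ?A v then ennreal (\<epsilon> + \<theta>) else 0) \<partial>\<mu>) \<partial>count_space UNIV)
      = (\<integral>\<^sup>+x. (\<integral>\<^sup>+v. (if is_leaf lam t v \<and> x \<in> ?A v then ennreal (\<epsilon> + \<theta>) else 0) \<partial>count_space UNIV) \<partial>\<mu>)"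
    by (rule nn_integral_count_space_nn_integral[symmetric]) auto
  also have "\<dots> \<le> (\<integral>\<^sup>+x. ennreal (\<epsilon> + \<theta>) \<partial>\<mu>)"
    by (intro nn_integral_mono nn_integral_leaf_indicator_le) simp
  also have "\<dots> = ennreal (\<epsilon> + \<theta>)" using \<mu>.emeasure_space_1 by simp
  also have "(\<integral>\<^sup>+v. (\<integral>\<^sup>+x. (if is_leaf lam t v \<and> x \<in> ?A v \<and> bad v then 1 else 0) \<partial>\<mu>) \<partial>count_space UNIV)
      = (\<integral>\<^sup>+x. (\<integral>\<^sup>+v. (if is_leaf lam t v \<and> x \<in> ?A v \<and> bad v then 1 else 0) \<partial>count_space UNIV) \<partial>\<mu>)"
    by (rule nn_integral_count_space_nn_integral[symmetric]) auto
  finally show ?thesis by (simp add: bad_def add_mono)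
qed

text \<open>Averages the bound for a fixed partition over the tree. The tree uses its own
  integration variable \<omega>', as if independent of the data; independence is brought in only
  when the forest is decoupled.\<close>

lemma tree_excess_risk:
  fixes lam \<delta> :: real
  assumes "mondrian_tree M C T" and lam: "lam \<ge> 0" and X_C: "AE x in \<mu>. x \<in> cbox (fst C) (snd C)"
    and n: "n \<ge> 1" and \<theta>: "\<theta> > 0" and \<epsilon>: "\<epsilon> \<ge> 0" and B: "B \<ge> 0" and \<delta>: "\<delta> > 0"
    and f [measurable]: "f \<in> borel_measurable borel"
    and f_unif: "\<And>x y. x \<in> cbox (fst C) (snd C) \<Longrightarrow> y \<in> cbox (fst C) (snd C) \<Longrightarrow>
        (\<And>j. \<bar>x $ j - y $ j\<bar> \<le> 2 * \<delta>) \<Longrightarrow> \<bar>f x - f y\<bar> \<le> \<epsilon>"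
    and f_bdd: "\<And>x. x \<in> cbox (fst C) (snd C) \<Longrightarrow> \<bar>f x\<bar> \<le> B"
  shows "(\<integral>\<^sup>+\<omega>'. \<integral>\<^sup>+\<omega>. \<integral>\<^sup>+x. ennreal \<bar>h x\<bar> *
        (if tree_classify (mondrian_partition C lam (T \<omega>')) n (\<lambda>i. D i \<omega>) x \<noteq> (h x > 0) then 1 else 0) \<partial>\<mu> \<partial>M \<partial>M)
    \<le> (\<integral>\<^sup>+x. ennreal \<bar>h x - f x\<bar> \<partial>\<mu>) + ennreal (\<epsilon> + \<theta>)
      + ennreal (2 * B) * ennreal (2 * CARD('d) * exp (- \<delta> * lam))
      + ennreal (1 / (\<theta> * n)) * ennreal (\<Prod>j\<in>UNIV. 1 + lam * side C j)"
proof -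
  interpret T: mondrian_tree M C T by fact
  interpret \<mu>: prob_space \<mu> by (rule prob_space_mu)
  interpret M\<mu>: pair_sigma_finite M \<mu> ..
  note [measurable] = T.measurable_T
  let ?in = "\<lambda>\<omega> v x. is_leaf lam (T \<omega>) v \<and> x \<in> node_cell C (T \<omega>) v"
  let ?bad = "\<lambda>\<omega> v. \<exists>j. side (node_box C (T \<omega>) v) j > 2 * \<delta>"
  let ?wide = "\<lambda>\<omega> v x. if is_leaf lam (T \<omega>) v \<and> x \<in> node_cell C (T \<omega>) v \<and> ?bad \<omega> v then 1 else (0::ennreal)"
  \<comment> \<open>\<open>AE_point_in_leaf\<close> has an exceptional tree event for each point;
    Fubini turns this into an exceptional set of points for almost every tree.\<close>
  have covered: "AE \<omega> in M. AE x in \<mu>. \<exists>v. ?in \<omega> v x"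
  proof -
    have "AE x in \<mu>. AE \<omega> in M. \<exists>v. ?in \<omega> v x"
      using X_C by eventually_elim (rule T.AE_point_in_leaf[OF _ lam])
    then show ?thesis
      by (subst M\<mu>.AE_commute) measurable
  qed
  have affine: "(\<integral>\<^sup>+\<omega>. a + b + c * u \<omega> + d * w \<omega> \<partial>M) = a + b + c * (\<integral>\<^sup>+\<omega>. u \<omega> \<partial>M) + d * (\<integral>\<^sup>+\<omega>. w \<omega> \<partial>M)"
    if "u \<in> borel_measurable M" "w \<in> borel_measurable M" for a b c d :: ennreal and u w
    using that by (simp add: nn_integral_add nn_integral_cmult emeasure_space_1)
  have mcount: "(\<lambda>\<omega>. \<integral>\<^sup>+v. indicator {v. is_leaf lam (T \<omega>) v} v \<partial>count_space UNIV) \<in> borel_measurable M"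
    unfolding nn_integral_nodes indicator_def mem_Collect_eq by measurable
  have mbad: "(\<lambda>(\<omega>, x). \<integral>\<^sup>+v. ?wide \<omega> v x \<partial>count_space UNIV)
      \<in> borel_measurable (M \<Otimes>\<^sub>M \<mu>)"
    unfolding nn_integral_nodes by measurable
  then have mbad': "(\<lambda>\<omega>. \<integral>\<^sup>+x. \<integral>\<^sup>+v. ?wide \<omega> v x \<partial>count_space UNIV \<partial>\<mu>)
      \<in> borel_measurable M"
    by (rule \<mu>.borel_measurable_nn_integral)
  have bad: "(\<integral>\<^sup>+\<omega>. \<integral>\<^sup>+v. ?wide \<omega> v x \<partial>count_space UNIV \<partial>M)
      \<le> ennreal (2 * CARD('d) * exp (- \<delta> * lam))" for x
  proof -
    \<comment> \<open>Segments of length \<delta> leaving \<open>x\<close> in the two directions of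
      axis j; as degenerate boxes they have size \<delta>.\<close>
    define R where "R j = (x, x + axis j \<delta>)" for j
    define L where "L j = (x - axis j \<delta>, x)" for j
    have side0: "side (R j) i \<ge> 0" "side (L j) i \<ge> 0" for i j
      using \<delta> by (auto simp: side_def R_def L_def axis_def)
    have size: "box_size (R j) = \<delta>" "box_size (L j) = \<delta>" for j
      by (simp_all add: box_size_def side_def R_def L_def axis_def)
    let ?g = "\<lambda>B \<omega> v. indicator {\<omega>. is_leaf lam (T \<omega>) v} \<omega> * (if contains_box B (node_box C (T \<omega>) v) then 1 else (0::ennreal))"
    have mg[measurable]: "(\<lambda>\<omega>. ?g B \<omega> v) \<in> borel_measurable M" for B v
      unfolding indicator_def mem_Collect_eq contains_box_def by measurable
    have "(\<integral>\<^sup>+\<omega>. \<integral>\<^sup>+v. ?wide \<omega> v x \<partial>count_space UNIV \<partial>M)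
      \<le> (\<integral>\<^sup>+\<omega>. \<integral>\<^sup>+v. (\<Sum>j\<in>UNIV. ?g (R j) \<omega> v + ?g (L j) \<omega> v) \<partial>count_space UNIV \<partial>M)"
    proof (intro nn_integral_mono)
      fix \<omega> v
      show "?wide \<omega> v x \<le> (\<Sum>j\<in>UNIV. ?g (R j) \<omega> v + ?g (L j) \<omega> v)"
      proof (cases "is_leaf lam (T \<omega>) v \<and> x \<in> node_cell C (T \<omega>) v \<and> ?bad \<omega> v")
        case True
        then obtain j where j: "side (node_box C (T \<omega>) v) j > 2 * \<delta>" by blast
        have x: "fst (node_box C (T \<omega>) v) $ i \<le> x $ i" "x $ i \<le> snd (node_box C (T \<omega>) v) $ i" for i
          using True node_cell_subset_node_box[of C "T \<omega>" v] by (auto simp: mem_box_cart)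
        \<comment> \<open>A side longer than 2\<delta> leaves more than \<delta> on at least one
          side of \<open>x\<close>, so a wide leaf contains one of the 2d segments.\<close>
        have "x $ j + \<delta> \<le> snd (node_box C (T \<omega>) v) $ j \<or> fst (node_box C (T \<omega>) v) $ j \<le> x $ j - \<delta>"
          using j by (auto simp: side_def)
        then have "contains_box (R j) (node_box C (T \<omega>) v) \<or> contains_box (L j) (node_box C (T \<omega>) v)"
          using x by (auto simp: contains_box_def R_def L_def axis_def)
        then have "1 \<le> ?g (R j) \<omega> v + ?g (L j) \<omega> v" using True by auto
        also have "\<dots> \<le> (\<Sum>j\<in>UNIV. ?g (R j) \<omega> v + ?g (L j) \<omega> v)"
          by (rule member_le_sum) auto
        finally show ?thesis using True by simp
      next
        case False
        then show ?thesis by (simp only: if_False zero_le)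
      qed
    qed
    also have "\<dots> = (\<integral>\<^sup>+v. \<integral>\<^sup>+\<omega>. (\<Sum>j\<in>UNIV. ?g (R j) \<omega> v + ?g (L j) \<omega> v) \<partial>M \<partial>count_space UNIV)"
      by (rule nn_integral_count_space_nn_integral) (rule countableI_type, measurable)
    also have "\<dots> = (\<Sum>j\<in>UNIV. (\<integral>\<^sup>+v. \<integral>\<^sup>+\<omega>. ?g (R j) \<omega> v \<partial>M \<partial>count_space UNIV) + (\<integral>\<^sup>+v. \<integral>\<^sup>+\<omega>. ?g (L j) \<omega> v \<partial>M \<partial>count_space UNIV))"
      by (simp add: nn_integral_sum nn_integral_add mg)
    also have "\<dots> \<le> (\<Sum>j\<in>(UNIV::'d set). ennreal (exp (- \<delta> * lam)) + ennreal (exp (- \<delta> * lam)))"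
      using T.expected_leaves_containing_box[OF side0(1) lam] T.expected_leaves_containing_box[OF side0(2) lam]
      by (intro sum_mono add_mono) (simp_all add: size)
    also have "\<dots> = ennreal (2 * CARD('d) * exp (- \<delta> * lam))"
      by (simp only: ennreal_plus[symmetric] exp_ge_zero sum_ennreal add_nonneg_nonneg) simp
    finally show ?thesis .
  qed
  have "(\<integral>\<^sup>+\<omega>'. \<integral>\<^sup>+\<omega>. \<integral>\<^sup>+x. ennreal \<bar>h x\<bar> *
        (if tree_classify (mondrian_partition C lam (T \<omega>')) n (\<lambda>i. D i \<omega>) x \<noteq> (h x > 0) then 1 else 0) \<partial>\<mu> \<partial>M \<partial>M)
     \<le> (\<integral>\<^sup>+\<omega>. (\<integral>\<^sup>+x. ennreal \<bar>h x - f x\<bar> \<partial>\<mu>) + ennreal (\<epsilon> + \<theta>)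
      + ennreal (2 * B) * (\<integral>\<^sup>+x. \<integral>\<^sup>+v. ?wide \<omega> v x \<partial>count_space UNIV \<partial>\<mu>)
      + ennreal (1 / (\<theta> * n)) * (\<integral>\<^sup>+v. indicator {v. is_leaf lam (T \<omega>) v} v \<partial>count_space UNIV) \<partial>M)"
  proof (rule nn_integral_mono_AE, use covered in eventually_elim)
    case (elim \<omega>)
    from fixed_tree_excess_risk[OF elim n \<theta> \<epsilon> B f, of "2 * \<delta>"] f_unif f_bdd show ?case by blast
  qed
  also have "\<dots> = (\<integral>\<^sup>+x. ennreal \<bar>h x - f x\<bar> \<partial>\<mu>) + ennreal (\<epsilon> + \<theta>)
      + ennreal (2 * B) * (\<integral>\<^sup>+\<omega>. \<integral>\<^sup>+x. \<integral>\<^sup>+v. ?wide \<omega> v x \<partial>count_space UNIV \<partial>\<mu> \<partial>M)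
      + ennreal (1 / (\<theta> * n)) * (\<integral>\<^sup>+\<omega>. \<integral>\<^sup>+v. indicator {v. is_leaf lam (T \<omega>) v} v \<partial>count_space UNIV \<partial>M)"
    by (rule affine[OF mbad' mcount])
  also have "(\<integral>\<^sup>+\<omega>. \<integral>\<^sup>+v. indicator {v. is_leaf lam (T \<omega>) v} v \<partial>count_space UNIV \<partial>M)
      = (\<integral>\<^sup>+v. \<integral>\<^sup>+\<omega>. indicator {v. is_leaf lam (T \<omega>) v} v \<partial>M \<partial>count_space UNIV)"
    unfolding indicator_def mem_Collect_eq
    by (rule nn_integral_count_space_nn_integral) (rule countableI_type, measurable)
  also have "\<dots> = (\<integral>\<^sup>+v. emeasure M {\<omega> \<in> space M. is_leaf lam (T \<omega>) v} \<partial>count_space UNIV)"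
    by (intro nn_integral_cong, subst nn_integral_indicator[symmetric], measurable)
       (intro nn_integral_cong, auto split: split_indicator)
  also have "\<dots> \<le> ennreal (\<Prod>j\<in>UNIV. 1 + lam * side C j)"
    by (rule T.expected_leaf_count[OF lam])
  also have "(\<integral>\<^sup>+\<omega>. \<integral>\<^sup>+x. \<integral>\<^sup>+v. ?wide \<omega> v x \<partial>count_space UNIV \<partial>\<mu> \<partial>M)
     = (\<integral>\<^sup>+x. \<integral>\<^sup>+\<omega>. \<integral>\<^sup>+v. ?wide \<omega> v x \<partial>count_space UNIV \<partial>M \<partial>\<mu>)"
    by (rule M\<mu>.Fubini'[symmetric, OF mbad])
  also have "\<dots> \<le> (\<integral>\<^sup>+x. ennreal (2 * CARD('d) * exp (- \<delta> * lam)) \<partial>\<mu>)"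
    by (intro nn_integral_mono bad)
  also have "\<dots> = ennreal (2 * CARD('d) * exp (- \<delta> * lam))"
    using \<mu>.emeasure_space_1 by simp
  finally show ?thesis by (simp add: add_mono mult_left_mono)
qed

end

section \<open>Independence and measurability of the forest\<close>

context iid_sample
begin

text \<open>The continuous approximation of \<open>h\<close>, its bound and its modulus of
  continuity are fixed first; the two terms that depend on the lifetime then vanish as n
  grows.\<close>

lemma tree_risk_tendsto_0:
  assumes T: "mondrian_tree M (0, 1) T" and X_C: "AE x in \<mu>. x \<in> cbox 0 1"
    and lam: "filterlim lam at_top sequentially" "(\<lambda>n. lam n ^ CARD('d) / real n) \<longlonglongrightarrow> 0"
  shows "(\<lambda>n. \<integral>\<^sup>+\<omega>'. \<integral>\<^sup>+\<omega>. \<integral>\<^sup>+x. ennreal \<bar>h x\<bar> *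
        (if tree_classify (mondrian_partition (0, 1) (lam n) (T \<omega>')) n (\<lambda>i. D i \<omega>) x \<noteq> (h x > 0) then 1 else 0) \<partial>\<mu> \<partial>M \<partial>M) \<longlonglongrightarrow> 0"
    (is "?R \<longlonglongrightarrow> 0")
proof -
  interpret \<mu>: prob_space \<mu> by (rule prob_space_mu)
  have small: "\<forall>\<^sub>F n in sequentially. ?R n \<le> ennreal \<kappa>" if \<kappa>: "\<kappa> > 0" for \<kappa> :: real
  proof -
    \<comment> \<open>Five equal shares: approximation, oscillation, the threshold \<theta> (also
      chosen as \<epsilon>), wide leaves, and the leaf count.\<close>
    define \<epsilon> where "\<epsilon> = \<kappa> / 5"
    have \<epsilon>: "\<epsilon> > 0" using \<kappa> by (simp add: \<epsilon>_def)
    obtain f where f: "continuous_on UNIV f" "(\<integral>\<^sup>+x. ennreal \<bar>h x - f x\<bar> \<partial>\<mu>) \<le> ennreal \<epsilon>"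
      using integrable_L1_approx_continuous[OF \<mu>.finite_measure_axioms _ integrable_h \<epsilon>] by auto
    have [measurable]: "f \<in> borel_measurable borel"
      by (rule borel_measurable_continuous_onI[OF f(1)])
    have f_C: "continuous_on (cbox 0 1) f" by (rule continuous_on_subset[OF f(1)]) simp
    have "compact (f ` cbox 0 1)" by (rule compact_continuous_image[OF f_C]) simp
    then obtain B where B: "B \<ge> 0" "\<And>x. x \<in> cbox 0 1 \<Longrightarrow> \<bar>f x\<bar> \<le> B"
      using compact_imp_bounded[of "f ` cbox 0 1"] by (auto simp: bounded_pos intro: less_imp_le)
    have "uniformly_continuous_on (cbox 0 1) f"
      by (rule compact_uniformly_continuous[OF f_C]) simp
    then obtain \<rho> where \<rho>: "\<rho> > 0" "\<And>x y. x \<in> cbox 0 1 \<Longrightarrow> y \<in> cbox 0 1 \<Longrightarrow> dist x y < \<rho> \<Longrightarrow> dist (f x) (f y) < \<epsilon>"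
      using \<epsilon> unfolding uniformly_continuous_on_def by metis
    \<comment> \<open>Coordinate distances up to 2\<delta> give an l1 distance, hence a Euclidean
      one, of at most \<rho> / 2.\<close>
    define \<delta> where "\<delta> = \<rho> / (4 * CARD('d))"
    have \<delta>: "\<delta> > 0" using \<rho>(1) by (simp add: \<delta>_def)
    have f_unif: "\<bar>f x - f y\<bar> \<le> \<epsilon>" if "x \<in> cbox 0 1" "y \<in> cbox 0 1" "\<And>j. \<bar>x $ j - y $ j\<bar> \<le> 2 * \<delta>" for x y
    proof -
      have "dist x y \<le> (\<Sum>j\<in>UNIV. \<bar>(x - y) $ j\<bar>)"
        unfolding dist_norm by (rule norm_le_l1_cart)
      also have "\<dots> \<le> (\<Sum>j\<in>(UNIV :: 'd set). 2 * \<delta>)" using that(3) by (intro sum_mono) simp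
      also have "\<dots> < \<rho>" using \<rho>(1) by (simp add: \<delta>_def)
      finally have "dist (f x) (f y) < \<epsilon>" by (rule \<rho>(2)[OF that(1,2)])
      then show ?thesis by (simp add: dist_real_def)
    qed
    have "filterlim (\<lambda>n. - \<delta> * lam n) at_bot sequentially"
      using \<delta> by (intro filterlim_tendsto_neg_mult_at_bot[OF tendsto_const _ lam(1)]) simp
    then have "(\<lambda>n. exp (- \<delta> * lam n)) \<longlonglongrightarrow> 0"
      by (rule filterlim_compose[OF exp_at_bot])
    then have "(\<lambda>n. 2 * B * (2 * real CARD('d) * exp (- \<delta> * lam n))) \<longlonglongrightarrow> 2 * B * (2 * real CARD('d) * 0)"
      by (intro tendsto_mult tendsto_const)
    then have t1: "\<forall>\<^sub>F n in sequentially. 2 * B * (2 * CARD('d) * exp (- \<delta> * lam n)) < \<epsilon>"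
      using \<epsilon> by (intro order_tendstoD) auto
    \<comment> \<open>For \<open>lam n\<close> at least 1 the leaf count satisfies (1 + lam n)^d
      \<le> (2 lam n)^d, which is where 2^d comes from; dividing by \<theta> n = \<epsilon> n gives
      this sequence.\<close>
    have "(\<lambda>n. 2 ^ CARD('d) / \<epsilon> * (lam n ^ CARD('d) / real n)) \<longlonglongrightarrow> 2 ^ CARD('d) / \<epsilon> * 0"
      by (intro tendsto_intros lam(2))
    then have t2: "\<forall>\<^sub>F n in sequentially. 2 ^ CARD('d) / \<epsilon> * (lam n ^ CARD('d) / real n) < \<epsilon>"
      using \<epsilon> by (intro order_tendstoD) auto
    have t3: "\<forall>\<^sub>F n in sequentially. lam n \<ge> 1"
      using lam(1) by (auto simp: filterlim_at_top)
    show "\<forall>\<^sub>F n in sequentially. ?R n \<le> ennreal \<kappa>"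
      using t1 t2 t3 eventually_ge_at_top[of "1::nat"]
    proof eventually_elim
      case (elim n)
      have "(\<Prod>j\<in>(UNIV :: 'd set). 1 + lam n * side (0, 1) j) = (1 + lam n) ^ CARD('d)"
        by (simp add: side_def)
      also have "\<dots> \<le> (2 * lam n) ^ CARD('d)" using elim by (intro power_mono) auto
      finally have "1 / (\<epsilon> * n) * (\<Prod>j\<in>(UNIV :: 'd set). 1 + lam n * side (0, 1) j) \<le> 1 / (\<epsilon> * n) * (2 * lam n) ^ CARD('d)"
        using \<epsilon> by (intro mult_left_mono) auto
      also have "\<dots> = 2 ^ CARD('d) / \<epsilon> * (lam n ^ CARD('d) / real n)"
        by (simp add: power_mult_distrib)
      finally have count: "1 / (\<epsilon> * n) * (\<Prod>j\<in>(UNIV :: 'd set). 1 + lam n * side (0, 1) j) \<le> \<epsilon>"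
        using elim by simp
      have "?R n \<le> (\<integral>\<^sup>+x. ennreal \<bar>h x - f x\<bar> \<partial>\<mu>) + ennreal (\<epsilon> + \<epsilon>)
        + ennreal (2 * B) * ennreal (2 * CARD('d) * exp (- \<delta> * lam n))
        + ennreal (1 / (\<epsilon> * n)) * ennreal (\<Prod>j\<in>(UNIV :: 'd set). 1 + lam n * side (0, 1) j)"
        by (rule tree_excess_risk[OF T]) (use elim \<epsilon> \<delta> B X_C f_unif in auto)
      also have "\<dots> \<le> ennreal \<epsilon> + ennreal (\<epsilon> + \<epsilon>) + ennreal \<epsilon> + ennreal \<epsilon>"
      proof (intro add_mono f(2) order_refl)
        show "ennreal (2 * B) * ennreal (2 * CARD('d) * exp (- \<delta> * lam n)) \<le> ennreal \<epsilon>"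
          using elim(1) B(1) by (simp flip: ennreal_mult add: ennreal_leI)
        show "ennreal (1 / (\<epsilon> * n)) * ennreal (\<Prod>j\<in>(UNIV :: 'd set). 1 + lam n * side (0, 1) j) \<le> ennreal \<epsilon>"
          using count \<epsilon> elim(3) by (subst ennreal_mult[symmetric]) (auto intro!: ennreal_leI prod_nonneg simp: side_def)
      qed
      also have "\<dots> = ennreal \<kappa>"
        using \<epsilon> by (simp add: \<epsilon>_def flip: ennreal_plus)
      finally show ?case .
    qed
  qed
  show ?thesis
  proof (rule order_tendstoI)
    fix a :: ennreal assume "0 < a"
    then obtain \<kappa> :: real where "0 < \<kappa>" "ennreal \<kappa> < a"
      by (metis ennreal_0 ennreal_eq_0_iff ennreal_lessI dense ennreal_cases less_le top.not_eq_extremum not_le order_less_trans ennreal_less_zero_iff)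
    with small[of \<kappa>] show "\<forall>\<^sub>F n in sequentially. ?R n < a"
      by (auto elim: eventually_mono)
  qed simp
qed

text \<open>\<gamma> and the sign of \<open>h\<close> disagree exactly on A and B. There the
  difference of the error indicators is the vote on A and minus the vote on B, so
  \<open>mean_vote\<close> turns the difference of risks into an integral of |h|.\<close>

lemma excess_risk:
  assumes [measurable]: "Measurable.pred borel \<gamma>"
  shows "emeasure P {z \<in> space P. \<gamma> (fst z) \<noteq> snd z} =
    ennreal (measure P {z \<in> space P. (h (fst z) > 0) \<noteq> snd z}) +
      (\<integral>\<^sup>+x. ennreal \<bar>h x\<bar> * (if \<gamma> x \<noteq> (h x > 0) then 1 else 0) \<partial>\<mu>)"
proof -
  interpret P: prob_space P by (rule prob_space_P)
  define A B where "A = {x. h x > 0 \<and> \<not> \<gamma> x}" and "B = {x. \<not> h x > 0 \<and> \<gamma> x}"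
  have [measurable]: "A \<in> sets borel" "B \<in> sets borel" unfolding A_def B_def by measurable
  have int_vote: "integrable P (vote S)" if [measurable]: "S \<in> sets borel" for S
    by (rule P.integrable_const_bound[where B=1]) (auto simp: vote_def split: split_indicator)
  have int_h: "integrable \<mu> (\<lambda>x. indicator S x * h x)" if [measurable]: "S \<in> sets borel" for S
    using integrable_h by (intro integrable_mult_indicator[where 'b=real, simplified]) auto
  let ?q = "\<integral>x. indicator A x * h x - indicator B x * h x \<partial>\<mu>"
  have "measure P {z \<in> space P. \<gamma> (fst z) \<noteq> snd z} - measure P {z \<in> space P. (h (fst z) > 0) \<noteq> snd z} =
     (\<integral>z. indicator {z \<in> space P. \<gamma> (fst z) \<noteq> snd z} z - indicator {z \<in> space P. (h (fst z) > 0) \<noteq> snd z} z \<partial>P)"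
    by (subst Bochner_Integration.integral_diff) (auto simp: P.emeasure_eq_measure)
  also have "\<dots> = (\<integral>z. vote A z - vote B z \<partial>P)"
    by (rule Bochner_Integration.integral_cong) (auto simp: vote_def A_def B_def split: split_indicator)
  also have "\<dots> = ?q"
    by (simp add: int_vote mean_vote int_h)
  finally have diff: "measure P {z \<in> space P. \<gamma> (fst z) \<noteq> snd z} = measure P {z \<in> space P. (h (fst z) > 0) \<noteq> snd z} + ?q"
    by linarith
  have q0: "0 \<le> ?q"
    by (rule Bochner_Integration.integral_nonneg) (auto simp: A_def B_def split: split_indicator)
  have "ennreal ?q = (\<integral>\<^sup>+x. ennreal (indicator A x * h x - indicator B x * h x) \<partial>\<mu>)"
    by (rule nn_integral_eq_integral[symmetric])
       (auto intro!: int_h Bochner_Integration.integrable_diff AE_I2 simp: A_def B_def split: split_indicator)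
  also have "\<dots> = (\<integral>\<^sup>+x. ennreal \<bar>h x\<bar> * (if \<gamma> x \<noteq> (h x > 0) then 1 else 0) \<partial>\<mu>)"
    by (rule nn_integral_cong) (auto simp: A_def B_def split: split_indicator)
  finally have *: "ennreal ?q = \<dots>" .
  show ?thesis
    unfolding *[symmetric] P.emeasure_eq_measure diff using q0 by (intro ennreal_plus) simp_all
qed

end

text \<open>Independence of the generated sigma-algebras makes the joint law a product, and Tonelli
  gives an iterated integral over independent copies.\<close>

lemma (in prob_space) indep_set_nn_integral:
  assumes [measurable]: "U \<in> M \<rightarrow>\<^sub>M N1" "V \<in> M \<rightarrow>\<^sub>M N2" "F \<in> borel_measurable (N1 \<Otimes>\<^sub>M N2)"
    and indep: "indep_set (sigma_gen M U N1) (sigma_gen M V N2)"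
  shows "(\<integral>\<^sup>+\<omega>. F (U \<omega>, V \<omega>) \<partial>M) = (\<integral>\<^sup>+\<omega>'. \<integral>\<^sup>+\<omega>. F (U \<omega>, V \<omega>') \<partial>M \<partial>M)"
proof -
  interpret U: prob_space "distr M N1 U" by (rule prob_space_distr) simp
  interpret V: prob_space "distr M N2 V" by (rule prob_space_distr) simp
  interpret UV: pair_sigma_finite "distr M N1 U" "distr M N2 V" ..
  have eq: "distr M N1 U \<Otimes>\<^sub>M distr M N2 V = distr M (N1 \<Otimes>\<^sub>M N2) (\<lambda>\<omega>. (U \<omega>, V \<omega>))"
  proof (rule pair_measure_eqI)
    fix A B assume "A \<in> sets (distr M N1 U)" "B \<in> sets (distr M N2 V)"
    then have [measurable]: "A \<in> sets N1" "B \<in> sets N2" by simp_all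
    have "U -` A \<inter> space M \<in> sigma_gen M U N1" "V -` B \<inter> space M \<in> sigma_gen M V N2"
      by (auto simp: sets_vimage_algebra intro!: sigma_sets.Basic)
    from indep_setD[OF indep this]
    have "prob ((U -` A \<inter> space M) \<inter> (V -` B \<inter> space M)) = prob (U -` A \<inter> space M) * prob (V -` B \<inter> space M)" .
    also have "(U -` A \<inter> space M) \<inter> (V -` B \<inter> space M) = (\<lambda>\<omega>. (U \<omega>, V \<omega>)) -` (A \<times> B) \<inter> space M" by auto
    finally show "emeasure (distr M N1 U) A * emeasure (distr M N2 V) B = emeasure (distr M (N1 \<Otimes>\<^sub>M N2) (\<lambda>\<omega>. (U \<omega>, V \<omega>))) (A \<times> B)"
      by (simp add: emeasure_distr emeasure_eq_measure ennreal_mult)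
  qed (simp_all add: U.sigma_finite_measure_axioms V.sigma_finite_measure_axioms)
  have "(\<integral>\<^sup>+\<omega>. F (U \<omega>, V \<omega>) \<partial>M) = (\<integral>\<^sup>+x. F x \<partial>(distr M N1 U \<Otimes>\<^sub>M distr M N2 V))"
    unfolding eq by (subst nn_integral_distr) simp_all
  also have "\<dots> = (\<integral>\<^sup>+y. \<integral>\<^sup>+x. F (x, y) \<partial>distr M N1 U \<partial>distr M N2 V)"
    by (rule UV.nn_integral_snd[symmetric, where f=F]) simp
  also have "\<dots> = (\<integral>\<^sup>+\<omega>'. \<integral>\<^sup>+\<omega>. F (U \<omega>, V \<omega>') \<partial>M \<partial>M)"
    by (subst nn_integral_distr) (auto intro!: nn_integral_cong nn_integral_distr)
  finally show ?thesis .
qed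

section \<open>Joint measurability of the classifiers in trees, data and point\<close>

lemma measurable_majority:
  fixes n :: nat
  assumes [measurable]: "\<And>i. i \<in> {1..n} \<Longrightarrow> Measurable.pred M (\<lambda>w. Q w i)"
    "\<And>i. i \<in> {1..n} \<Longrightarrow> Measurable.pred M (\<lambda>w. y w i)"
  shows "Measurable.pred M (\<lambda>w. majority {i \<in> {1..n}. Q w i} (y w))"
proof -
  have "majority {i \<in> {1..n}. Q w i} (y w) \<longleftrightarrow>
    (\<Sum>i=1..n. if Q w i \<and> \<not> y w i then 1 else 0) < (\<Sum>i=1..n. if Q w i \<and> y w i then 1 else (0::nat))" for w
  proof -
    have "(\<Sum>i=1..n. if Q w i \<and> R i then 1 else (0::nat)) = card {i \<in> {i \<in> {1..n}. Q w i}. R i}" for R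
      by (subst sum.inter_filter[symmetric]) (auto intro!: arg_cong[where f=card])
    then show ?thesis unfolding majority_def by (simp only:)
  qed
  then show ?thesis by simp
qed

lemma measurable_tree_classify:
  assumes [measurable]: "t \<in> M \<rightarrow>\<^sub>M draw_tree_space" "x \<in> borel_measurable M"
    and d [measurable]: "\<And>i. i \<in> {1..n} \<Longrightarrow> (\<lambda>w. d w i) \<in> M \<rightarrow>\<^sub>M sample_space"
  shows "Measurable.pred M (\<lambda>w. tree_classify (mondrian_partition C lam (t w)) n (d w) (x w))"
  unfolding tree_classify_def
proof (rule measurable_majority)
  fix i assume i[measurable]: "i \<in> {1..n}"
  have [measurable]: "(\<lambda>w. fst (d w i)) \<in> borel_measurable M" "Measurable.pred M (\<lambda>w. snd (d w i))"
    using d[OF i] by measurable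
  \<comment> \<open>Membership in the leaf of a random point becomes a disjunction over nodes, of
    which there are countably many.\<close>
  have "fst (d w i) \<in> leaf_cell (mondrian_partition C lam (t w)) (x w) \<longleftrightarrow>
    (\<exists>v. is_leaf lam (t w) v \<and> x w \<in> node_cell C (t w) v \<and> fst (d w i) \<in> node_cell C (t w) v)" for w
    by (auto simp: leaf_cell_def mondrian_partition_def)
  then show "Measurable.pred M (\<lambda>w. fst (d w i) \<in> leaf_cell (mondrian_partition C lam (t w)) (x w))"
    by simp
  show "Measurable.pred M (\<lambda>w. snd (d w i))" by measurable
qed

lemma measurable_mondrian_forest:
  assumes t: "\<And>k. k \<in> {1..K} \<Longrightarrow> (\<lambda>w. t w k) \<in> M \<rightarrow>\<^sub>M draw_tree_space" and x: "x \<in> borel_measurable M"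
    and d: "\<And>i. i \<in> {1..n} \<Longrightarrow> (\<lambda>w. d w i) \<in> M \<rightarrow>\<^sub>M sample_space"
  shows "Measurable.pred M (\<lambda>w. mondrian_forest K lam (t w) n (d w) (x w))"
  unfolding mondrian_forest_def
proof -
  have "Measurable.pred M (\<lambda>w. majority {k \<in> {1..K}. True}
      (\<lambda>k. tree_classify (mondrian_partition (0, 1) lam (t w k)) n (d w) (x w)))"
  proof (rule measurable_majority[where Q="\<lambda>_ _. True" and
          y="\<lambda>w k. tree_classify (mondrian_partition (0, 1) lam (t w k)) n (d w) (x w)"])
    fix k assume "k \<in> {1..K}"
    from measurable_tree_classify[OF t[OF this] x d]
    show "Measurable.pred M (\<lambda>w. tree_classify (mondrian_partition (0, 1) lam (t w k)) n (d w) (x w))" .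
  qed simp
  then show "Measurable.pred M (\<lambda>w. majority {1..K} (\<lambda>k. tree_classify (mondrian_partition (0, 1) lam (t w k)) n (d w) (x w)))"
    by (simp only: simp_thms Collect_mem_eq)
qed

text \<open>If no tree deviates from \<open>g\<close>, the vote is unanimous. An empty forest would
  always answer 0, hence \<open>K \<ge> 1\<close>.\<close>

lemma majority_mismatch_le_sum:
  fixes K :: nat
  assumes "K \<ge> 1"
  shows "(if majority {1..K} y \<noteq> g then 1 else 0) \<le> (\<Sum>k=1..K. if y k \<noteq> g then 1 else (0::ennreal))"
proof (cases "\<exists>k\<in>{1..K}. y k \<noteq> g")
  case True
  then obtain k where k: "k \<in> {1..K}" "y k \<noteq> g" by blast
  have "(if majority {1..K} y \<noteq> g then 1 else 0) \<le> (if y k \<noteq> g then 1 else (0::ennreal))" using k by simp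
  also have "\<dots> \<le> (\<Sum>k=1..K. if y k \<noteq> g then 1 else (0::ennreal))"
    by (rule member_le_sum) (use k in auto)
  finally show ?thesis .
next
  case False
  then have "{k \<in> {1..K}. y k} = (if g then {1..K} else {})" "{k \<in> {1..K}. \<not> y k} = (if g then {} else {1..K})"
    by auto
  then have "majority {1..K} y = g"
    using assms by (simp add: majority_def)
  then show ?thesis by simp
qed

section \<open>Consistency\<close>

text \<open>Converts the almost sure characterisation of \<eta> into integral form over events {X
  \<in> A}, which is what \<open>mean_vote\<close> is built from.\<close>

lemma (in prob_space)
  assumes [measurable]: "X \<in> borel_measurable M" "Measurable.pred M Y"
    and reg: "regression_function M X Y \<eta>"
  shows integrable_regression_function: "integrable M (\<lambda>\<omega>. \<eta> (X \<omega>))"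
    and integral_regression_function: "A \<in> sets borel \<Longrightarrow>
      (\<integral>\<omega>. indicator A (X \<omega>) * \<eta> (X \<omega>) \<partial>M) = prob {\<omega> \<in> space M. X \<omega> \<in> A \<and> Y \<omega>}"
proof -
  let ?F = "vimage_algebra (space M) X borel" and ?I = "indicat_real {\<omega> \<in> space M. Y \<omega>}"
  have "subalgebra M ?F"
    by (rule subalgebra_vimage_algebra) simp
  then interpret F: finite_measure_subalgebra M ?F by unfold_locales
  have [measurable]: "\<eta> \<in> borel_measurable borel"
    and ae: "AE \<omega> in M. real_cond_exp M ?F ?I \<omega> = \<eta> (X \<omega>)"
    using reg by (auto simp: regression_function_def)
  have int: "integrable M ?I" by (intro integrable_real_indicator) (auto simp: less_top[symmetric])
  show "integrable M (\<lambda>\<omega>. \<eta> (X \<omega>))"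
    using F.real_cond_exp_int(1)[OF int] integrable_cong_AE[OF _ _ ae] by auto
  assume [measurable]: "A \<in> sets borel"
  let ?S = "X -` A \<inter> space M"
  have S: "?S \<in> sets ?F" by (rule in_vimage_algebra) simp
  have "(\<integral>\<omega>. indicator A (X \<omega>) * \<eta> (X \<omega>) \<partial>M) = (\<integral>\<omega>\<in>?S. real_cond_exp M ?F ?I \<omega> \<partial>M)"
    unfolding set_lebesgue_integral_def
  proof (rule integral_cong_AE)
    show "AE \<omega> in M. indicator A (X \<omega>) * \<eta> (X \<omega>) = indicator ?S \<omega> *\<^sub>R real_cond_exp M ?F ?I \<omega>"
      using ae AE_space by eventually_elim (auto split: split_indicator)
  qed measurable
  also have "\<dots> = (\<integral>\<omega>\<in>?S. ?I \<omega> \<partial>M)"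
    by (rule F.real_cond_exp_intA[OF int S, symmetric])
  also have "\<dots> = (\<integral>\<omega>. indicator {\<omega> \<in> space M. X \<omega> \<in> A \<and> Y \<omega>} \<omega> \<partial>M)"
    unfolding set_lebesgue_integral_def by (rule Bochner_Integration.integral_cong) (auto split: split_indicator)
  also have "\<dots> = prob {\<omega> \<in> space M. X \<omega> \<in> A \<and> Y \<omega>}" by simp
  finally show "(\<integral>\<omega>. indicator A (X \<omega>) * \<eta> (X \<omega>) \<partial>M) = prob {\<omega> \<in> space M. X \<omega> \<in> A \<and> Y \<omega>}" .
qed

text \<open>\<open>fW\<close> identifies the conditional expectation of \<open>f n\<close> as c plus
  that of \<open>W n\<close>. The latter is nonnegative with vanishing mean, so Markov's inequality
  applies.\<close>

lemma (in prob_space) tendsto_in_prob_real_cond_exp: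
  assumes sub: "\<And>n. subalgebra M (F n)" and f: "\<And>n. integrable M (f n)"
    and W: "\<And>n. integrable M (W n)" "\<And>n \<omega>. 0 \<le> W n \<omega>"
    and fW: "\<And>n S. S \<in> sets (F n) \<Longrightarrow> (\<integral>\<omega>\<in>S. f n \<omega> \<partial>M) = c * prob S + (\<integral>\<omega>\<in>S. W n \<omega> \<partial>M)"
    and lim: "(\<lambda>n. \<integral>\<omega>. W n \<omega> \<partial>M) \<longlonglongrightarrow> 0"
  shows "tendsto_in_prob M (\<lambda>n. real_cond_exp M (F n) (f n)) c"
  unfolding tendsto_in_prob_def
proof (intro allI impI)
  fix \<epsilon> :: real assume \<epsilon>: "\<epsilon> > 0"
  have bound: "prob {\<omega> \<in> space M. \<bar>real_cond_exp M (F n) (f n) \<omega> - c\<bar> > \<epsilon>} \<le> (\<integral>\<omega>. W n \<omega> \<partial>M) / \<epsilon>" for n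
  proof -
    interpret F: finite_measure_subalgebra M "F n" by unfold_locales (rule sub)
    let ?E = "real_cond_exp M (F n) (W n)"
    have E: "integrable M ?E" "(\<integral>\<omega>. ?E \<omega> \<partial>M) = (\<integral>\<omega>. W n \<omega> \<partial>M)"
      by (rule F.real_cond_exp_int[OF W(1)])+
    have E_pos: "AE \<omega> in M. ?E \<omega> \<ge> 0"
      by (rule F.real_cond_exp_pos) (use W in auto)
    have [measurable]: "?E \<in> borel_measurable M" "real_cond_exp M (F n) (f n) \<in> borel_measurable M" by simp_all
    have "AE \<omega> in M. real_cond_exp M (F n) (f n) \<omega> = c + ?E \<omega>"
    proof (rule F.real_cond_exp_charact)
      fix S assume S: "S \<in> sets (F n)"
      then have [measurable]: "S \<in> sets M" using sub by (auto simp: subalgebra_def)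
      have S_E: "integrable M (\<lambda>\<omega>. indicator S \<omega> * ?E \<omega>)"
        using integrable_mult_indicator[OF _ E(1), of S] by simp
      have "(\<integral>\<omega>\<in>S. c + ?E \<omega> \<partial>M) = (\<integral>\<omega>. c * indicator S \<omega> + indicator S \<omega> * ?E \<omega> \<partial>M)"
        unfolding set_lebesgue_integral_def by (rule Bochner_Integration.integral_cong) (auto simp: algebra_simps)
      also have "\<dots> = c * prob S + (\<integral>\<omega>\<in>S. ?E \<omega> \<partial>M)"
        by (subst Bochner_Integration.integral_add) (auto simp: S_E set_lebesgue_integral_def emeasure_eq_measure)
      also have "(\<integral>\<omega>\<in>S. ?E \<omega> \<partial>M) = (\<integral>\<omega>\<in>S. W n \<omega> \<partial>M)"
        by (rule F.real_cond_exp_intA[OF W(1) S, symmetric])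
      finally show "(\<integral>\<omega>\<in>S. f n \<omega> \<partial>M) = (\<integral>\<omega>\<in>S. c + ?E \<omega> \<partial>M)"
        unfolding fW[OF S] by simp
    qed (use f E in auto)
    then have "prob {\<omega> \<in> space M. \<bar>real_cond_exp M (F n) (f n) \<omega> - c\<bar> > \<epsilon>} \<le> prob {\<omega> \<in> space M. ?E \<omega> \<ge> \<epsilon>}"
      using E_pos by (intro finite_measure_mono_AE) auto
    also have "\<dots> \<le> (\<integral>\<omega>. ?E \<omega> \<partial>M) / \<epsilon>"
      by (rule integral_Markov_inequality_measure[OF E(1), where A="{}"]) (use E_pos \<epsilon> in auto)
    finally show ?thesis by (simp add: E(2))
  qed
  show "(\<lambda>n. prob {\<omega> \<in> space M. \<bar>real_cond_exp M (F n) (f n) \<omega> - c\<bar> > \<epsilon>}) \<longlonglongrightarrow> 0"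
  proof (rule tendsto_sandwich[OF _ _ tendsto_const])
    show "(\<lambda>n. (\<integral>\<omega>. W n \<omega> \<partial>M) / \<epsilon>) \<longlonglongrightarrow> 0"
      using tendsto_divide[OF lim tendsto_const, of \<epsilon>] \<epsilon> by simp
  qed (auto intro!: always_eventually bound)
qed

lemma majority_cong:
  assumes "I = J" "\<And>i. i \<in> J \<Longrightarrow> y i = y' i"
  shows "majority I y = majority J y'"
proof -
  have "{i \<in> I. y i} = {i \<in> J. y' i}" "{i \<in> I. \<not> y i} = {i \<in> J. \<not> y' i}" using assms by auto
  then show ?thesis by (simp add: majority_def)
qed

text \<open>Product spaces require families restricted to their index set; the classifiers look only
  at indices inside it, so the restricted and original families are interchangeable.\<close>

lemma tree_classify_cong:
  assumes "\<And>i. i \<in> {1..n} \<Longrightarrow> d i = d' i"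
  shows "tree_classify Q n d x = tree_classify Q n d' x"
  unfolding tree_classify_def using assms by (intro majority_cong) auto

lemma mondrian_forest_cong:
  assumes "\<And>k. k \<in> {1..K} \<Longrightarrow> t k = t' k" "\<And>i. i \<in> {1..n} \<Longrightarrow> d i = d' i"
  shows "mondrian_forest K lam t n d x = mondrian_forest K lam t' n d' x"
  unfolding mondrian_forest_def
proof (rule majority_cong)
  fix k assume "k \<in> {1..K}"
  then show "tree_classify (mondrian_partition (0, 1) lam (t k)) n d x = tree_classify (mondrian_partition (0, 1) lam (t' k)) n d' x"
    using assms(1)[of k] tree_classify_cong[of n d d', OF assms(2)] by simp
qed simp

theorem theorem1:
  fixes K :: nat and lam :: "nat \<Rightarrow> real"
    and P :: "((real ^ 'd) \<times> bool) measure"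
    and M :: "'w measure"
    and X :: "'w \<Rightarrow> real ^ 'd" and Y :: "'w \<Rightarrow> bool" and \<eta> :: "real ^ 'd \<Rightarrow> real"
    and D :: "nat \<Rightarrow> 'w \<Rightarrow> (real ^ 'd) \<times> bool"
    and T :: "nat \<Rightarrow> 'w \<Rightarrow> 'd draw_tree"
  assumes "K \<ge> 1"
    and "\<And>n. n \<ge> 1 \<Longrightarrow> lam n > 0"
    and "mono_on {1..} lam"
    and "filterlim lam at_top sequentially"
    and "(\<lambda>n. lam n ^ CARD('d) / real n) \<longlonglongrightarrow> 0"
    and "prob_space P" and "sets P = sets sample_space"
    and "AE z in P. fst z \<in> cbox 0 1"
    and "prob_space M"
    and "(\<lambda>\<omega>. (X \<omega>, Y \<omega>)) \<in> M \<rightarrow>\<^sub>M sample_space"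
    and "distr M sample_space (\<lambda>\<omega>. (X \<omega>, Y \<omega>)) = P"
    and "\<And>i. i \<ge> 1 \<Longrightarrow> distr M sample_space (D i) = P"
    and "prob_space.indep_vars M (\<lambda>_. sample_space) D {1..}"
    and "\<And>k. k \<in> {1..K} \<Longrightarrow> mondrian_process M (0, 1) (T k)"
    and "prob_space.indep_vars M (\<lambda>_. draw_tree_space) T {1..K}"
    and "prob_space.indep_set M
           (sigma_gen M (\<lambda>\<omega>. (X \<omega>, Y \<omega>)) sample_space)
           (sigma_gen M (\<lambda>\<omega>. \<lambda>i\<in>{1..}. D i \<omega>) (Pi\<^sub>M {1..} (\<lambda>_. sample_space)))"
    and "prob_space.indep_set M
           (sigma_gen M (\<lambda>\<omega>. ((X \<omega>, Y \<omega>), \<lambda>i\<in>{1..}. D i \<omega>))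
              (sample_space \<Otimes>\<^sub>M Pi\<^sub>M {1..} (\<lambda>_. sample_space)))
           (sigma_gen M (\<lambda>\<omega>. \<lambda>k\<in>{1..K}. T k \<omega>) (Pi\<^sub>M {1..K} (\<lambda>_. draw_tree_space)))"
    and "regression_function M X Y \<eta>"
  shows "tendsto_in_prob M
           (\<lambda>n. conditional_risk M X Y D n
              (\<lambda>\<omega>. mondrian_forest K (lam n) (\<lambda>k. T k \<omega>) n (\<lambda>i. D i \<omega>)))
           (bayes_risk M X Y \<eta>)"
proof -
  interpret prob_space M by fact
  note K = assms(1) and distr_XY = assms(11)
  define h where "h x = 2 * \<eta> x - 1" for x
  define U where "U \<omega> = (X \<omega>, Y \<omega>)" for \<omega>
  \<comment> \<open>Restricted families, so that they are random elements of the product spaces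
    named in the independence assumptions.\<close>
  define DD where "DD \<omega> = (\<lambda>i\<in>{1..}. D i \<omega>)" for \<omega>
  define TT where "TT \<omega> = (\<lambda>k\<in>{1..K}. T k \<omega>)" for \<omega>
  let ?NS = "Pi\<^sub>M {1..} (\<lambda>_. sample_space) :: (nat \<Rightarrow> 'd sample) measure"
  let ?NT = "Pi\<^sub>M {1..K} (\<lambda>_. draw_tree_space) :: (nat \<Rightarrow> 'd draw_tree) measure"
  let ?N3 = "(sample_space \<Otimes>\<^sub>M ?NS) \<Otimes>\<^sub>M ?NT"
  have U[measurable]: "U \<in> M \<rightarrow>\<^sub>M sample_space" unfolding U_def by fact
  have X[measurable]: "X \<in> borel_measurable M"
    using measurable_compose[OF assms(10) measurable_fst] by simp
  have Y[measurable]: "Measurable.pred M Y"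
    using measurable_compose[OF assms(10) measurable_snd] by simp
  have mD: "D i \<in> M \<rightarrow>\<^sub>M sample_space" if "i \<ge> 1" for i
    using assms(13) that by (auto simp: indep_vars_def)
  have mT: "T k \<in> M \<rightarrow>\<^sub>M draw_tree_space" if "k \<in> {1..K}" for k
    using assms(15) that by (auto simp: indep_vars_def)
  have DD[measurable]: "DD \<in> M \<rightarrow>\<^sub>M ?NS" unfolding DD_def by (intro measurable_restrict mD) simp
  have TT[measurable]: "TT \<in> M \<rightarrow>\<^sub>M ?NT" unfolding TT_def by (intro measurable_restrict mT)
  have [measurable]: "\<eta> \<in> borel_measurable borel"
    using assms(18) by (simp add: regression_function_def)
  have h[measurable]: "h \<in> borel_measurable borel" unfolding h_def by measurable
  note [measurable_cong] = assms(7)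
  have P_X: "distr P borel fst = distr M borel X"
    unfolding distr_XY[symmetric] by (subst distr_distr) (auto simp: comp_def assms(10))
  note int_\<eta> = integrable_regression_function[OF X Y assms(18)]
  have int_h: "integrable M (\<lambda>\<omega>. h (X \<omega>))" using int_\<eta> unfolding h_def by simp
  interpret iid_sample M D P h
  proof
    show "integrable (distr P borel fst) h"
      unfolding P_X using int_h by (subst integrable_distr_eq) auto
    fix A :: "(real ^ 'd) set" assume A[measurable]: "A \<in> sets borel"
    have int_A: "integrable M (\<lambda>\<omega>. indicator A (X \<omega>) * \<eta> (X \<omega>))"
      by (rule Bochner_Integration.integrable_bound[OF int_\<eta>]) (auto split: split_indicator)
    have "(\<integral>z. vote A z \<partial>P) = (\<integral>\<omega>. vote A (U \<omega>) \<partial>M)"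
      unfolding distr_XY[symmetric] U_def[symmetric] by (rule integral_distr) measurable
    \<comment> \<open>A signed label is 2Y - 1, matching \<open>h\<close> = 2\<eta> - 1.\<close>
    also have "\<dots> = (\<integral>\<omega>. 2 * indicator {\<omega> \<in> space M. X \<omega> \<in> A \<and> Y \<omega>} \<omega> - indicator {\<omega> \<in> space M. X \<omega> \<in> A} \<omega> \<partial>M)"
      by (rule Bochner_Integration.integral_cong) (auto simp: vote_def U_def split: split_indicator)
    also have "\<dots> = 2 * prob {\<omega> \<in> space M. X \<omega> \<in> A \<and> Y \<omega>} - (\<integral>\<omega>. indicator {\<omega> \<in> space M. X \<omega> \<in> A} \<omega> \<partial>M)"
      by (subst Bochner_Integration.integral_diff) (auto simp: emeasure_eq_measure)
    also have "prob {\<omega> \<in> space M. X \<omega> \<in> A \<and> Y \<omega>} = (\<integral>\<omega>. indicator A (X \<omega>) * \<eta> (X \<omega>) \<partial>M)"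
      by (rule integral_regression_function[OF X Y assms(18) A, symmetric])
    also have "(\<integral>\<omega>. indicator {\<omega> \<in> space M. X \<omega> \<in> A} \<omega> \<partial>M) = (\<integral>\<omega>. indicator A (X \<omega>) \<partial>M)"
      by (rule Bochner_Integration.integral_cong) (auto split: split_indicator)
    also have "2 * (\<integral>\<omega>. indicator A (X \<omega>) * \<eta> (X \<omega>) \<partial>M) - (\<integral>\<omega>. indicator A (X \<omega>) \<partial>M)
        = (\<integral>\<omega>. 2 * (indicator A (X \<omega>) * \<eta> (X \<omega>)) - indicator A (X \<omega>) \<partial>M)"
      by (subst Bochner_Integration.integral_diff)
         (auto intro!: int_A integrable_const_bound[where B=1] split: split_indicator)
    also have "\<dots> = (\<integral>\<omega>. indicator A (X \<omega>) * h (X \<omega>) \<partial>M)"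
      by (rule Bochner_Integration.integral_cong) (auto simp: h_def split: split_indicator)
    also have "\<dots> = (\<integral>x. indicator A x * h x \<partial>distr P borel fst)"
      unfolding P_X by (rule integral_distr[symmetric]) measurable
    finally show "(\<integral>z. vote A z \<partial>P) = (\<integral>x. indicator A x * h x \<partial>distr P borel fst)" .
  qed (use assms in auto)

  \<comment> \<open>Decoupling the test point, the data and the trees\<close>
  have decouple: "(\<integral>\<^sup>+\<omega>. F ((U \<omega>, DD \<omega>), TT \<omega>) \<partial>M) = (\<integral>\<^sup>+\<omega>'. \<integral>\<^sup>+\<omega>. \<integral>\<^sup>+z. F ((z, DD \<omega>), TT \<omega>') \<partial>P \<partial>M \<partial>M)"
    if F[measurable]: "F \<in> borel_measurable ?N3" for F
  proof -
    have indep_T: "indep_set (sigma_gen M (\<lambda>\<omega>. (U \<omega>, DD \<omega>)) (sample_space \<Otimes>\<^sub>M ?NS)) (sigma_gen M TT ?NT)"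
      and indep_D: "indep_set (sigma_gen M U sample_space) (sigma_gen M DD ?NS)"
      using assms(16,17) unfolding U_def DD_def TT_def by blast+
    \<comment> \<open>Independence is used twice: first the trees are separated from the pair of
      test point and data, then the test point from the data.\<close>
    have "(\<integral>\<^sup>+\<omega>. F ((U \<omega>, DD \<omega>), TT \<omega>) \<partial>M) = (\<integral>\<^sup>+\<omega>'. \<integral>\<^sup>+\<omega>. F ((U \<omega>, DD \<omega>), TT \<omega>') \<partial>M \<partial>M)"
      by (rule indep_set_nn_integral[OF _ TT F indep_T]) measurable
    also have "\<dots> = (\<integral>\<^sup>+\<omega>'. \<integral>\<^sup>+\<omega>. \<integral>\<^sup>+z. F ((z, DD \<omega>), TT \<omega>') \<partial>P \<partial>M \<partial>M)"
    proof (rule nn_integral_cong)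
      fix \<omega>' assume "\<omega>' \<in> space M"
      then have t: "TT \<omega>' \<in> space ?NT" by (rule measurable_space[OF TT])
      have F': "(\<lambda>p. F (p, TT \<omega>')) \<in> borel_measurable (sample_space \<Otimes>\<^sub>M ?NS)"
        using t by measurable
      have "(\<integral>\<^sup>+\<omega>. F ((U \<omega>, DD \<omega>), TT \<omega>') \<partial>M) = (\<integral>\<^sup>+\<omega>''. \<integral>\<^sup>+\<omega>. F ((U \<omega>, DD \<omega>''), TT \<omega>') \<partial>M \<partial>M)"
        by (rule indep_set_nn_integral[OF U DD F' indep_D])
      also have "\<dots> = (\<integral>\<^sup>+\<omega>''. \<integral>\<^sup>+z. F ((z, DD \<omega>''), TT \<omega>') \<partial>P \<partial>M)"
      proof (rule nn_integral_cong)
        fix \<omega>'' assume "\<omega>'' \<in> space M"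
        then have "DD \<omega>'' \<in> space ?NS" by (rule measurable_space[OF DD])
        then have "(\<lambda>z. F ((z, DD \<omega>''), TT \<omega>')) \<in> borel_measurable sample_space"
          using t by measurable
        then show "(\<integral>\<^sup>+\<omega>. F ((U \<omega>, DD \<omega>''), TT \<omega>') \<partial>M) = (\<integral>\<^sup>+z. F ((z, DD \<omega>''), TT \<omega>') \<partial>P)"
          unfolding distr_XY[symmetric] U_def[symmetric] by (subst nn_integral_distr) auto
      qed
      finally show "(\<integral>\<^sup>+\<omega>. F ((U \<omega>, DD \<omega>), TT \<omega>') \<partial>M) = (\<integral>\<^sup>+\<omega>. \<integral>\<^sup>+z. F ((z, DD \<omega>), TT \<omega>') \<partial>P \<partial>M)" .
    qed
    finally show ?thesis .
  qed
  have proj_t: "(\<lambda>w. snd w k) \<in> ?N3 \<rightarrow>\<^sub>M draw_tree_space" if "k \<in> {1..K}" for k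
    using measurable_compose[OF measurable_snd measurable_component_singleton[OF that]] by simp
  have proj_d: "(\<lambda>w. snd (fst w) i) \<in> ?N3 \<rightarrow>\<^sub>M sample_space" if "i \<in> {1..n}" for i n
    using measurable_compose[OF measurable_compose[OF measurable_fst measurable_snd] measurable_component_singleton[of i "{1..}"]] that
    by simp
  have proj_x: "(\<lambda>w. fst (fst (fst w))) \<in> borel_measurable ?N3"
    by measurable

  \<comment> \<open>Expected excess risk of each tree\<close>
  define vote_k where "vote_k n k \<omega> = tree_classify (mondrian_partition (0, 1) (lam n) (T k \<omega>)) n (\<lambda>i. D i \<omega>) (X \<omega>)" for n k \<omega>
  define R where "R n k = (\<integral>\<^sup>+\<omega>. ennreal \<bar>h (X \<omega>)\<bar> * (if vote_k n k \<omega> \<noteq> (h (X \<omega>) > 0) then 1 else 0) \<partial>M)" for n k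
  have R_lim: "(\<lambda>n. R n k) \<longlonglongrightarrow> 0" if k: "k \<in> {1..K}" for k
  proof -
    have "mondrian_tree M (0, 1) (T k)"
      by unfold_locales (use assms(14)[OF k] in \<open>auto simp: side_def\<close>)
    moreover have "AE x in distr P borel fst. x \<in> cbox 0 1"
      using assms(8) by (subst AE_distr_iff) auto
    ultimately have lim: "(\<lambda>n. \<integral>\<^sup>+\<omega>'. \<integral>\<^sup>+\<omega>. \<integral>\<^sup>+x. ennreal \<bar>h x\<bar> *
        (if tree_classify (mondrian_partition (0, 1) (lam n) (T k \<omega>')) n (\<lambda>i. D i \<omega>) x \<noteq> (h x > 0) then 1 else 0) \<partial>distr P borel fst \<partial>M \<partial>M) \<longlonglongrightarrow> 0"
      by (rule tree_risk_tendsto_0) fact+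
    \<comment> \<open>Under the joint law the test point, data and tree share one \<omega>;
      decoupling brings \<open>R n k\<close> to the iterated form treated by
      \<open>tree_risk_tendsto_0\<close>.\<close>
    have "R n k = (\<integral>\<^sup>+\<omega>'. \<integral>\<^sup>+\<omega>. \<integral>\<^sup>+x. ennreal \<bar>h x\<bar> *
        (if tree_classify (mondrian_partition (0, 1) (lam n) (T k \<omega>')) n (\<lambda>i. D i \<omega>) x \<noteq> (h x > 0) then 1 else 0) \<partial>distr P borel fst \<partial>M \<partial>M)" for n
    proof -
      let ?tc = "\<lambda>w. tree_classify (mondrian_partition (0, 1) (lam n) (snd w k)) n (snd (fst w)) (fst (fst (fst w)))"
      define F where "F w = ennreal \<bar>h (fst (fst (fst w)))\<bar> * (if ?tc w \<noteq> (h (fst (fst (fst w))) > 0) then 1 else 0)"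
        for w :: "('d sample \<times> (nat \<Rightarrow> 'd sample)) \<times> (nat \<Rightarrow> 'd draw_tree)"
      have [measurable]: "Measurable.pred ?N3 ?tc"
        by (rule measurable_tree_classify[OF proj_t[OF k] proj_x proj_d])
      have mF: "F \<in> borel_measurable ?N3"
        unfolding F_def by measurable
      have restr: "tree_classify (mondrian_partition (0, 1) (lam n) (TT \<omega>' k)) n (DD \<omega>) x =
        tree_classify (mondrian_partition (0, 1) (lam n) (T k \<omega>')) n (\<lambda>i. D i \<omega>) x" for \<omega> \<omega>' x
        using k tree_classify_cong[of n "DD \<omega>" "\<lambda>i. D i \<omega>"] by (simp add: TT_def DD_def)
      have "R n k = (\<integral>\<^sup>+\<omega>. F ((U \<omega>, DD \<omega>), TT \<omega>) \<partial>M)"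
        unfolding R_def F_def fst_conv snd_conv restr by (simp add: U_def vote_k_def)
      also have "\<dots> = (\<integral>\<^sup>+\<omega>'. \<integral>\<^sup>+\<omega>. \<integral>\<^sup>+z. F ((z, DD \<omega>), TT \<omega>') \<partial>P \<partial>M \<partial>M)"
        by (rule decouple[OF mF])
      also have "\<dots> = (\<integral>\<^sup>+\<omega>'. \<integral>\<^sup>+\<omega>. \<integral>\<^sup>+x. ennreal \<bar>h x\<bar> *
        (if tree_classify (mondrian_partition (0, 1) (lam n) (T k \<omega>')) n (\<lambda>i. D i \<omega>) x \<noteq> (h x > 0) then 1 else 0) \<partial>distr P borel fst \<partial>M \<partial>M)"
        unfolding F_def fst_conv snd_conv restr
      proof (intro nn_integral_cong)
        fix \<omega>' \<omega>
        let ?G = "tree_classify (mondrian_partition (0, 1) (lam n) (T k \<omega>')) n (\<lambda>i. D i \<omega>)"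
        have [measurable]: "Measurable.pred borel (tree_classify (mondrian_partition (0, 1) (lam n) (T k \<omega>')) n (\<lambda>i. D i \<omega>))"
          by (rule measurable_tree_classify[where t="\<lambda>_. T k \<omega>'" and x="\<lambda>x. x" and d="\<lambda>_ i. D i \<omega>"])
             (auto simp: space_PiM space_pair_measure)
        show "(\<integral>\<^sup>+z. ennreal \<bar>h (fst z)\<bar> * (if ?G (fst z) \<noteq> (h (fst z) > 0) then 1 else 0) \<partial>P)
          = (\<integral>\<^sup>+x. ennreal \<bar>h x\<bar> * (if ?G x \<noteq> (h x > 0) then 1 else 0) \<partial>distr P borel fst)"
          by (rule nn_integral_distr[symmetric]) measurable
      qed
      finally show ?thesis .
    qed
    with lim show ?thesis by simp
  qed

  \<comment> \<open>Expected excess risk of the forest\<close>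
  define forest where "forest n \<omega> = mondrian_forest K (lam n) (\<lambda>k. T k \<omega>) n (\<lambda>i. D i \<omega>)" for n \<omega>
  define W where "W n \<omega> = \<bar>h (X \<omega>)\<bar> * (if forest n \<omega> (X \<omega>) \<noteq> (h (X \<omega>) > 0) then 1 else 0)" for n \<omega>
  have m_forest[measurable]: "Measurable.pred M (\<lambda>\<omega>. forest n \<omega> (X \<omega>))" for n
    unfolding forest_def by (rule measurable_mondrian_forest) (auto intro: mT mD)
  have m_vote[measurable]: "Measurable.pred M (vote_k n k)" if "k \<in> {1..K}" for n k
    unfolding vote_k_def by (rule measurable_tree_classify) (use that in \<open>auto intro: mT mD\<close>)
  have W_int: "integrable M (W n)" for n
    unfolding W_def by (rule Bochner_Integration.integrable_bound[OF int_h]) auto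
  have W_le: "ennreal (\<integral>\<omega>. W n \<omega> \<partial>M) \<le> (\<Sum>k=1..K. R n k)" for n
  proof -
    have "ennreal (\<integral>\<omega>. W n \<omega> \<partial>M) = (\<integral>\<^sup>+\<omega>. ennreal (W n \<omega>) \<partial>M)"
      by (rule nn_integral_eq_integral[symmetric]) (auto simp: W_int, simp add: W_def)
    also have "\<dots> \<le> (\<integral>\<^sup>+\<omega>. (\<Sum>k=1..K. ennreal \<bar>h (X \<omega>)\<bar> * (if vote_k n k \<omega> \<noteq> (h (X \<omega>) > 0) then 1 else 0)) \<partial>M)"
    proof (rule nn_integral_mono)
      fix \<omega>
      have "ennreal (W n \<omega>) = ennreal \<bar>h (X \<omega>)\<bar> * (if majority {1..K} (\<lambda>k. vote_k n k \<omega>) \<noteq> (h (X \<omega>) > 0) then 1 else 0)"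
        by (simp add: W_def forest_def mondrian_forest_def vote_k_def)
      \<comment> \<open>The union bound over the K trees, for each outcome; K stays fixed, so the
        sum of the tree risks still tends to 0.\<close>
      also have "\<dots> \<le> ennreal \<bar>h (X \<omega>)\<bar> * (\<Sum>k=1..K. if vote_k n k \<omega> \<noteq> (h (X \<omega>) > 0) then 1 else 0)"
        by (intro mult_left_mono majority_mismatch_le_sum K) simp
      finally show "ennreal (W n \<omega>) \<le> (\<Sum>k=1..K. ennreal \<bar>h (X \<omega>)\<bar> * (if vote_k n k \<omega> \<noteq> (h (X \<omega>) > 0) then 1 else 0))"
        by (simp add: sum_distrib_left)
    qed
    also have "\<dots> = (\<Sum>k=1..K. R n k)"
      unfolding R_def by (rule nn_integral_sum) measurable
    finally show ?thesis .
  qed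
  have W_lim: "(\<lambda>n. \<integral>\<omega>. W n \<omega> \<partial>M) \<longlonglongrightarrow> 0"
  proof -
    have "(\<lambda>n. \<Sum>k=1..K. R n k) \<longlonglongrightarrow> (\<Sum>k=1..K. 0)"
      by (intro tendsto_sum R_lim)
    then have R_sum: "(\<lambda>n. \<Sum>k=1..K. R n k) \<longlonglongrightarrow> 0" by simp
    have lim: "(\<lambda>n. ennreal (\<integral>\<omega>. W n \<omega> \<partial>M)) \<longlonglongrightarrow> ennreal 0"
      unfolding ennreal_0
      by (rule tendsto_sandwich[OF _ _ tendsto_const R_sum]) (intro always_eventually allI W_le zero_le)+
    have W_nonneg: "0 \<le> (\<integral>\<omega>. W n \<omega> \<partial>M)" for n
      by (rule Bochner_Integration.integral_nonneg) (simp add: W_def)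
    show ?thesis
      by (rule tendsto_ennrealD[OF lim]) (simp_all add: W_nonneg)
  qed
  have bayes: "bayes_risk M X Y \<eta> = measure P {z \<in> space P. (h (fst z) > 0) \<noteq> snd z}"
  proof -
    have "measure P {z \<in> space P. (h (fst z) > 0) \<noteq> snd z} = prob (U -` {z \<in> space sample_space. (h (fst z) > 0) \<noteq> snd z} \<inter> space M)"
      unfolding distr_XY[symmetric] U_def[symmetric] space_distr by (rule measure_distr) measurable
    also have "U -` {z \<in> space sample_space. (h (fst z) > 0) \<noteq> snd z} \<inter> space M = {\<omega> \<in> space M. bayes_classifier \<eta> (X \<omega>) \<noteq> Y \<omega>}"
      by (auto simp: U_def h_def space_pair_measure bayes_classifier_def)
    finally show ?thesis by (simp add: bayes_risk_def)
  qed

  \<comment> \<open>The conditional risk on events of the data\<close>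
  let ?N = "\<lambda>n. Pi\<^sub>M {1..n} (\<lambda>_. sample_space) :: (nat \<Rightarrow> 'd sample) measure"
  let ?F = "\<lambda>n. vimage_algebra (space M) (\<lambda>\<omega>. \<lambda>i\<in>{1..n}. D i \<omega>) (?N n)"
  have mDn: "(\<lambda>\<omega>. \<lambda>i\<in>{1..n}. D i \<omega>) \<in> M \<rightarrow>\<^sub>M ?N n" for n
    by (intro measurable_restrict mD) simp
  have sub: "subalgebra M (?F n)" for n
    by (rule subalgebra_vimage_algebra[OF mDn])
  have key: "(\<integral>\<omega>\<in>S. indicat_real {\<omega> \<in> space M. forest n \<omega> (X \<omega>) \<noteq> Y \<omega>} \<omega> \<partial>M)
      = bayes_risk M X Y \<eta> * prob S + (\<integral>\<omega>\<in>S. W n \<omega> \<partial>M)" if S: "S \<in> sets (?F n)" for S n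
  proof -
    have "(\<lambda>\<omega>. \<lambda>i\<in>{1..n}. D i \<omega>) \<in> space M \<rightarrow> space (?N n)"
      by (rule funcsetI) (rule measurable_space[OF mDn])
    from S[unfolded sets_vimage_algebra2[OF this] mem_Collect_eq]
    obtain B where S_eq: "S = (\<lambda>\<omega>. \<lambda>i\<in>{1..n}. D i \<omega>) -` B \<inter> space M" and B[measurable]: "B \<in> sets (?N n)"
      by (elim exE conjE)
    have [measurable]: "S \<in> sets M" using S sub[of n] unfolding subalgebra_def by (elim conjE subsetD)
    \<comment> \<open>An event of the first n observations becomes a function of \<open>DD\<close>,
      hence admissible in \<open>decouple\<close>.\<close>
    have S_DD: "indicator S \<omega> = indicator B (restrict (DD \<omega>) {1..n})" if "\<omega> \<in> space M" for \<omega>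
    proof -
      have "restrict (DD \<omega>) {1..n} = (\<lambda>i\<in>{1..n}. D i \<omega>)" by (auto simp: DD_def)
      then show ?thesis using that by (simp add: S_eq split: split_indicator)
    qed
    let ?g = "\<lambda>w. mondrian_forest K (lam n) (snd w) n (snd (fst w)) (fst (fst (fst w)))"
    have [measurable]: "Measurable.pred ?N3 ?g"
      by (rule measurable_mondrian_forest[OF proj_t proj_x proj_d])
    have [measurable]: "(\<lambda>w. restrict (snd (fst w)) {1..n}) \<in> ?N3 \<rightarrow>\<^sub>M ?N n"
      by (intro measurable_restrict proj_d)
    have restr: "mondrian_forest K (lam n) (TT \<omega>') n (DD \<omega>) x = mondrian_forest K (lam n) (\<lambda>k. T k \<omega>') n (\<lambda>i. D i \<omega>) x" for \<omega> \<omega>' x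
      by (rule mondrian_forest_cong) (auto simp: TT_def DD_def)
    let ?c = "bayes_risk M X Y \<eta>"
    let ?G = "\<lambda>\<omega>' \<omega>. mondrian_forest K (lam n) (\<lambda>k. T k \<omega>') n (\<lambda>i. D i \<omega>)"
    define F1 F2 where "F1 w = indicator B (restrict (snd (fst w)) {1..n}) * (if ?g w \<noteq> snd (fst (fst w)) then 1 else (0::ennreal))"
      and "F2 w = indicator B (restrict (snd (fst w)) {1..n}) *
          (ennreal \<bar>h (fst (fst (fst w)))\<bar> * (if ?g w \<noteq> (h (fst (fst (fst w))) > 0) then 1 else 0))"
      for w :: "('d sample \<times> (nat \<Rightarrow> 'd sample)) \<times> (nat \<Rightarrow> 'd draw_tree)"
    have mF: "F1 \<in> borel_measurable ?N3" "F2 \<in> borel_measurable ?N3"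
      unfolding F1_def F2_def by measurable
    \<comment> \<open>With data and trees frozen the forest is a deterministic classifier, and
      \<open>excess_risk\<close> applies to the fresh test point.\<close>
    have inner: "(\<integral>\<^sup>+z. F1 ((z, DD \<omega>), TT \<omega>') \<partial>P) = indicator S \<omega> * ennreal ?c + (\<integral>\<^sup>+z. F2 ((z, DD \<omega>), TT \<omega>') \<partial>P)"
      if "\<omega> \<in> space M" for \<omega> \<omega>'
    proof -
      have [measurable]: "Measurable.pred borel (?G \<omega>' \<omega>)"
        by (rule measurable_mondrian_forest[where t="\<lambda>_ k. T k \<omega>'" and x="\<lambda>x. x" and d="\<lambda>_ i. D i \<omega>"])
           (auto simp: space_PiM space_pair_measure)
      have "(\<integral>\<^sup>+z. F1 ((z, DD \<omega>), TT \<omega>') \<partial>P) = (\<integral>\<^sup>+z. indicator S \<omega> * indicator {z \<in> space P. ?G \<omega>' \<omega> (fst z) \<noteq> snd z} z \<partial>P)"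
        unfolding F1_def fst_conv snd_conv restr S_DD[OF that] by (rule nn_integral_cong) (auto split: split_indicator)
      also have "\<dots> = indicator S \<omega> * emeasure P {z \<in> space P. ?G \<omega>' \<omega> (fst z) \<noteq> snd z}"
        by (rule nn_integral_cmult_indicator) measurable
      also have "\<dots> = indicator S \<omega> * (ennreal ?c + (\<integral>\<^sup>+x. ennreal \<bar>h x\<bar> * (if ?G \<omega>' \<omega> x \<noteq> (h x > 0) then 1 else 0) \<partial>distr P borel fst))"
        unfolding bayes by (subst excess_risk) simp_all
      also have "(\<integral>\<^sup>+x. ennreal \<bar>h x\<bar> * (if ?G \<omega>' \<omega> x \<noteq> (h x > 0) then 1 else 0) \<partial>distr P borel fst)
          = (\<integral>\<^sup>+z. ennreal \<bar>h (fst z)\<bar> * (if ?G \<omega>' \<omega> (fst z) \<noteq> (h (fst z) > 0) then 1 else 0) \<partial>P)"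
        by (rule nn_integral_distr) measurable
      also have "indicator S \<omega> * (ennreal ?c + (\<integral>\<^sup>+z. ennreal \<bar>h (fst z)\<bar> * (if ?G \<omega>' \<omega> (fst z) \<noteq> (h (fst z) > 0) then 1 else 0) \<partial>P))
        = indicator S \<omega> * ennreal ?c + (\<integral>\<^sup>+z. F2 ((z, DD \<omega>), TT \<omega>') \<partial>P)"
        unfolding F2_def fst_conv snd_conv restr S_DD[OF that] by (subst nn_integral_cmult) (auto simp: distrib_left)
      finally show ?thesis .
    qed
    have int_f: "integrable M (\<lambda>\<omega>. indicator S \<omega> * indicat_real {\<omega> \<in> space M. forest n \<omega> (X \<omega>) \<noteq> Y \<omega>} \<omega>)"
      by (rule integrable_const_bound[where B=1]) (auto split: split_indicator)
    have int_W: "integrable M (\<lambda>\<omega>. indicator S \<omega> * W n \<omega>)"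
      using integrable_mult_indicator[OF _ W_int, of S n] by simp
    have W0: "0 \<le> W n \<omega>" for \<omega> by (simp add: W_def)
    have "ennreal (\<integral>\<omega>. indicator S \<omega> * indicat_real {\<omega> \<in> space M. forest n \<omega> (X \<omega>) \<noteq> Y \<omega>} \<omega> \<partial>M)
      = (\<integral>\<^sup>+\<omega>. ennreal (indicator S \<omega> * indicat_real {\<omega> \<in> space M. forest n \<omega> (X \<omega>) \<noteq> Y \<omega>} \<omega>) \<partial>M)"
      by (rule nn_integral_eq_integral[symmetric, OF int_f]) simp
    also have "\<dots> = (\<integral>\<^sup>+\<omega>. F1 ((U \<omega>, DD \<omega>), TT \<omega>) \<partial>M)"
    proof (rule nn_integral_cong)
      fix \<omega> assume \<omega>: "\<omega> \<in> space M"
      show "ennreal (indicator S \<omega> * indicat_real {\<omega> \<in> space M. forest n \<omega> (X \<omega>) \<noteq> Y \<omega>} \<omega>) = F1 ((U \<omega>, DD \<omega>), TT \<omega>)"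
        unfolding F1_def fst_conv snd_conv restr S_DD[OF \<omega>, symmetric]
        using \<omega> by (simp add: U_def forest_def split: split_indicator)
    qed
    also have "\<dots> = (\<integral>\<^sup>+\<omega>'. \<integral>\<^sup>+\<omega>. \<integral>\<^sup>+z. F1 ((z, DD \<omega>), TT \<omega>') \<partial>P \<partial>M \<partial>M)"
      by (rule decouple[OF mF(1)])
    also have "\<dots> = (\<integral>\<^sup>+\<omega>'. \<integral>\<^sup>+\<omega>. indicator S \<omega> * ennreal ?c + (\<integral>\<^sup>+z. F2 ((z, DD \<omega>), TT \<omega>') \<partial>P) \<partial>M \<partial>M)"
      by (intro nn_integral_cong inner)
    \<comment> \<open>The constant moves under the integral over the probability measure P, so that
      the whole integrand has the shape needed to run \<open>decouple\<close> backwards.\<close>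
    also have "\<dots> = (\<integral>\<^sup>+\<omega>'. \<integral>\<^sup>+\<omega>. \<integral>\<^sup>+z. indicator B (restrict (DD \<omega>) {1..n}) * ennreal ?c + F2 ((z, DD \<omega>), TT \<omega>') \<partial>P \<partial>M \<partial>M)"
    proof (intro nn_integral_cong)
      fix \<omega>' \<omega> assume \<omega>: "\<omega> \<in> space M" "\<omega>' \<in> space M"
      interpret P: prob_space P by fact
      have "(\<lambda>z. F2 ((z, DD \<omega>), TT \<omega>')) \<in> borel_measurable P"
        using mF(2) measurable_space[OF DD \<omega>(1)] measurable_space[OF TT \<omega>(2)] by measurable
      then show "indicator S \<omega> * ennreal ?c + (\<integral>\<^sup>+z. F2 ((z, DD \<omega>), TT \<omega>') \<partial>P)
          = (\<integral>\<^sup>+z. indicator B (restrict (DD \<omega>) {1..n}) * ennreal ?c + F2 ((z, DD \<omega>), TT \<omega>') \<partial>P)"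
        by (subst nn_integral_add) (simp_all add: S_DD[OF \<omega>(1)] P.emeasure_space_1)
    qed
    also have "\<dots> = (\<integral>\<^sup>+\<omega>. indicator B (restrict (DD \<omega>) {1..n}) * ennreal ?c + F2 ((U \<omega>, DD \<omega>), TT \<omega>) \<partial>M)"
    proof -
      note [measurable] = mF(2)
      have "(\<lambda>w. indicator B (restrict (snd (fst w)) {1..n}) * ennreal ?c + F2 w) \<in> borel_measurable ?N3"
        by measurable
      from decouple[OF this, symmetric] show ?thesis unfolding fst_conv snd_conv .
    qed
    also have "\<dots> = (\<integral>\<^sup>+\<omega>. ennreal (?c * indicator S \<omega> + indicator S \<omega> * W n \<omega>) \<partial>M)"
    proof (rule nn_integral_cong)
      fix \<omega> assume \<omega>: "\<omega> \<in> space M"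
      have "indicator B (restrict (DD \<omega>) {1..n}) * ennreal ?c + F2 ((U \<omega>, DD \<omega>), TT \<omega>) = indicator S \<omega> * (ennreal ?c + ennreal (W n \<omega>))"
        unfolding F2_def fst_conv snd_conv restr S_DD[OF \<omega>, symmetric]
        by (simp add: U_def forest_def W_def distrib_left)
      also have "\<dots> = ennreal (?c * indicator S \<omega> + indicator S \<omega> * W n \<omega>)"
        using W0[of \<omega>] by (simp add: bayes split: split_indicator)
      finally show "indicator B (restrict (DD \<omega>) {1..n}) * ennreal ?c + F2 ((U \<omega>, DD \<omega>), TT \<omega>) = ennreal (?c * indicator S \<omega> + indicator S \<omega> * W n \<omega>)" .
    qed
    also have "\<dots> = ennreal (\<integral>\<omega>. ?c * indicator S \<omega> + indicator S \<omega> * W n \<omega> \<partial>M)"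
      by (rule nn_integral_eq_integral) (auto simp: int_W emeasure_eq_measure bayes W0)
    also have "(\<integral>\<omega>. ?c * indicator S \<omega> + indicator S \<omega> * W n \<omega> \<partial>M) = ?c * prob S + (\<integral>\<omega>. indicator S \<omega> * W n \<omega> \<partial>M)"
      by (subst Bochner_Integration.integral_add) (auto simp: int_W emeasure_eq_measure)
    finally have "(\<integral>\<omega>. indicator S \<omega> * indicat_real {\<omega> \<in> space M. forest n \<omega> (X \<omega>) \<noteq> Y \<omega>} \<omega> \<partial>M)
        = ?c * prob S + (\<integral>\<omega>. indicator S \<omega> * W n \<omega> \<partial>M)"
      \<comment> \<open>Both sides are nonnegative reals, so the identity in \<open>ennreal\<close>
        descends to the reals.\<close>
      by (subst (asm) ennreal_inj) (auto simp: bayes W0 intro!: Bochner_Integration.integral_nonneg add_nonneg_nonneg mult_nonneg_nonneg)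
    then show ?thesis by (simp add: set_lebesgue_integral_def)
  qed
  show ?thesis
    unfolding conditional_risk_def forest_def[symmetric]
    by (rule tendsto_in_prob_real_cond_exp[OF sub _ W_int _ key W_lim])
       (auto simp: W_def emeasure_eq_measure)
qed

end
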